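(* Let $d_{11},d_{22}\ge0$ and $d_1,d_2,d_{12},d_{21}>0$ be constants. Let $\rho_1,\rho_2,\sigma_1,\sigma_2\in L^\infty(\mathbb{T})$ be non-negative kernels with $\rho_1(x)=\rho_2(-x)=\rho(x)$, $\sigma_1(x)=\sigma_1(-x)$, $\sigma_2(x)=\sigma_2(-x)$, and let $u_1^0,u_2^0\in L^1(\mathbb{T})$ be non-negative with $h_1(u_1^0),h_2(u_2^0)\in L^1(\mathbb{T})$. Let $T>0$ and let $(\mathcal{D}_m)_{m\in\mathbb{N}}$ be a family of space-time discretizations of $Q_T=\mathbb{T}\times(0,T)$, with space step $\Delta x_m$ and time step $\Delta t_m$, such that $\eta_m=\max\{\Delta x_m,\Delta t_m\}\to0$ as $m\to\infty$. For each $m$, let $(u_{1,m},u_{2,m})$ be the piecewise constant reconstruction of a nonnegative solution to the scheme (S) on $\mathcal{D}_m$ satisfying the mass conservation and entropy inequality stated in the context (such solutions exist). Then there exists $(u_1,u_2)\in(L^p(Q_T))^2$ for $p\in[1,3)$, a distributional solution of the nonlocal cross-diffusion system (in the sense defined in the context), such that, up to a subsequence, for $j=1,2$, $$u_{j,m}\to u_j\quad\text{strongly in }L^p(Q_T)\text{ for }1\le p<3,\quad\text{as }m\to\infty.$$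
   Context: $\mathbb{T}=\mathbb{R}/\mathbb{Z}$. Discretization. A space-time discretization of $Q_T$ is given by integers $N\ge1$, $N_T\ge1$ with $\Delta x=1/N$, $\Delta t=T/N_T$, $t_k=k\Delta t$, $\mathcal{I}=\mathbb{Z}/N\mathbb{Z}$ (indices modulo $N$), $K_i=((i-\frac12)\Delta x,(i+\frac12)\Delta x)\subset\mathbb{T}$. Scheme (S). The initial data are discretized by $u_{j,i}^0=\frac1{\Delta x}\int_{K_i}u_j^0(x)\,\mathrm{d}x$. For $1\le k\le N_T$, $(u_1^k,u_2^k)\in\mathbb{R}^{2N}$ satisfies $$\frac{u_{j,i}^k-u_{j,i}^{k-1}}{\Delta t}-\frac{\mu_{j,i+1}^ku_{j,i+1}^k-2\mu_{j,i}^ku_{j,i}^k+\mu_{j,i-1}^ku_{j,i-1}^k}{\Delta x^2}=0,\qquad i\in\mathcal{I},\ j=1,2,$$ with $$\mu_{1,i}^k=d_1+d_{11}\sum_{n\in\mathcal{I}}\Delta x\,\sigma_{1,i-n}u_{1,n}^k+d_{12}\sum_{n\in\mathcal{I}}\Delta x\,\rho_{1,i-n}u_{2,n}^k,$$ $$\mu_{2,i}^k=d_2+d_{21}\sum_{n\in\mathcal{I}}\Delta x\,\rho_{2,i-n}u_{1,n}^k+d_{22}\sum_{n\in\mathcal{I}}\Delta x\,\sigma_{2,i-n}u_{2,n}^k,$$ where $\rho_{j,i}=\frac1{\Delta x}\int_{K_i}\rho_j$, $\sigma_{j,i}=\frac1{\Delta x}\int_{K_i}\sigma_j$, and $\rho_i=\rho_{1,i}=\rho_{2,-i}$.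 The reconstruction is $u_{j,m}(x,t)=u_{j,i}^k$ for $x\in K_i$, $t\in(t_{k-1},t_k]$ (on the mesh $\mathcal{D}_m$). Properties of the considered solutions: $\sum_{i}\Delta x\,u_{j,i}^k=\int_{\mathbb{T}}u_j^0$ for all $k\ge 0$, $j=1,2$, and $H(u_1^k,u_2^k)+\Delta t\,D(u_1^k,u_2^k)\le H(u_1^{k-1},u_2^{k-1})$ for all $k\ge1$, where $h_1(x)=\frac1{d_{12}}(x(\log x-1)+1)$, $h_2(x)=\frac1{d_{21}}(x(\log x-1)+1)$ (extended continuously at $0$), $H(u_1,u_2)=\sum_i\Delta x\,h_1(u_{1,i})+\sum_i\Delta x\,h_2(u_{2,i})$, and $$D(u_1,u_2)=2\frac{d_{11}}{d_{12}}\sum_{j\in\mathcal{I}}\sigma_{1,j}\sum_{i\in\mathcal{I}}\Big(\sqrt{u_{1,i+1}u_{1,i+1-j}}-\sqrt{u_{1,i}u_{1,i-j}}\Big)^2+2\frac{d_{22}}{d_{21}}\sum_{j\in\mathcal{I}}\sigma_{2,j}\sum_{i\in\mathcal{I}}\Big(\sqrt{u_{2,i+1}u_{2,i+1-j}}-\sqrt{u_{2,i}u_{2,i-j}}\Big)^2$$ $$+4\frac{d_1}{d_{12}}|\sqrt{u_1}|_{1,2}^2+4\frac{d_2}{d_{21}}|\sqrt{u_2}|_{1,2}^2+4\sum_{j\in\mathcal{I}}\rho_j\sum_{i\in\mathcal{I}}\Big(\sqrt{u_{1,i+1}u_{2,i+1-j}}-\sqrt{u_{1,i}u_{2,i-j}}\Big)^2,$$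 with $|w|_{1,2}^2=\sum_i\Delta x\left|\frac{w_{i+1}-w_i}{\Delta x}\right|^2$. Nonlocal system and distributional solutions. The system is $\partial_tu_1-\Delta((d_1+d_{11}\sigma_1\ast u_1+d_{12}\rho_1\ast u_2)u_1)=0$, $\partial_tu_2-\Delta((d_2+d_{21}\rho_2\ast u_1+d_{22}\sigma_2\ast u_2)u_2)=0$ on $Q_T$ with $u_j(\cdot,0)=u_j^0$; $\ast$ is convolution in $x$ on $\mathbb{T}$. Measurable functions $u_1,u_2:Q_T\to\mathbb{R}_+$ are distributional solutions if for every $\phi\in C_0^\infty(\mathbb{T}\times[0,T))$, $$\int_{Q_T}\big(u_1\partial_t\phi+(d_1u_1+d_{11}(\sigma_1\ast u_1)u_1+d_{12}(\rho_1\ast u_2)u_1)\Delta\phi\big)\,\mathrm{d}x\mathrm{d}t=-\int_{\mathbb{T}}u_1^0(x)\phi(x,0)\,\mathrm{d}x,$$ $$\int_{Q_T}\big(u_2\partial_t\phi+(d_2u_2+d_{21}(\rho_2\ast u_1)u_2+d_{22}(\sigma_2\ast u_2)u_2)\Delta\phi\big)\,\mathrm{d}x\mathrm{d}t=-\int_{\mathbb{T}}u_2^0(x)\phi(x,0)\,\mathrm{d}x.$$ *)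

theory Defs
  imports "HOL-Analysis.Analysis" "HOL-Library.Periodic_Fun"
begin

(* Functions on the torus R/Z are 1-periodic functions on the reals, integrated over the
   fundamental domain [0,1); functions on Z/NZ are N-periodic functions on the integers. *)

abbreviation torus_fun :: "(real \<Rightarrow> 'b) \<Rightarrow> bool" where
  "torus_fun f \<equiv> periodic_fun_simple' f"

abbreviation grid_fun :: "nat \<Rightarrow> (int \<Rightarrow> 'b) \<Rightarrow> bool" where
  "grid_fun N v \<equiv> periodic_fun_simple v (int N)"

definition Linf_torus :: "(real \<Rightarrow> real) \<Rightarrow> bool" where
  "Linf_torus f \<longleftrightarrow> torus_fun f \<and> f \<in> borel_measurable lebesgue \<and>
     (\<exists>C. AE x in lebesgue. \<bar>f x\<bar> \<le> C)"

definition L1_torus :: "(real \<Rightarrow> real) \<Rightarrow> bool" where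
  "L1_torus f \<longleftrightarrow> torus_fun f \<and> set_integrable lebesgue {0..<1} f"

definition torus_conv :: "(real \<Rightarrow> real) \<Rightarrow> (real \<Rightarrow> real) \<Rightarrow> real \<Rightarrow> real" where
  "torus_conv f g x = (LINT y:{0..<1}|lebesgue. f (x - y) * g y)"

definition QT :: "real \<Rightarrow> (real \<times> real) set" where
  "QT T = {0..<1} \<times> {0<..<T}"

definition in_Lp :: "real \<Rightarrow> 'a::euclidean_space set \<Rightarrow> ('a \<Rightarrow> real) \<Rightarrow> bool" where
  "in_Lp p S f \<longleftrightarrow> set_borel_measurable lebesgue S f \<and>
     set_integrable lebesgue S (\<lambda>z. \<bar>f z\<bar> powr p)"

definition Lp_norm :: "real \<Rightarrow> 'a::euclidean_space set \<Rightarrow> ('a \<Rightarrow> real) \<Rightarrow> real" where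
  "Lp_norm p S f = (LINT z:S|lebesgue. \<bar>f z\<bar> powr p) powr (1 / p)"

definition Lp_converges ::
  "real \<Rightarrow> 'a::euclidean_space set \<Rightarrow> (nat \<Rightarrow> 'a \<Rightarrow> real) \<Rightarrow> ('a \<Rightarrow> real) \<Rightarrow> bool" where
  "Lp_converges p S f g \<longleftrightarrow> (\<forall>m. in_Lp p S (f m)) \<and> in_Lp p S g \<and>
     (\<lambda>m. Lp_norm p S (\<lambda>z. f m z - g z)) \<longlonglongrightarrow> 0"

(* Since ln 0 = 0 in HOL, this gives h c 0 = 1 / c, the continuous extension at 0.
   The paper's h_1 and h_2 are h d12 and h d21. *)
definition h :: "real \<Rightarrow> real \<Rightarrow> real" where
  "h c x = (1 / c) * (x * (ln x - 1) + 1)"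

definition dx :: "nat \<Rightarrow> real" where
  "dx N = 1 / real N"

definition dt :: "real \<Rightarrow> nat \<Rightarrow> real" where
  "dt T NT = T / real NT"

definition cell :: "nat \<Rightarrow> int \<Rightarrow> real set" where
  "cell N i = {(of_int i - 1/2) * dx N <..< (of_int i + 1/2) * dx N}"

definition cell_avg :: "nat \<Rightarrow> (real \<Rightarrow> real) \<Rightarrow> int \<Rightarrow> real" where
  "cell_avg N f i = (1 / dx N) * (LINT x:cell N i|lebesgue. f x)"

definition grid_conv :: "nat \<Rightarrow> (int \<Rightarrow> real) \<Rightarrow> (int \<Rightarrow> real) \<Rightarrow> int \<Rightarrow> real" where
  "grid_conv N a v i = (\<Sum>n\<in>{0..<int N}. dx N * a (i - n) * v n)"

(* The coefficient mu for a species v with competitor w: ds, \<sigma> are the self-diffusion and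
   dc, \<rho> the cross-diffusion constant and kernel. *)
definition mu :: "nat \<Rightarrow> real \<Rightarrow> real \<Rightarrow> (real \<Rightarrow> real) \<Rightarrow> real \<Rightarrow> (real \<Rightarrow> real) \<Rightarrow>
    (int \<Rightarrow> real) \<Rightarrow> (int \<Rightarrow> real) \<Rightarrow> int \<Rightarrow> real" where
  "mu N d ds \<sigma> dc \<rho> v w i =
     d + ds * grid_conv N (cell_avg N \<sigma>) v i + dc * grid_conv N (cell_avg N \<rho>) w i"

(* U k i and W k i are the values at time level k in cell i. *)
definition scheme_species :: "real \<Rightarrow> nat \<Rightarrow> nat \<Rightarrow> real \<Rightarrow> real \<Rightarrow> (real \<Rightarrow> real) \<Rightarrow> real \<Rightarrow>
    (real \<Rightarrow> real) \<Rightarrow> (real \<Rightarrow> real) \<Rightarrow> (nat \<Rightarrow> int \<Rightarrow> real) \<Rightarrow> (nat \<Rightarrow> int \<Rightarrow> real) \<Rightarrow> bool" where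
  "scheme_species T N NT d ds \<sigma> dc \<rho> u0 U W \<longleftrightarrow>
     (\<forall>k\<le>NT. grid_fun N (U k)) \<and>
     (\<forall>i. U 0 i = cell_avg N u0 i) \<and>
     (\<forall>k\<in>{1..NT}. \<forall>i.
        (let \<mu> = mu N d ds \<sigma> dc \<rho> (U k) (W k) in
         (U k i - U (k - 1) i) / dt T NT
         - (\<mu> (i + 1) * U k (i + 1) - 2 * \<mu> i * U k i + \<mu> (i - 1) * U k (i - 1)) / (dx N)\<^sup>2 = 0))"

definition scheme_solution :: "real \<Rightarrow> nat \<Rightarrow> nat \<Rightarrow> real \<Rightarrow> real \<Rightarrow> real \<Rightarrow> real \<Rightarrow> real \<Rightarrow> real \<Rightarrow>
    (real \<Rightarrow> real) \<Rightarrow> (real \<Rightarrow> real) \<Rightarrow> (real \<Rightarrow> real) \<Rightarrow> (real \<Rightarrow> real) \<Rightarrow> (real \<Rightarrow> real) \<Rightarrow> (real \<Rightarrow> real) \<Rightarrow>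
    (nat \<Rightarrow> int \<Rightarrow> real) \<Rightarrow> (nat \<Rightarrow> int \<Rightarrow> real) \<Rightarrow> bool" where
  "scheme_solution T N NT d1 d2 d11 d12 d21 d22 \<rho>1 \<rho>2 \<sigma>1 \<sigma>2 u10 u20 U1 U2 \<longleftrightarrow>
     scheme_species T N NT d1 d11 \<sigma>1 d12 \<rho>1 u10 U1 U2 \<and>
     scheme_species T N NT d2 d22 \<sigma>2 d21 \<rho>2 u20 U2 U1"

definition mass_conserved :: "nat \<Rightarrow> nat \<Rightarrow> (real \<Rightarrow> real) \<Rightarrow> (nat \<Rightarrow> int \<Rightarrow> real) \<Rightarrow> bool" where
  "mass_conserved N NT u0 U \<longleftrightarrow>
     (\<forall>k\<le>NT. (\<Sum>i\<in>{0..<int N}. dx N * U k i) = (LINT x:{0..<1}|lebesgue. u0 x))"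

definition entropy :: "nat \<Rightarrow> real \<Rightarrow> real \<Rightarrow> (int \<Rightarrow> real) \<Rightarrow> (int \<Rightarrow> real) \<Rightarrow> real" where
  "entropy N d12 d21 v w =
     (\<Sum>i\<in>{0..<int N}. dx N * h d12 (v i)) + (\<Sum>i\<in>{0..<int N}. dx N * h d21 (w i))"

definition grid_H1_sq :: "nat \<Rightarrow> (int \<Rightarrow> real) \<Rightarrow> real" where
  "grid_H1_sq N w = (\<Sum>i\<in>{0..<int N}. dx N * \<bar>(w (i + 1) - w i) / dx N\<bar>\<^sup>2)"

definition nonlocal_dissip ::
  "nat \<Rightarrow> (real \<Rightarrow> real) \<Rightarrow> (int \<Rightarrow> real) \<Rightarrow> (int \<Rightarrow> real) \<Rightarrow> real" where
  "nonlocal_dissip N f v w =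
     (\<Sum>j\<in>{0..<int N}. cell_avg N f j *
        (\<Sum>i\<in>{0..<int N}. (sqrt (v (i + 1) * w (i + 1 - j)) - sqrt (v i * w (i - j)))\<^sup>2))"

definition dissipation :: "nat \<Rightarrow> real \<Rightarrow> real \<Rightarrow> real \<Rightarrow> real \<Rightarrow> real \<Rightarrow> real \<Rightarrow>
    (real \<Rightarrow> real) \<Rightarrow> (real \<Rightarrow> real) \<Rightarrow> (real \<Rightarrow> real) \<Rightarrow> (int \<Rightarrow> real) \<Rightarrow> (int \<Rightarrow> real) \<Rightarrow> real" where
  "dissipation N d1 d2 d11 d12 d21 d22 \<rho> \<sigma>1 \<sigma>2 v w =
     2 * (d11 / d12) * nonlocal_dissip N \<sigma>1 v v
   + 2 * (d22 / d21) * nonlocal_dissip N \<sigma>2 w w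
   + 4 * (d1 / d12) * grid_H1_sq N (\<lambda>i. sqrt (v i))
   + 4 * (d2 / d21) * grid_H1_sq N (\<lambda>i. sqrt (w i))
   + 4 * nonlocal_dissip N \<rho> v w"

definition entropy_inequality :: "real \<Rightarrow> nat \<Rightarrow> nat \<Rightarrow> real \<Rightarrow> real \<Rightarrow> real \<Rightarrow> real \<Rightarrow> real \<Rightarrow> real \<Rightarrow>
    (real \<Rightarrow> real) \<Rightarrow> (real \<Rightarrow> real) \<Rightarrow> (real \<Rightarrow> real) \<Rightarrow>
    (nat \<Rightarrow> int \<Rightarrow> real) \<Rightarrow> (nat \<Rightarrow> int \<Rightarrow> real) \<Rightarrow> bool" where
  "entropy_inequality T N NT d1 d2 d11 d12 d21 d22 \<rho> \<sigma>1 \<sigma>2 U1 U2 \<longleftrightarrow>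
     (\<forall>k\<in>{1..NT}. entropy N d12 d21 (U1 k) (U2 k)
        + dt T NT * dissipation N d1 d2 d11 d12 d21 d22 \<rho> \<sigma>1 \<sigma>2 (U1 k) (U2 k)
        \<le> entropy N d12 d21 (U1 (k - 1)) (U2 (k - 1)))"

(* The lemma reconstruction_eq below states the defining property; the cell interfaces,
   a null set, are attributed to the cell on their right. *)
definition reconstruction ::
  "real \<Rightarrow> nat \<Rightarrow> nat \<Rightarrow> (nat \<Rightarrow> int \<Rightarrow> real) \<Rightarrow> real \<Rightarrow> real \<Rightarrow> real" where
  "reconstruction T N NT U x t = U (nat \<lceil>t / dt T NT\<rceil>) \<lfloor>x / dx N + 1/2\<rfloor>"

lemma reconstruction_eq:
  assumes "T > 0" "N \<ge> 1" "NT \<ge> 1" "k \<ge> 1" "x \<in> cell N i"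
    and "(real k - 1) * dt T NT < t" "t \<le> real k * dt T NT"
  shows "reconstruction T N NT U x t = U k i"
proof -
  have p: "dt T NT > 0" "dx N > 0"
    using assms by (auto simp: dt_def dx_def)
  have "\<lceil>t / dt T NT\<rceil> = int k"
    using assms p by (intro ceiling_unique) (auto simp: field_simps)
  moreover have "\<lfloor>x / dx N + 1/2\<rfloor> = i"
    using assms p by (intro floor_unique) (auto simp: cell_def field_simps)
  ultimately show ?thesis
    by (simp add: reconstruction_def)
qed

(* C_0^infty(T x [0,T)): D i j is the derivative of order i in x and j in t, one-sided at t = 0,
   and the support need not avoid t = 0. *)
definition test_function :: "real \<Rightarrow> (real \<Rightarrow> real \<Rightarrow> real) \<Rightarrow> bool" where
  "test_function T \<phi> \<longleftrightarrow>
     (\<forall>t\<in>{0..<T}. torus_fun (\<lambda>x. \<phi> x t)) \<and>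
     (\<exists>D :: nat \<Rightarrow> nat \<Rightarrow> real \<Rightarrow> real \<Rightarrow> real. D 0 0 = \<phi> \<and>
        (\<forall>i j. continuous_on (UNIV \<times> {0..<T}) (\<lambda>(x, t). D i j x t)) \<and>
        (\<forall>i j x. \<forall>t\<in>{0..<T}.
           ((\<lambda>y. D i j y t) has_real_derivative D (Suc i) j x t) (at x) \<and>
           ((\<lambda>s. D i j x s) has_real_derivative D i (Suc j) x t) (at t within {0..<T}))) \<and>
     (\<exists>T'<T. \<forall>x. \<forall>t\<in>{T'<..<T}. \<phi> x t = 0)"

definition weak_integrand :: "real \<Rightarrow> real \<Rightarrow> (real \<Rightarrow> real) \<Rightarrow> real \<Rightarrow> (real \<Rightarrow> real) \<Rightarrow>
    (real \<Rightarrow> real \<Rightarrow> real) \<Rightarrow> (real \<Rightarrow> real \<Rightarrow> real) \<Rightarrow> (real \<Rightarrow> real \<Rightarrow> real) \<Rightarrow> real \<Rightarrow> real \<Rightarrow> real" where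
  "weak_integrand d ds \<sigma> dc \<rho> u w \<phi> x t =
     u x t * deriv (\<lambda>s. \<phi> x s) t
   + (d * u x t + ds * torus_conv \<sigma> (\<lambda>y. u y t) x * u x t
      + dc * torus_conv \<rho> (\<lambda>y. w y t) x * u x t) * deriv (deriv (\<lambda>y. \<phi> y t)) x"

definition weak_equation :: "real \<Rightarrow> real \<Rightarrow> real \<Rightarrow> (real \<Rightarrow> real) \<Rightarrow> real \<Rightarrow> (real \<Rightarrow> real) \<Rightarrow>
    (real \<Rightarrow> real) \<Rightarrow> (real \<Rightarrow> real \<Rightarrow> real) \<Rightarrow> (real \<Rightarrow> real \<Rightarrow> real) \<Rightarrow> bool" where
  "weak_equation T d ds \<sigma> dc \<rho> u0 u w \<longleftrightarrow>
     (\<forall>\<phi>. test_function T \<phi> \<longrightarrow>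
        set_integrable lebesgue (QT T) (\<lambda>(x, t). weak_integrand d ds \<sigma> dc \<rho> u w \<phi> x t) \<and>
        (LINT (x, t):QT T|lebesgue. weak_integrand d ds \<sigma> dc \<rho> u w \<phi> x t)
          = - (LINT x:{0..<1}|lebesgue. u0 x * \<phi> x 0))"

(* Integrability of almost every time slice makes the convolutions with bounded kernels
   meaningful; the Bochner integral is 0 on non-integrable functions. *)
definition state_fun :: "real \<Rightarrow> (real \<Rightarrow> real \<Rightarrow> real) \<Rightarrow> bool" where
  "state_fun T u \<longleftrightarrow>
     (\<forall>t\<in>{0<..<T}. torus_fun (\<lambda>x. u x t)) \<and>
     set_borel_measurable lebesgue (QT T) (\<lambda>(x, t). u x t) \<and>
     (\<forall>x. \<forall>t\<in>{0<..<T}. u x t \<ge> 0) \<and>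
     (AE t in lebesgue. t \<in> {0<..<T} \<longrightarrow> set_integrable lebesgue {0..<1} (\<lambda>x. u x t))"

definition distributional_solution :: "real \<Rightarrow> real \<Rightarrow> real \<Rightarrow> real \<Rightarrow> real \<Rightarrow> real \<Rightarrow> real \<Rightarrow>
    (real \<Rightarrow> real) \<Rightarrow> (real \<Rightarrow> real) \<Rightarrow> (real \<Rightarrow> real) \<Rightarrow> (real \<Rightarrow> real) \<Rightarrow> (real \<Rightarrow> real) \<Rightarrow> (real \<Rightarrow> real) \<Rightarrow>
    (real \<Rightarrow> real \<Rightarrow> real) \<Rightarrow> (real \<Rightarrow> real \<Rightarrow> real) \<Rightarrow> bool" where
  "distributional_solution T d1 d2 d11 d12 d21 d22 \<rho>1 \<rho>2 \<sigma>1 \<sigma>2 u10 u20 u1 u2 \<longleftrightarrow>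
     state_fun T u1 \<and> state_fun T u2 \<and>
     weak_equation T d1 d11 \<sigma>1 d12 \<rho>1 u10 u1 u2 \<and>
     weak_equation T d2 d22 \<sigma>2 d21 \<rho>2 u20 u2 u1"

end

theory Submission
  imports Defs "HOL-Complex_Analysis.Great_Picard"
begin

text \<open>
  The entropy inequality bounds, uniformly in the mesh, the time sum of the discrete \<open>H\<^sup>1\<close> seminorms of the
  square roots of the densities; the initial entropy is controlled by convexity (\<open>initial_entropy_bound\<close>).
  By the Cauchy-Schwarz inequality and conservation of mass, the total variation in space of the densities
  is bounded in \<open>L\<^sup>2\<close> in time, and in one space dimension this also bounds the densities in \<open>L\<^sup>3\<close> of the
  cylinder (\<open>TV_square_le\<close>, \<open>species_bounds\<close>). Since the kernels are bounded and the mass is conserved, the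
  diffusion coefficients are bounded, so the fluxes are bounded in \<open>L\<^sup>1\<close> at every time.

  Compactness in \<open>L\<^sup>1\<close> combines the two bounds. Averages of a density against a smooth bump are Lipschitz in time
  up to the time step, because the scheme moves two discrete derivatives onto the bump (\<open>bump_sum_step\<close>).
  A diagonal argument makes countably many such averages converge at all times. The total variation bound
  says that a density is close in \<open>L\<^sup>1\<close> to finitely many of its averages, uniformly in the mesh, so a subsequence is
  Cauchy in \<open>L\<^sup>1\<close> of the cylinder (\<open>L1_Cauchy_subsequence\<close>). The \<open>L\<^sup>3\<close> bound and interpolation upgrade the convergence
  to \<open>L\<^sup>p\<close> for \<open>p < 3\<close> (\<open>Lp_converges_QT\<close>).

  For the limit equation, the discrete convolution is the exact convolution of the step function evaluated at
  cell centres (\<open>grid_conv_eq_torus_conv\<close>). It is therefore close to the limiting convolution uniformly in space,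
  with an error controlled by the total variation and the \<open>L\<^sup>1\<close> distance (\<open>grid_conv_error\<close>), and the fluxes
  converge in \<open>L\<^sup>1\<close> (\<open>flux_limit\<close>). The scheme is then tested with nodal values of a test function; all terms
  are integrals of step functions, and \<open>weak_equation_limit\<close> passes to the limit.
\<close>

section \<open>Periodic functions and cell averages\<close>

text \<open>
  Lebesgue measure on the fundamental domain \<open>[0,1)\<close> of the torus, on the time interval \<open>(0,T)\<close>,
  and their product. They live on the Borel sets: the step functions and their limits are Borel, so
  Lebesgue measurability only enters through the kernels and the initial data.
\<close>

definition XM :: "real measure" where "XM = restrict_space lborel {0..<1}"
definition YM :: "real \<Rightarrow> real measure" where "YM T = restrict_space lborel {0<..<T}"
definition PM :: "real \<Rightarrow> (real \<times> real) measure" where "PM T = XM \<Otimes>\<^sub>M YM T"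

text \<open>
  The index of the cell containing \<open>x\<close> (an interface belongs to the cell on its right) and the index \<open>k\<close>
  of the time level with \<open>t\<close> in the interval from \<open>(k-1)\<Delta>t\<close> (excluded) to \<open>k\<Delta>t\<close> (included). The
  reconstruction of \<open>U\<close> is \<open>U (kt T NT t) (ix N x)\<close>.
\<close>

definition ix :: "nat \<Rightarrow> real \<Rightarrow> int" where "ix N x = \<lfloor>x / dx N + 1/2\<rfloor>"
definition kt :: "real \<Rightarrow> nat \<Rightarrow> real \<Rightarrow> nat" where "kt T NT t = nat \<lceil>t / dt T NT\<rceil>"

lemma torus_fun_plus_int:
  assumes "torus_fun F" shows "F (x + real_of_int n) = F x"
proof -
  interpret periodic_fun_simple' F by fact
  show ?thesis by (rule plus_of_int)
qed

lemma grid_fun_plus: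
  assumes "grid_fun N v" shows "v (i + int N) = v i" "v (i + n * int N) = v i"
proof -
  interpret periodic_fun_simple v "int N" by fact
  show "v (i + int N) = v i" by (rule plus_period)
  show "v (i + n * int N) = v i" using plus_of_int[of i n] by simp
qed

lemma set_integrable_shift:
  fixes F :: "real \<Rightarrow> real"
  shows "set_integrable lebesgue {a..<b} (\<lambda>x. F (x + c)) \<longleftrightarrow> set_integrable lebesgue {a+c..<b+c} F"
proof -
  have "indicat_real {a+c..<b+c} (c + 1 * x) *\<^sub>R F (c + 1 * x) = indicat_real {a..<b} x *\<^sub>R F (x + c)" for x
    by (auto simp: indicator_def algebra_simps)
  then show ?thesis
    using lebesgue_integrable_real_affine_iff[of 1 "\<lambda>x. indicat_real {a+c..<b+c} x *\<^sub>R F x" c]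
    unfolding set_integrable_def by simp
qed

lemma set_integral_shift:
  fixes F :: "real \<Rightarrow> real"
  shows "(LINT x:{a..<b}|lebesgue. F (x + c)) = (LINT x:{a+c..<b+c}|lebesgue. F x)"
proof -
  have "indicat_real {a+c..<b+c} (c + 1 * x) *\<^sub>R F (c + 1 * x) = indicat_real {a..<b} x *\<^sub>R F (x + c)" for x
    by (auto simp: indicator_def algebra_simps)
  then show ?thesis
    using lebesgue_integral_real_affine[of 1 "\<lambda>x. indicat_real {a+c..<b+c} x *\<^sub>R F x" c]
    unfolding set_lebesgue_integral_def by simp
qed

lemma torus_integral_period_aux:
  fixes F :: "real \<Rightarrow> real"
  assumes F: "torus_fun F" and i: "set_integrable lebesgue {0..<1} F" and s: "0 \<le> s" "s \<le> 1"
  shows "set_integrable lebesgue {s..<s+1} F" "(LINT x:{s..<s+1}|lebesgue. F x) = (LINT x:{0..<1}|lebesgue. F x)"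
proof -
  have i1: "set_integrable lebesgue {0..<s} F" and i2: "set_integrable lebesgue {s..<1} F"
    by (rule set_integrable_subset[OF i]; use s in auto)+
  have p: "F (x + 1) = F x" for x using torus_fun_plus_int[OF F, of x 1] by simp
  have i3: "set_integrable lebesgue {1..<s+1} F"
    using set_integrable_shift[of 0 s F 1] i1 by (simp add: p)
  have e3: "(LINT x:{1..<s+1}|lebesgue. F x) = (LINT x:{0..<s}|lebesgue. F x)"
    using set_integral_shift[of 0 s F 1] by (simp add: p)
  have u: "{s..<s+1} = {s..<1} \<union> {1..<s+1}" "{0..<1} = {s..<1} \<union> {0..<s}" using s by auto
  show "set_integrable lebesgue {s..<s+1} F" unfolding u(1) by (intro set_integrable_Un i2 i3) auto
  show "(LINT x:{s..<s+1}|lebesgue. F x) = (LINT x:{0..<1}|lebesgue. F x)"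
    unfolding u by (subst (1 2) set_integral_Un) (use i1 i2 i3 s in \<open>auto simp: e3\<close>)
qed

text \<open>
  The integral of a periodic function over a period does not depend on the starting point.
\<close>

lemma torus_integral_period:
  fixes F :: "real \<Rightarrow> real"
  assumes F: "torus_fun F" and i: "set_integrable lebesgue {0..<1} F"
  shows "set_integrable lebesgue {s..<s+1} F" "(LINT x:{s..<s+1}|lebesgue. F x) = (LINT x:{0..<1}|lebesgue. F x)"
proof -
  define q where "q = s - of_int \<lfloor>s\<rfloor>"
  have q: "0 \<le> q" "q \<le> 1" unfolding q_def by linarith+
  have e: "q + of_int \<lfloor>s\<rfloor> = s" "q + 1 + of_int \<lfloor>s\<rfloor> = s + 1" by (auto simp: q_def)
  show "set_integrable lebesgue {s..<s+1} F" 
    using torus_integral_period_aux(1)[OF F i q] set_integrable_shift[of q "q+1" F "of_int \<lfloor>s\<rfloor>"]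
    by (simp add: torus_fun_plus_int[OF F] e)
  show "(LINT x:{s..<s+1}|lebesgue. F x) = (LINT x:{0..<1}|lebesgue. F x)"
    using torus_integral_period_aux(2)[OF F i q] set_integral_shift[of q "q+1" F "of_int \<lfloor>s\<rfloor>"]
    by (simp add: torus_fun_plus_int[OF F] e)
qed

lemma torus_integral_shift:
  fixes F :: "real \<Rightarrow> real"
  assumes F: "torus_fun F" and i: "set_integrable lebesgue {0..<1} F"
  shows "set_integrable lebesgue {0..<1} (\<lambda>x. F (x + s))" "(LINT x:{0..<1}|lebesgue. F (x + s)) = (LINT x:{0..<1}|lebesgue. F x)"
  using torus_integral_period[OF F i, of s] set_integrable_shift[of 0 1 F s] set_integral_shift[of 0 1 F s]
  by (simp_all add: add.commute)

lemma dx_pos: "N \<ge> 1 \<Longrightarrow> dx N > 0" by (simp add: dx_def)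
lemma dx_N: "N \<ge> 1 \<Longrightarrow> real N * dx N = 1" by (simp add: dx_def)
lemma dx_le1: "N \<ge> 1 \<Longrightarrow> dx N \<le> 1" by (simp add: dx_def)
lemma dt_pos: "T > 0 \<Longrightarrow> NT \<ge> 1 \<Longrightarrow> dt T NT > 0" by (simp add: dt_def)
lemma dt_NT: "NT \<ge> 1 \<Longrightarrow> real NT * dt T NT = T" by (simp add: dt_def)

lemma ix_iff:
  assumes "N \<ge> 1"
  shows "ix N x = i \<longleftrightarrow> (of_int i - 1/2) * dx N \<le> x \<and> x < (of_int i + 1/2) * dx N"
proof -
  have "ix N x = i \<longleftrightarrow> of_int i \<le> x / dx N + 1/2 \<and> x / dx N + 1/2 < of_int i + 1"
    unfolding ix_def by (rule floor_eq_iff)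
  also have "\<dots> \<longleftrightarrow> (of_int i - 1/2) * dx N \<le> x \<and> x < (of_int i + 1/2) * dx N"
    using dx_pos[OF assms] by (auto simp: field_simps)
  finally show ?thesis .
qed

lemma ix_dist:
  assumes "N \<ge> 1" shows "\<bar>x - of_int (ix N x) * dx N\<bar> \<le> dx N / 2"
  using ix_iff[OF assms, of x "ix N x"] unfolding abs_le_iff by (auto simp: algebra_simps)

lemma ix_cell: assumes "N \<ge> 1" "x \<in> cell N i" shows "ix N x = i"
  using assms by (auto simp: ix_iff cell_def)

lemma ix_plus1: assumes "N \<ge> 1" shows "ix N (x + 1) = ix N x + int N"
proof -
  have "(x + 1) / dx N + 1/2 = (x / dx N + 1/2) + of_int (int N)"
    using assms by (simp add: dx_def field_simps)
  then show ?thesis unfolding ix_def by (simp only: floor_add_int)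
qed

lemma torus_fun_step:
  assumes "N \<ge> 1" "grid_fun N v" shows "torus_fun (\<lambda>x. v (ix N x))"
  by standard (simp add: ix_plus1[OF assms(1)] grid_fun_plus[OF assms(2)])

text \<open>
  Up to a null set, the cells \<open>0,\<dots>,N-1\<close> cover the shifted fundamental domain
  \<open>[-\<Delta>x/2, 1-\<Delta>x/2)\<close>.
\<close>

lemma torus_integral_cells:
  fixes F :: "real \<Rightarrow> real"
  assumes N: "N \<ge> 1" and F: "torus_fun F" and i: "set_integrable lebesgue {0..<1} F"
  shows "(LINT x:{0..<1}|lebesgue. F x) = (\<Sum>n\<in>{0..<int N}. LINT x:cell N n|lebesgue. F x)"
    and "\<And>n. set_integrable lebesgue (cell N n) F"
proof -
  note d = dx_pos[OF N]
  define H where "H n = {x. ix N x = n}" for n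
  have H: "H n = {(of_int n - 1/2) * dx N ..< (of_int n + 1/2) * dx N}" for n
    by (auto simp: H_def ix_iff[OF N])
  have U: "{-dx N/2 ..< -dx N/2 + 1} = (\<Union>n\<in>{0..<int N}. H n)"
  proof -
    have "x \<in> {-dx N/2 ..< -dx N/2 + 1} \<longleftrightarrow> 0 \<le> x / dx N + 1/2 \<and> x / dx N + 1/2 < of_int (int N)" for x
      using d N by (auto simp: field_simps dx_def)
    also have "\<dots> x \<longleftrightarrow> ix N x \<in> {0..<int N}" for x unfolding ix_def
      by (auto simp: le_floor_iff floor_less_iff)
    finally have "x \<in> {-dx N/2 ..< -dx N/2 + 1} \<longleftrightarrow> x \<in> (\<Union>n\<in>{0..<int N}. H n)" for x
      unfolding H_def by blast
    then show ?thesis by (rule set_eqI)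
  qed
  have iH: "set_integrable lebesgue (H n) F" for n
    unfolding H
  proof (rule set_integrable_subset[OF torus_integral_period(1)[OF F i, of "(of_int n - 1/2) * dx N"]])
    have "(of_int n + 1/2) * dx N = (of_int n - 1/2) * dx N + dx N" by (simp add: algebra_simps)
    then show "{(of_int n - 1/2) * dx N ..< (of_int n + 1/2) * dx N} \<subseteq> {(of_int n - 1/2) * dx N ..< (of_int n - 1/2) * dx N + 1}"
      using d dx_le1[OF N] by auto
  qed auto
  have cH: "H n = insert ((of_int n - 1/2) * dx N) (cell N n)" for n
  proof -
    have "(of_int n + 1/2) * dx N = (of_int n - 1/2) * dx N + dx N" by (simp add: algebra_simps)
    then show ?thesis using d unfolding H cell_def by auto
  qed
  show ic: "set_integrable lebesgue (cell N n) F" for n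
    by (rule set_integrable_subset[OF iH[of n]]) (auto simp: cH, simp add: cell_def)
  have c: "(LINT x:H n|lebesgue. F x) = (LINT x:cell N n|lebesgue. F x)" for n
  proof (rule set_integral_cong_set)
    show "AE x in lebesgue. (x \<in> cell N n) = (x \<in> H n)"
      unfolding cH by (rule AE_I'[of "{(of_int n - 1/2) * dx N}"]) auto
    show "set_borel_measurable lebesgue (H n) F" "set_borel_measurable lebesgue (cell N n) F"
      using iH ic by (auto simp: set_borel_measurable_def set_integrable_def)
  qed
  have "(LINT x:{0..<1}|lebesgue. F x) = (LINT x:(\<Union>n\<in>{0..<int N}. H n)|lebesgue. F x)"
    unfolding U[symmetric] by (rule torus_integral_period(2)[OF F i, symmetric])
  also have "\<dots> = (\<Sum>n\<in>{0..<int N}. LINT x:H n|lebesgue. F x)"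
  proof (rule set_integral_finite_Union)
    show "disjoint_family_on H {0..<int N}" by (auto simp: disjoint_family_on_def H_def)
  qed (auto simp: iH, auto simp: H)
  finally show "(LINT x:{0..<1}|lebesgue. F x) = (\<Sum>n\<in>{0..<int N}. LINT x:cell N n|lebesgue. F x)"
    by (simp add: c)
qed

section \<open>Step functions on the space-time cylinder\<close>

lemma space_XM [simp]: "space XM = {0..<1}" by (simp add: XM_def space_restrict_space)
lemma space_YM [simp]: "space (YM T) = {0<..<T}" by (simp add: YM_def space_restrict_space)
lemma space_PM: "space (PM T) = QT T" by (simp add: PM_def space_pair_measure QT_def)
lemma emeasure_XM: "emeasure XM (space XM) = 1"
  unfolding space_XM XM_def by (subst emeasure_restrict_space) auto

lemma emeasure_YM: "T > 0 \<Longrightarrow> emeasure (YM T) (space (YM T)) = ennreal T"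
  unfolding space_YM YM_def by (subst emeasure_restrict_space) auto

lemma finite_measure_XM: "finite_measure XM"
  by standard (simp only: emeasure_XM, simp)

lemma finite_measure_YM: "finite_measure (YM T)"
proof (cases "T > 0")
  case True then show ?thesis by (intro finite_measureI) (simp only: emeasure_YM, simp)
next
  case False 
  then have "space (YM T) = {}" by simp
  then show ?thesis by (intro finite_measureI) simp
qed

lemma measure_XM: "measure XM (space XM) = 1"
  unfolding measure_def emeasure_XM by simp

lemma pair_XY: "pair_sigma_finite XM (YM T)"
  using finite_measure_XM finite_measure_YM by (intro pair_sigma_finite.intro finite_measure.axioms(1))

lemma finite_measure_PM: "finite_measure (PM T)"
  unfolding PM_def by (rule finite_measure_pair_measure[OF finite_measure_YM finite_measure_XM])

text \<open>
  This identifies iterated integration over space and time with integration over the cylinder.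
\<close>

lemma PM_eq: "PM T = restrict_space lborel (QT T)"
  unfolding PM_def
proof (rule pair_measure_eqI)
  show "sigma_finite_measure XM" "sigma_finite_measure (YM T)"
    using finite_measure_XM finite_measure_YM[of T] by (auto intro: finite_measure.axioms)
  let ?R = "restrict_space (borel :: (real\<times>real) measure) (QT T)"
  have Q: "QT T \<in> sets borel" unfolding QT_def by (intro borel_Times) auto
  have m1: "(\<lambda>z. z) \<in> XM \<Otimes>\<^sub>M YM T \<rightarrow>\<^sub>M ?R"
  proof (rule measurable_restrict_space2)
    show "(\<lambda>z. z) \<in> space (XM \<Otimes>\<^sub>M YM T) \<rightarrow> QT T" by (auto simp: space_pair_measure QT_def)
    have "fst \<in> XM \<Otimes>\<^sub>M YM T \<rightarrow>\<^sub>M borel" "snd \<in> XM \<Otimes>\<^sub>M YM T \<rightarrow>\<^sub>M borel"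
      by (rule measurable_compose[OF measurable_fst], simp add: XM_def measurable_restrict_space1)
         (rule measurable_compose[OF measurable_snd], simp add: YM_def measurable_restrict_space1)
    then show "(\<lambda>z. z) \<in> XM \<Otimes>\<^sub>M YM T \<rightarrow>\<^sub>M borel"
      using borel_measurable_Pair[of fst _ snd] by simp
  qed
  have m2: "(\<lambda>z. z) \<in> ?R \<rightarrow>\<^sub>M XM \<Otimes>\<^sub>M YM T"
  proof (rule measurable_pair)
    have "fst \<in> ?R \<rightarrow>\<^sub>M borel" "snd \<in> ?R \<rightarrow>\<^sub>M borel"
      by (intro measurable_restrict_space1; simp add: borel_measurable_continuous_onI continuous_on_fst continuous_on_snd continuous_on_id)+
    then show "fst \<circ> (\<lambda>z. z) \<in> ?R \<rightarrow>\<^sub>M XM" "snd \<circ> (\<lambda>z. z) \<in> ?R \<rightarrow>\<^sub>M YM T"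
      unfolding XM_def YM_def o_def
      by (auto intro!: measurable_restrict_space2 simp: space_restrict_space QT_def)
  qed
  show s: "sets (XM \<Otimes>\<^sub>M YM T) = sets (restrict_space lborel (QT T))"
  proof -
    have sp: "space (XM \<Otimes>\<^sub>M YM T) = space ?R" by (auto simp: space_pair_measure QT_def space_restrict_space)
    have "sets (XM \<Otimes>\<^sub>M YM T) = sets ?R"
    proof (intro set_eqI iffI)
      fix A assume A: "A \<in> sets (XM \<Otimes>\<^sub>M YM T)"
      show "A \<in> sets ?R" using measurable_sets[OF m2 A] sets.sets_into_space[OF A] sp by (simp add: Int_absorb2)
    next
      fix A assume A: "A \<in> sets ?R"
      show "A \<in> sets (XM \<Otimes>\<^sub>M YM T)" using measurable_sets[OF m1 A] sets.sets_into_space[OF A] sp by (simp add: Int_absorb2)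
    qed
    then show ?thesis by (simp cong: sets_restrict_space_cong)
  qed
  fix A B assume A: "A \<in> sets XM" and B: "B \<in> sets (YM T)"
  have A': "A \<in> sets borel" "A \<subseteq> {0..<1}" and B': "B \<in> sets borel" "B \<subseteq> {0<..<T}"
    using A B by (auto simp: XM_def YM_def sets_restrict_space_iff)
  have "emeasure (restrict_space lborel (QT T)) (A \<times> B) = emeasure lborel (A \<times> B)"
    using A' B' Q by (intro emeasure_restrict_space) (auto simp: QT_def)
  also have "\<dots> = emeasure lborel A * emeasure lborel B"
    using A' B' by (simp flip: lborel_prod add: lborel.emeasure_pair_measure_Times)
  finally show "emeasure XM A * emeasure (YM T) B = emeasure (restrict_space lborel (QT T)) (A \<times> B)"
    using A' B' by (simp add: XM_def YM_def emeasure_restrict_space)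
qed

lemma QT_borel [measurable]: "QT T \<in> sets borel" unfolding QT_def by (intro borel_Times) auto

lemma borel_measurable_PM:
  fixes f :: "real \<times> real \<Rightarrow> 'b::topological_space"
  shows "f \<in> borel_measurable borel \<Longrightarrow> f \<in> borel_measurable (PM T)"
  unfolding PM_eq by (rule measurable_restrict_space1) simp

lemma borel_measurable_PM_iff:
  fixes f :: "real \<times> real \<Rightarrow> real"
  shows "f \<in> borel_measurable (PM T) \<longleftrightarrow> (\<lambda>z. indicator (QT T) z *\<^sub>R f z) \<in> borel_measurable lborel"
  unfolding PM_eq by (subst borel_measurable_restrict_space_iff) auto

lemma set_integrable_QT:
  fixes f :: "real \<times> real \<Rightarrow> real"
  assumes "f \<in> borel_measurable (PM T)"
  shows "set_integrable lebesgue (QT T) f \<longleftrightarrow> integrable (PM T) f"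
  using assms unfolding set_integrable_def borel_measurable_PM_iff 
  by (subst integrable_completion) (auto simp: PM_eq integrable_restrict_space)

lemma set_integral_QT:
  fixes f :: "real \<times> real \<Rightarrow> real"
  assumes "f \<in> borel_measurable (PM T)"
  shows "(LINT z:QT T|lebesgue. f z) = integral\<^sup>L (PM T) f"
  using assms unfolding set_lebesgue_integral_def borel_measurable_PM_iff 
  by (subst integral_completion) (auto simp: PM_eq integral_restrict_space)

lemma set_borel_measurable_QT:
  fixes f :: "real \<times> real \<Rightarrow> real"
  assumes "f \<in> borel_measurable (PM T)"
  shows "set_borel_measurable lebesgue (QT T) f"
  using assms unfolding set_borel_measurable_def borel_measurable_PM_iff by (simp add: measurable_completion)

lemma set_integrable_XM:
  fixes f :: "real \<Rightarrow> real"
  assumes "f \<in> borel_measurable XM"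
  shows "set_integrable lebesgue {0..<1} f \<longleftrightarrow> integrable XM f"
proof -
  have "(\<lambda>z. indicat_real {0..<1} z *\<^sub>R f z) \<in> borel_measurable lborel"
    using assms unfolding XM_def by (subst (asm) borel_measurable_restrict_space_iff) auto
  then show ?thesis
    unfolding set_integrable_def by (subst integrable_completion) (auto simp: XM_def integrable_restrict_space)
qed

lemma set_integral_XM:
  fixes f :: "real \<Rightarrow> real"
  assumes "f \<in> borel_measurable XM"
  shows "(LINT z:{0..<1}|lebesgue. f z) = integral\<^sup>L XM f"
proof -
  have "(\<lambda>z. indicat_real {0..<1} z *\<^sub>R f z) \<in> borel_measurable lborel"
    using assms unfolding XM_def by (subst (asm) borel_measurable_restrict_space_iff) auto
  then show ?thesis
    unfolding set_lebesgue_integral_def by (subst integral_completion) (auto simp: XM_def integral_restrict_space)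
qed

lemma borel_XM: "f \<in> borel_measurable borel \<Longrightarrow> f \<in> borel_measurable XM"
  unfolding XM_def by (rule measurable_restrict_space1) simp

lemma ix_borel [measurable]: "ix N \<in> borel \<rightarrow>\<^sub>M count_space UNIV"
  unfolding ix_def by measurable
lemma kt_borel [measurable]: "kt T NT \<in> borel \<rightarrow>\<^sub>M count_space UNIV"
  unfolding kt_def by measurable
lemma ix_XM [measurable]: "ix N \<in> XM \<rightarrow>\<^sub>M count_space UNIV"
  unfolding XM_def by (rule measurable_restrict_space1) simp
lemma kt_YM [measurable]: "kt T NT \<in> YM S \<rightarrow>\<^sub>M count_space UNIV"
  unfolding YM_def by (rule measurable_restrict_space1) simp

lemma kt_iff:
  assumes "T > 0" "NT \<ge> 1" "k \<ge> 1"
  shows "kt T NT t = k \<longleftrightarrow> (real k - 1) * dt T NT < t \<and> t \<le> real k * dt T NT"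
proof -
  note d = dt_pos[OF assms(1,2)]
  have "kt T NT t = k \<longleftrightarrow> \<lceil>t / dt T NT\<rceil> = int k" unfolding kt_def using assms(3) by auto
  also have "\<dots> \<longleftrightarrow> of_int (int k) - 1 < t / dt T NT \<and> t / dt T NT \<le> of_int (int k)" by (rule ceiling_eq_iff)
  also have "\<dots> \<longleftrightarrow> (real k - 1) * dt T NT < t \<and> t \<le> real k * dt T NT"
    using d by (auto simp: field_simps)
  finally show ?thesis .
qed

lemma kt_range:
  assumes "T > 0" "NT \<ge> 1" "0 < t" "t \<le> T"
  shows "1 \<le> kt T NT t" "kt T NT t \<le> NT"
proof -
  note d = dt_pos[OF assms(1,2)]
  have "0 < t / dt T NT" "t / dt T NT \<le> real NT"
    using d assms dt_NT[OF assms(2), of T] by (auto simp: field_simps)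
  then have "0 < \<lceil>t / dt T NT\<rceil>" "\<lceil>t / dt T NT\<rceil> \<le> int NT" by (simp_all add: ceiling_le_iff)
  then show "1 \<le> kt T NT t" "kt T NT t \<le> NT" unfolding kt_def by linarith+
qed

lemma kt_bounds:
  assumes "T > 0" "NT \<ge> 1" "0 < t" "t \<le> T"
  shows "(real (kt T NT t) - 1) * dt T NT < t" "t \<le> real (kt T NT t) * dt T NT"
  using kt_iff[OF assms(1,2) kt_range(1)[OF assms], of t] by auto

lemma grid_fun_bounded:
  fixes v :: "int \<Rightarrow> real"
  assumes "N \<ge> 1" "grid_fun N v" shows "\<exists>B. \<forall>i. \<bar>v i\<bar> \<le> B"
proof (intro exI allI)
  fix i
  have "v i = v (i mod int N)"
    using grid_fun_plus(2)[OF assms(2), of "i mod int N" "i div int N"] by (simp add: algebra_simps)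
  also have "\<bar>\<dots>\<bar> \<le> (\<Sum>i\<in>{0..<int N}. \<bar>v i\<bar>)"
    using assms(1) by (intro member_le_sum[of _ _ "\<lambda>i. \<bar>v i\<bar>"]) auto
  finally show "\<bar>v i\<bar> \<le> (\<Sum>i\<in>{0..<int N}. \<bar>v i\<bar>)" .
qed

lemma XM_step:
  fixes v :: "int \<Rightarrow> real"
  assumes N: "N \<ge> 1" and v: "grid_fun N v"
  shows "integrable XM (\<lambda>x. v (ix N x))" "(LINT x|XM. v (ix N x)) = (\<Sum>i\<in>{0..<int N}. dx N * v i)"
proof -
  interpret finite_measure XM by (rule finite_measure_XM)
  have m[measurable]: "(\<lambda>x. v (ix N x)) \<in> borel_measurable XM" 
    by (rule measurable_compose[OF ix_XM]) simp
  obtain B where B: "\<And>i. \<bar>v i\<bar> \<le> B" using grid_fun_bounded[OF N v] by blast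
  show i: "integrable XM (\<lambda>x. v (ix N x))"
    by (rule integrable_const_bound[of _ B]) (use B in auto)
  have "(LINT x|XM. v (ix N x)) = (LINT x:{0..<1}|lebesgue. v (ix N x))" by (rule set_integral_XM[symmetric]) fact
  also have "\<dots> = (\<Sum>n\<in>{0..<int N}. LINT x:cell N n|lebesgue. v (ix N x))"
    by (rule torus_integral_cells(1)[OF N torus_fun_step[OF N v]]) (use i m set_integrable_XM in blast)
  also have "\<dots> = (\<Sum>i\<in>{0..<int N}. dx N * v i)"
  proof (rule sum.cong[OF refl])
    fix n 
    have "(LINT x:cell N n|lebesgue. v (ix N x)) = (LINT x:cell N n|lebesgue. v n)"
      by (rule set_lebesgue_integral_cong) (auto simp: ix_cell[OF N], simp add: cell_def)
    also have "\<dots> = dx N * v n"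
      using dx_pos[OF N] by (simp add: cell_def set_lebesgue_integral_def algebra_simps)
    finally show "(LINT x:cell N n|lebesgue. v (ix N x)) = dx N * v n" .
  qed
  finally show "(LINT x|XM. v (ix N x)) = (\<Sum>i\<in>{0..<int N}. dx N * v i)" .
qed

lemma YM_step:
  fixes b :: "nat \<Rightarrow> real"
  assumes T: "T > 0" and NT: "NT \<ge> 1"
  shows "integrable (YM T) (\<lambda>t. b (kt T NT t))" "(LINT t|YM T. b (kt T NT t)) = (\<Sum>k\<in>{1..NT}. dt T NT * b k)"
proof -
  interpret finite_measure "YM T" by (rule finite_measure_YM)
  note d = dt_pos[OF T NT]
  have m[measurable]: "(\<lambda>x. b (kt T NT x)) \<in> borel_measurable (YM T)" 
    by (rule measurable_compose[OF kt_YM]) simp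
  have B: "\<bar>b (kt T NT t)\<bar> \<le> (\<Sum>k\<in>{1..NT}. \<bar>b k\<bar>)" if "t \<in> {0<..<T}" for t
    using kt_range[OF T NT, of t] that by (intro member_le_sum[of _ _ "\<lambda>i. \<bar>b i\<bar>"]) auto
  show i: "integrable (YM T) (\<lambda>t. b (kt T NT t))"
    by (rule integrable_const_bound[of _ "\<Sum>k\<in>{1..NT}. \<bar>b k\<bar>"]) (use B in auto)
  let ?I = "\<lambda>k. {(real k - 1) * dt T NT <.. real k * dt T NT}"
  have e: "indicator {0<..<T} t *\<^sub>R b (kt T NT t) = (\<Sum>k\<in>{1..NT}. b k * indicat_real (?I k) t)" if "t \<noteq> T" for t
  proof (cases "t \<in> {0<..<T}")
    case True
    then have r: "kt T NT t \<in> {1..NT}" using kt_range[OF T NT, of t] by auto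
    have "indicat_real (?I k) t = (if kt T NT t = k then 1 else 0)" if "k \<in> {1..NT}" for k
      using kt_iff[OF T NT, of k t] that by (auto simp: indicator_def)
    then have "(\<Sum>k\<in>{1..NT}. b k * indicat_real (?I k) t) = (\<Sum>k\<in>{1..NT}. if kt T NT t = k then b k else 0)"
      by (intro sum.cong) auto
    also have "\<dots> = b (kt T NT t)" using r by simp
    finally show ?thesis using True by simp
  next
    case False
    have "t \<notin> ?I k" if "k \<in> {1..NT}" for k
    proof
      assume t: "t \<in> ?I k"
      have "0 \<le> (real k - 1) * dt T NT" "real k * dt T NT \<le> real NT * dt T NT"
        using that d by (auto intro!: mult_right_mono mult_nonneg_nonneg)
      then show False using t False \<open>t \<noteq> T\<close> dt_NT[OF NT, of T] by auto
    qed
    then show ?thesis using False by simp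
  qed
  have "(LINT t|YM T. b (kt T NT t)) = (LINT t|lborel. indicator {0<..<T} t *\<^sub>R b (kt T NT t))"
    unfolding YM_def by (subst integral_restrict_space) auto
  also have "\<dots> = (LINT t|lborel. (\<Sum>k\<in>{1..NT}. b k * indicat_real (?I k) t))"
  proof (rule integral_cong_AE)
    show "(\<lambda>t. indicat_real {0<..<T} t *\<^sub>R b (kt T NT t)) \<in> borel_measurable lborel"
      using m unfolding YM_def by (subst (asm) borel_measurable_restrict_space_iff) auto
    show "AE t in lborel. indicat_real {0<..<T} t *\<^sub>R b (kt T NT t) = (\<Sum>k = 1..NT. b k * indicat_real (?I k) t)"
      using AE_lborel_singleton[of T] by eventually_elim (rule e)
    show "(\<lambda>t. \<Sum>k = 1..NT. b k * indicat_real (?I k) t) \<in> borel_measurable lborel"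
      by (intro borel_measurable_sum borel_measurable_times borel_measurable_const borel_measurable_indicator) auto
  qed
  also have "\<dots> = (\<Sum>k\<in>{1..NT}. b k * measure lborel (?I k))"
  proof (subst Bochner_Integration.integral_sum)
    fix k
    have "(real k - 1) * dt T NT \<le> real k * dt T NT" using d by simp
    then show "integrable lborel (\<lambda>t. b k * indicat_real (?I k) t)"
      by (simp add: integrable_indicator_iff)
  qed simp
  also have "\<dots> = (\<Sum>k\<in>{1..NT}. dt T NT * b k)"
  proof (rule sum.cong[OF refl])
    fix k
    have "(real k - 1) * dt T NT \<le> real k * dt T NT" using d by simp
    then have "measure lborel (?I k) = real k * dt T NT - (real k - 1) * dt T NT" by simp
    then show "b k * measure lborel (?I k) = dt T NT * b k" by (simp add: algebra_simps)
  qed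
  finally show "(LINT t|YM T. b (kt T NT t)) = (\<Sum>k\<in>{1..NT}. dt T NT * b k)" .
qed

lemma step_borel:
  fixes F :: "nat \<Rightarrow> int \<Rightarrow> real"
  shows "(\<lambda>(x, t). F (kt T NT t) (ix N x)) \<in> borel_measurable borel"
proof -
  have "(\<lambda>z. F (kt T NT (snd z)) (ix N (fst z))) \<in> borel_measurable (borel \<Otimes>\<^sub>M borel :: (real\<times>real) measure)"
  proof (rule measurable_compose_countable[where f="\<lambda>k z. F k (ix N (fst z))" and g="\<lambda>z. kt T NT (snd z)"])
    show "(\<lambda>z. F k (ix N (fst z))) \<in> borel_measurable (borel \<Otimes>\<^sub>M borel)" for k
      by (rule measurable_compose[of fst _ borel], simp, rule measurable_compose[OF ix_borel]) simp
    show "(\<lambda>z. kt T NT (snd z)) \<in> borel \<Otimes>\<^sub>M borel \<rightarrow>\<^sub>M count_space UNIV"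
      by (rule measurable_compose[OF measurable_snd kt_borel])
  qed
  then show ?thesis by (simp add: borel_prod split_beta')
qed

lemma PM_step:
  fixes F :: "nat \<Rightarrow> int \<Rightarrow> real"
  assumes T: "T > 0" and N: "N \<ge> 1" and NT: "NT \<ge> 1" and F: "\<And>k. k \<in> {1..NT} \<Longrightarrow> grid_fun N (F k)"
  shows "integrable (PM T) (\<lambda>(x, t). F (kt T NT t) (ix N x))" 
    "(LINT (x, t)|PM T. F (kt T NT t) (ix N x)) = (\<Sum>k\<in>{1..NT}. dt T NT * (\<Sum>i\<in>{0..<int N}. dx N * F k i))"
proof -
  interpret pair_sigma_finite XM "YM T" by (rule pair_XY)
  interpret P: finite_measure "PM T" by (rule finite_measure_PM)
  have "\<forall>k\<in>{1..NT}. \<exists>B. \<forall>i. \<bar>F k i\<bar> \<le> B" using grid_fun_bounded[OF N F] by blast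
  then obtain B where B: "\<And>k i. k \<in> {1..NT} \<Longrightarrow> \<bar>F k i\<bar> \<le> B k" by metis
  have Bs: "\<bar>F k i\<bar> \<le> (\<Sum>k\<in>{1..NT}. \<bar>B k\<bar>)" if "k \<in> {1..NT}" for k i
  proof -
    have "\<bar>F k i\<bar> \<le> \<bar>B k\<bar>" using B[OF that, of i] by simp
    also have "\<dots> \<le> (\<Sum>k\<in>{1..NT}. \<bar>B k\<bar>)" using that by (intro member_le_sum[of _ _ "\<lambda>i. \<bar>B i\<bar>"]) auto
    finally show ?thesis .
  qed
  have m: "(\<lambda>(x, t). F (kt T NT t) (ix N x)) \<in> borel_measurable (PM T)"
    by (rule borel_measurable_PM[OF step_borel])
  have b: "\<bar>F (kt T NT t) (ix N x)\<bar> \<le> (\<Sum>k\<in>{1..NT}. \<bar>B k\<bar>)" if "(x, t) \<in> QT T" for x t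
    using that kt_range[OF T NT, of t] by (intro Bs) (auto simp: QT_def)
  show i: "integrable (PM T) (\<lambda>(x, t). F (kt T NT t) (ix N x))"
    by (rule P.integrable_const_bound[OF _ m, of "\<Sum>k\<in>{1..NT}. \<bar>B k\<bar>"]) (use b in \<open>auto simp: space_PM\<close>)
  have "(LINT (x, t)|PM T. F (kt T NT t) (ix N x)) = (LINT t|YM T. LINT x|XM. F (kt T NT t) (ix N x))"
    using integral_snd[of "\<lambda>x t. F (kt T NT t) (ix N x)"] i by (simp add: PM_def)
  also have "\<dots> = (LINT t|YM T. (\<lambda>k. \<Sum>i\<in>{0..<int N}. dx N * F k i) (kt T NT t))"
  proof (rule Bochner_Integration.integral_cong[OF refl])
    fix t assume "t \<in> space (YM T)"
    then have "kt T NT t \<in> {1..NT}" using kt_range[OF T NT, of t] by auto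
    then show "(LINT x|XM. F (kt T NT t) (ix N x)) = (\<Sum>i\<in>{0..<int N}. dx N * F (kt T NT t) i)"
      using XM_step(2)[OF N F] by blast
  qed
  also have "\<dots> = (\<Sum>k\<in>{1..NT}. dt T NT * (\<Sum>i\<in>{0..<int N}. dx N * F k i))"
    by (rule YM_step(2)[OF T NT])
  finally show "(LINT (x, t)|PM T. F (kt T NT t) (ix N x)) = (\<Sum>k\<in>{1..NT}. dt T NT * (\<Sum>i\<in>{0..<int N}. dx N * F k i))" .
qed

section \<open>Grid functions\<close>

text \<open>
  The total variation over one period of a periodic grid function.
\<close>

definition TV :: "nat \<Rightarrow> (int \<Rightarrow> real) \<Rightarrow> real" where
  "TV N v = (\<Sum>i\<in>{0..<int N}. \<bar>v (i + 1) - v i\<bar>)"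

lemma grid_fun_mod:
  assumes "grid_fun N v" shows "v (i mod int N) = v i"
proof -
  have "v (i mod int N + (i div int N) * int N) = v (i mod int N)" by (rule grid_fun_plus(2)[OF assms])
  then show ?thesis by (simp add: algebra_simps)
qed

lemma grid_sum_shift1:
  fixes v :: "int \<Rightarrow> real"
  assumes N: "N \<ge> 1" and v: "grid_fun N v"
  shows "(\<Sum>i\<in>{0..<int N}. v (i + 1)) = (\<Sum>i\<in>{0..<int N}. v i)"
proof -
  have "(\<Sum>i\<in>{0..<int N}. v (i + 1)) = (\<Sum>i\<in>{1..<int N + 1}. v i)"
    by (rule sum.reindex_bij_witness[of _ "\<lambda>i. i - 1" "\<lambda>i. i + 1"]) auto
  also have "{1..<int N + 1} = insert (int N) {1..<int N}" using N by auto
  also have "(\<Sum>i\<in>insert (int N) {1..<int N}. v i) = v (0 + int N) + (\<Sum>i\<in>{1..<int N}. v i)" by simp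
  also have "\<dots> = (\<Sum>i\<in>insert 0 {1..<int N}. v i)" unfolding grid_fun_plus(1)[OF v] by simp
  also have "insert 0 {1..<int N} = {0..<int N}" using N by auto
  finally show ?thesis .
qed

lemma grid_fun_shift: "grid_fun N v \<Longrightarrow> grid_fun N (\<lambda>i. v (i + s))"
  unfolding periodic_fun_simple_def by (simp add: algebra_simps) (metis add.commute add.left_commute)

lemma grid_sum_shift:
  fixes v :: "int \<Rightarrow> real"
  assumes N: "N \<ge> 1" and v: "grid_fun N v"
  shows "(\<Sum>i\<in>{0..<int N}. v (i + s)) = (\<Sum>i\<in>{0..<int N}. v i)"
proof (induction s rule: int_induct[where k=0])
  case (step1 s)
  have "(\<Sum>i\<in>{0..<int N}. v (i + 1 + s)) = (\<Sum>i\<in>{0..<int N}. v (i + s))"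
    using grid_sum_shift1[OF N grid_fun_shift[OF v, of s]] by simp
  then show ?case using step1 by (simp add: add_ac)
next
  case (step2 s)
  have "(\<Sum>i\<in>{0..<int N}. v (i + 1 + (s - 1))) = (\<Sum>i\<in>{0..<int N}. v (i + (s - 1)))"
    using grid_sum_shift1[OF N grid_fun_shift[OF v, of "s - 1"]] by simp
  then show ?case using step2 by (simp add: algebra_simps)
qed simp

lemma grid_fun_diff: "grid_fun N v \<Longrightarrow> grid_fun N (\<lambda>i. \<bar>v (i + 1) - v i\<bar> :: real)"
  unfolding periodic_fun_simple_def by (metis (no_types, lifting) add.assoc add.commute)

lemma TV_shift:
  assumes "N \<ge> 1" "grid_fun N v"
  shows "(\<Sum>i\<in>{0..<int N}. \<bar>v (i + s + 1) - v (i + s)\<bar>) = TV N v"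
  unfolding TV_def by (rule grid_sum_shift[OF assms(1) grid_fun_diff[OF assms(2)]])

lemma TV_nonneg: "TV N v \<ge> 0" unfolding TV_def by (intro sum_nonneg) auto

lemma telescope_abs:
  fixes v :: "int \<Rightarrow> real"
  assumes "i \<le> j" shows "\<bar>v j - v i\<bar> \<le> (\<Sum>l\<in>{i..<j}. \<bar>v (l + 1) - v l\<bar>)"
  using assms
proof (induction j rule: int_ge_induct)
  case (step j)
  then have "{i..<j + 1} = insert j {i..<j}" by auto
  then have "(\<Sum>l\<in>{i..<j+1}. \<bar>v (l + 1) - v l\<bar>) = \<bar>v (j + 1) - v j\<bar> + (\<Sum>l\<in>{i..<j}. \<bar>v (l + 1) - v l\<bar>)" by simp
  then show ?case using step.IH by linarith
qed simp

lemma osc_le_TV: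
  assumes v: "grid_fun N v" and N: "N \<ge> 1"
  shows "\<bar>v i - v j\<bar> \<le> TV N v"
proof -
  have *: "\<bar>v i - v j\<bar> \<le> TV N v" if "i \<in> {0..<int N}" "j \<in> {0..<int N}" "j \<le> i" for i j
    using telescope_abs[OF that(3), of v] 
      sum_mono2[of "{0..<int N}" "{j..<i}" "\<lambda>l. \<bar>v (l + 1) - v l\<bar>"] that unfolding TV_def by fastforce
  have r: "i mod int N \<in> {0..<int N}" for i using N by auto
  have "\<bar>v (i mod int N) - v (j mod int N)\<bar> \<le> TV N v"
    using *[OF r r, of i j] *[OF r r, of j i] by (cases "i mod int N \<le> j mod int N") auto
  then show ?thesis by (simp only: grid_fun_mod[OF v])
qed

lemma le_mean_plus_TV:
  assumes v: "grid_fun N v" and N: "N \<ge> 1" and M: "(\<Sum>i\<in>{0..<int N}. dx N * v i) = M"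
  shows "v i \<le> M + TV N v"
proof -
  have "v i - M = (\<Sum>j\<in>{0..<int N}. dx N * (v i - v j))"
    using N by (simp add: M[symmetric] sum_subtractf right_diff_distrib dx_def)
  also have "\<dots> \<le> (\<Sum>j\<in>{0..<int N}. dx N * TV N v)"
    using osc_le_TV[OF v N, of i] dx_pos[OF N] by (intro sum_mono mult_left_mono) (auto simp: abs_le_iff)
  also have "\<dots> = TV N v" using N by (simp add: dx_def)
  finally show ?thesis by simp
qed

text \<open>
  With \<open>w = \<surd>v\<close> one has \<open>\<bar>v\<^sub>i\<^sub>+\<^sub>1 - v\<^sub>i\<bar> = \<bar>w\<^sub>i\<^sub>+\<^sub>1 - w\<^sub>i\<bar> (w\<^sub>i\<^sub>+\<^sub>1 + w\<^sub>i)\<close>, and the Cauchy-Schwarz inequality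
  bounds the sum by the discrete \<open>H\<^sup>1\<close> seminorm and the mass. This turns the dissipation of the
  entropy into a bound on the total variation.
\<close>

lemma TV_square_le:
  assumes v: "grid_fun N v" and N: "N \<ge> 1" and M: "(\<Sum>i\<in>{0..<int N}. dx N * v i) = M" and pos: "\<And>i. v i \<ge> 0"
  shows "(TV N v)\<^sup>2 \<le> 4 * M * grid_H1_sq N (\<lambda>i. sqrt (v i))"
proof -
  note d = dx_pos[OF N]
  define w where "w i = sqrt (v i)" for i
  have vw: "v i = (w i)\<^sup>2" and w0: "w i \<ge> 0" for i using pos by (auto simp: w_def)
  define a where "a i = \<bar>w (i + 1) - w i\<bar>" for i
  define b where "b i = w (i + 1) + w i" for i
  have "TV N v = (\<Sum>i\<in>{0..<int N}. a i * b i)"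
    unfolding TV_def a_def b_def vw
  proof (rule sum.cong[OF refl])
    fix i show "\<bar>(w (i + 1))\<^sup>2 - (w i)\<^sup>2\<bar> = \<bar>w (i + 1) - w i\<bar> * (w (i + 1) + w i)"
      using w0[of "i+1"] w0[of i] by (simp add: power2_eq_square square_diff_square_factored abs_mult)
  qed
  then have "(TV N v)\<^sup>2 \<le> (\<Sum>i\<in>{0..<int N}. (a i)\<^sup>2) * (\<Sum>i\<in>{0..<int N}. (b i)\<^sup>2)"
    using Cauchy_Schwarz_ineq_sum[of a b "{0..<int N}"] by simp
  also have "\<dots> \<le> (\<Sum>i\<in>{0..<int N}. (a i)\<^sup>2) * (4 * M / dx N)"
  proof (rule mult_left_mono)
    have "(b i)\<^sup>2 \<le> 2 * v (i + 1) + 2 * v i" for i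
      unfolding b_def vw using sum_squares_bound[of "w (i+1)" "w i"] by (simp add: power2_sum)
    then have "(\<Sum>i\<in>{0..<int N}. (b i)\<^sup>2) \<le> (\<Sum>i\<in>{0..<int N}. 2 * v (i + 1) + 2 * v i)" by (intro sum_mono) 
    also have "\<dots> = 2 * (\<Sum>i\<in>{0..<int N}. v (i + 1)) + 2 * (\<Sum>i\<in>{0..<int N}. v i)"
      by (simp add: sum.distrib sum_distrib_left)
    also have "\<dots> = 4 * M / dx N"
      unfolding grid_sum_shift1[OF N v] M[symmetric] using d by (simp flip: sum_distrib_left)
    finally show "(\<Sum>i\<in>{0..<int N}. (b i)\<^sup>2) \<le> 4 * M / dx N" .
  qed (simp add: sum_nonneg)
  also have "\<dots> = 4 * M * grid_H1_sq N w"
  proof -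
    have "grid_H1_sq N w = (\<Sum>i\<in>{0..<int N}. (a i)\<^sup>2) / dx N"
      unfolding grid_H1_sq_def sum_divide_distrib a_def
      using d by (intro sum.cong) (auto simp: power2_eq_square)
    then show ?thesis by simp
  qed
  finally show ?thesis by (simp add: w_def[abs_def])
qed

text \<open>
  The variation of a grid function over the \<open>R\<close> cells on each side of cell \<open>i\<close>.
\<close>

definition local_var :: "(int \<Rightarrow> real) \<Rightarrow> nat \<Rightarrow> int \<Rightarrow> real" where
  "local_var v R i = (\<Sum>s\<in>{-int R..<int R}. \<bar>v (i + s + 1) - v (i + s)\<bar>)"

lemma local_var_bound:
  assumes "\<bar>i - j\<bar> \<le> int R" shows "\<bar>v i - v j\<bar> \<le> local_var v R i"
proof -
  have e: "(\<Sum>l\<in>{a..<b}. \<bar>v (l + 1) - v l\<bar>) \<le> local_var v R i" if "i - int R \<le> a" "b \<le> i + int R" for a b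
  proof -
    have "(\<Sum>l\<in>{a..<b}. \<bar>v (l + 1) - v l\<bar>) \<le> (\<Sum>l\<in>{i - int R..<i + int R}. \<bar>v (l + 1) - v l\<bar>)"
      using that by (intro sum_mono2) auto
    also have "\<dots> = local_var v R i" unfolding local_var_def
      by (rule sum.reindex_bij_witness[of _ "\<lambda>s. i + s" "\<lambda>l. l - i"]) (auto simp: algebra_simps)
    finally show ?thesis .
  qed
  show ?thesis
  proof (cases "i \<le> j")
    case True then show ?thesis using telescope_abs[OF True, of v] e[of i j] assms by linarith
  next
    case False then have "j \<le> i" by simp
    then show ?thesis using telescope_abs[of j i v] e[of j i] assms by linarith
  qed
qed

lemma grid_fun_local_var: "grid_fun N v \<Longrightarrow> grid_fun N (local_var v R)"
  unfolding local_var_def periodic_fun_simple_def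
proof (intro allI sum.cong refl)
  fix x s assume v: "\<forall>x. v (x + int N) = v x"
  have "x + int N + s + 1 = (x + s + 1) + int N" "x + int N + s = (x + s) + int N" by auto
  then show "\<bar>v (x + int N + s + 1) - v (x + int N + s)\<bar> = \<bar>v (x + s + 1) - v (x + s)\<bar>"
    using v by metis
qed

lemma sum_local_var:
  assumes "N \<ge> 1" "grid_fun N v"
  shows "(\<Sum>i\<in>{0..<int N}. dx N * local_var v R i) = 2 * real R * dx N * TV N v"
proof -
  have "(\<Sum>i\<in>{0..<int N}. local_var v R i) = (\<Sum>s\<in>{-int R..<int R}. TV N v)"
    unfolding local_var_def by (subst sum.swap) (simp only: TV_shift[OF assms])
  then show ?thesis by (simp flip: sum_distrib_left)
qed

section \<open>A priori estimates\<close>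

lemma h_nonneg: assumes "c > 0" "x \<ge> 0" shows "h c x \<ge> 0"
proof (cases "x = 0")
  case True then show ?thesis using assms by (simp add: h_def)
next
  case False
  have "ln (1 / x) \<le> 1 / x - 1" using False assms by (intro ln_le_minus_one) auto
  then have "x * ln (1 / x) \<le> x * (1 / x - 1)" using assms(2) by (rule mult_left_mono)
  then have "0 \<le> x * (ln x - 1) + 1" using False assms by (simp add: ln_div algebra_simps)
  then show ?thesis using assms by (simp add: h_def)
qed

lemma h_tangent: assumes "c > 0" "b > 0" "x \<ge> 0" shows "h c b + ln b / c * (x - b) \<le> h c x"
proof -
  have "b * (ln b - 1) + 1 + ln b * (x - b) \<le> x * (ln x - 1) + 1"
  proof (cases "x = 0")
    case False
    have "ln (b / x) \<le> b / x - 1" using False assms by (intro ln_le_minus_one) auto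
    then have "x * ln (b / x) \<le> x * (b / x - 1)" using assms(3) by (rule mult_left_mono)
    then have "x * (ln b - ln x) \<le> b - x" using False assms by (simp add: ln_div right_diff_distrib)
    then show ?thesis by (simp add: algebra_simps)
  qed (use assms in \<open>simp add: algebra_simps\<close>)
  then have "(1 / c) * (b * (ln b - 1) + 1 + ln b * (x - b)) \<le> (1 / c) * (x * (ln x - 1) + 1)"
    using assms by (intro mult_left_mono) auto
  then show ?thesis unfolding h_def by (simp add: algebra_simps add_divide_distrib diff_divide_distrib)
qed

lemma integral_cell_const: "N \<ge> 1 \<Longrightarrow> (LINT x:cell N i|lebesgue. (c::real)) = dx N * c"
  using dx_pos[of N] by (simp add: cell_def set_lebesgue_integral_def algebra_simps)

lemma set_integrable_cell_const: "N \<ge> 1 \<Longrightarrow> set_integrable lebesgue (cell N i) (\<lambda>x. c::real)"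
  using dx_pos[of N] unfolding set_integrable_def cell_def by (simp add: integrable_indicator_iff algebra_simps)

text \<open>
  Averaging over cells does not increase the integral of the convex function \<open>h c\<close>, by the tangent
  inequality at the average. The tangent is vertical at average 0; there \<open>h c 0 = 1/c\<close>, which costs
  at most the additional term \<open>1/c\<close>.
\<close>

lemma initial_entropy_bound:
  assumes c: "c > 0" and N: "N \<ge> 1" and u0: "L1_torus u0" and pos: "AE x in lebesgue. u0 x \<ge> 0"
    and hu: "L1_torus (\<lambda>x. h c (u0 x))"
    and a0: "\<And>i. cell_avg N u0 i \<ge> 0"
  shows "(\<Sum>i\<in>{0..<int N}. dx N * h c (cell_avg N u0 i)) \<le> (LINT x:{0..<1}|lebesgue. h c (u0 x)) + 1 / c"
proof -
  note d = dx_pos[OF N]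
  note cu = torus_integral_cells(2)[OF N, of u0] and ch = torus_integral_cells[OF N, of "\<lambda>x. h c (u0 x)"]
  have iu: "set_integrable lebesgue (cell N i) u0" for i using u0 cu unfolding L1_torus_def by blast
  have ih: "set_integrable lebesgue (cell N i) (\<lambda>x. h c (u0 x))" for i using hu ch unfolding L1_torus_def by blast
  have "dx N * h c (cell_avg N u0 i) \<le> (LINT x:cell N i|lebesgue. h c (u0 x)) + dx N * (1 / c)" for i
  proof (cases "cell_avg N u0 i = 0")
    case True
    have "0 \<le> (LINT x:cell N i|lebesgue. h c (u0 x))"
      unfolding set_lebesgue_integral_def
      by (rule integral_nonneg_AE) (use pos in eventually_elim, auto simp: h_nonneg[OF c])
    then show ?thesis unfolding True by (simp add: h_def)
  next
    case False
    define b where "b = cell_avg N u0 i"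
    have b: "b > 0" using False a0[of i] by (simp add: b_def)
    have bi: "(LINT x:cell N i|lebesgue. u0 x) = dx N * b" using d by (simp add: b_def cell_avg_def)
    have il: "set_integrable lebesgue (cell N i) (\<lambda>x. h c b + ln b / c * (u0 x - b))"
      by (intro set_integral_add set_integrable_mult_right set_integral_diff iu set_integrable_cell_const[OF N])
    have "dx N * h c b = (LINT x:cell N i|lebesgue. h c b + ln b / c * (u0 x - b))"
      by (simp add: iu set_integrable_cell_const[OF N] integral_cell_const[OF N] bi)
    also have "\<dots> \<le> (LINT x:cell N i|lebesgue. h c (u0 x))"
      unfolding set_lebesgue_integral_def
    proof (rule integral_mono_AE)
      show "AE x in lebesgue. indicat_real (cell N i) x *\<^sub>R (h c b + ln b / c * (u0 x - b)) \<le> indicat_real (cell N i) x *\<^sub>R h c (u0 x)"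
        using pos by eventually_elim (use h_tangent[OF c b] in \<open>auto simp: indicator_def\<close>)
    qed (use il ih in \<open>auto simp: set_integrable_def\<close>)
    finally show ?thesis using d c unfolding b_def by (simp add: add_increasing2)
  qed
  then have "(\<Sum>i\<in>{0..<int N}. dx N * h c (cell_avg N u0 i)) \<le> (\<Sum>i\<in>{0..<int N}. (LINT x:cell N i|lebesgue. h c (u0 x)) + dx N * (1 / c))"
    by (rule sum_mono)
  also have "\<dots> = (LINT x:{0..<1}|lebesgue. h c (u0 x)) + 1 / c"
    using ch(1) hu N unfolding L1_torus_def by (simp add: sum.distrib dx_def)
  finally show ?thesis .
qed

lemma cell_avg_grid_fun:
  assumes N: "N \<ge> 1" and f: "torus_fun f" shows "grid_fun N (cell_avg N f)"
proof
  fix i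
  have "indicat_real (cell N (i + int N)) (1 + 1 * x) *\<^sub>R f (1 + 1 * x) = indicat_real (cell N i) x *\<^sub>R f x" for x
  proof -
    have "1 + x \<in> cell N (i + int N) \<longleftrightarrow> x \<in> cell N i"
      using dx_N[OF N] unfolding cell_def by (auto simp: algebra_simps)
    moreover have "f (1 + x) = f x" using torus_fun_plus_int[OF f, of x 1] by (simp add: add.commute)
    ultimately show ?thesis by (simp add: indicator_def)
  qed
  then show "cell_avg N f (i + int N) = cell_avg N f i"
    using lebesgue_integral_real_affine[of 1 "\<lambda>x. indicat_real (cell N (i + int N)) x *\<^sub>R f x" 1]
    unfolding cell_avg_def set_lebesgue_integral_def by simp
qed

lemma Linf_torus_integrable:
  assumes "Linf_torus f" shows "set_integrable lebesgue {a..<b} f"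
proof -
  obtain C where C: "AE x in lebesgue. \<bar>f x\<bar> \<le> C" using assms by (auto simp: Linf_torus_def)
  have "integrable lebesgue (\<lambda>x. indicat_real {a..<b} x *\<^sub>R C)" by (cases "a \<le> b") (auto simp: integrable_indicator_iff)
  then show ?thesis unfolding set_integrable_def
  proof (rule Bochner_Integration.integrable_bound)
    have "f \<in> borel_measurable lebesgue" using assms by (auto simp: Linf_torus_def)
    then show "(\<lambda>x. indicat_real {a..<b} x *\<^sub>R f x) \<in> borel_measurable lebesgue"
      by (intro borel_measurable_scaleR borel_measurable_indicator) auto
    show "AE x in lebesgue. norm (indicat_real {a..<b} x *\<^sub>R f x) \<le> norm (indicat_real {a..<b} x *\<^sub>R C)"
      using C by eventually_elim (auto simp: indicator_def)
  qed
qed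

lemma Linf_torus_cell: assumes "N \<ge> 1" "Linf_torus f" shows "set_integrable lebesgue (cell N i) f"
  using torus_integral_cells(2)[OF assms(1) _ Linf_torus_integrable[OF assms(2)]] assms(2) by (auto simp: Linf_torus_def)

lemma cell_avg_bounds:
  assumes N: "N \<ge> 1" and f: "Linf_torus f" and pos: "AE x in lebesgue. f x \<ge> 0" and C: "AE x in lebesgue. \<bar>f x\<bar> \<le> C"
  shows "0 \<le> cell_avg N f i" "cell_avg N f i \<le> C"
proof -
  note d = dx_pos[OF N]
  have "0 \<le> (LINT x:cell N i|lebesgue. f x)" unfolding set_lebesgue_integral_def
    by (rule integral_nonneg_AE) (use pos in eventually_elim, auto)
  then show "0 \<le> cell_avg N f i" using d by (simp add: cell_avg_def)
  have "(LINT x:cell N i|lebesgue. f x) \<le> (LINT x:cell N i|lebesgue. C)"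
    unfolding set_lebesgue_integral_def
  proof (rule integral_mono_AE)
    show "AE x in lebesgue. indicat_real (cell N i) x *\<^sub>R f x \<le> indicat_real (cell N i) x *\<^sub>R C"
      using C by eventually_elim (auto simp: indicator_def)
  qed (use Linf_torus_cell[OF N f, of i] set_integrable_cell_const[OF N, of i C] in \<open>auto simp: set_integrable_def\<close>)
  then show "cell_avg N f i \<le> C" using d by (simp add: cell_avg_def integral_cell_const[OF N] field_simps)
qed

lemma grid_conv_bounds:
  assumes N: "N \<ge> 1" and a: "\<And>i. 0 \<le> a i" "\<And>i. a i \<le> C" and v: "\<And>i. v i \<ge> 0" "(\<Sum>i\<in>{0..<int N}. dx N * v i) = M"
  shows "0 \<le> grid_conv N a v i" "grid_conv N a v i \<le> C * M"
proof -
  note d = dx_pos[OF N]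
  show "0 \<le> grid_conv N a v i" unfolding grid_conv_def using a v d by (intro sum_nonneg) auto
  have "grid_conv N a v i \<le> (\<Sum>n\<in>{0..<int N}. C * (dx N * v n))"
    unfolding grid_conv_def using a v d by (intro sum_mono) (simp add: mult.left_commute mult_left_mono mult_right_mono mult.assoc)
  also have "\<dots> = C * M" by (simp add: v(2)[symmetric] sum_distrib_left)
  finally show "grid_conv N a v i \<le> C * M" .
qed

lemma grid_conv_grid_fun: "grid_fun N a \<Longrightarrow> grid_fun N (grid_conv N a v)"
proof
  fix i assume a: "grid_fun N a"
  have "a (i + int N - n) = a (i - n)" for n using grid_fun_plus(1)[OF a, of "i - n"] by (simp add: algebra_simps)
  then show "grid_conv N a v (i + int N) = grid_conv N a v i" by (simp add: grid_conv_def)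
qed

lemma nonlocal_dissip_nonneg:
  assumes N: "N \<ge> 1" and f: "Linf_torus f" and pos: "AE x in lebesgue. f x \<ge> 0"
  shows "nonlocal_dissip N f v w \<ge> 0"
proof -
  obtain C where C: "AE x in lebesgue. \<bar>f x\<bar> \<le> C" using f by (auto simp: Linf_torus_def)
  show ?thesis unfolding nonlocal_dissip_def
    by (intro sum_nonneg mult_nonneg_nonneg cell_avg_bounds(1)[OF N f pos C]) auto
qed

lemma grid_H1_sq_nonneg: "N \<ge> 1 \<Longrightarrow> grid_H1_sq N w \<ge> 0"
  using dx_pos[of N] unfolding grid_H1_sq_def by (intro sum_nonneg) auto

lemma sum_dissipation:
  assumes "entropy_inequality T N NT d1 d2 d11 d12 d21 d22 \<rho> \<sigma>1 \<sigma>2 U1 U2" "n \<le> NT"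
  shows "entropy N d12 d21 (U1 n) (U2 n) + (\<Sum>k\<in>{1..n}. dt T NT * dissipation N d1 d2 d11 d12 d21 d22 \<rho> \<sigma>1 \<sigma>2 (U1 k) (U2 k))
    \<le> entropy N d12 d21 (U1 0) (U2 0)"
  using assms(2)
proof (induction n)
  case (Suc n)
  have "entropy N d12 d21 (U1 (Suc n)) (U2 (Suc n))
        + dt T NT * dissipation N d1 d2 d11 d12 d21 d22 \<rho> \<sigma>1 \<sigma>2 (U1 (Suc n)) (U2 (Suc n))
        \<le> entropy N d12 d21 (U1 (Suc n - 1)) (U2 (Suc n - 1))"
    using assms(1) Suc.prems unfolding entropy_inequality_def by (metis Suc_le_mono atLeastAtMost_iff le0 One_nat_def)
  then show ?case using Suc by simp
qed simp

section \<open>Bump functions and local averages\<close>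

lemma second_difference_mvt:
  fixes f :: "real \<Rightarrow> real" and h :: real
  assumes f: "\<And>x. (f has_real_derivative f' x) (at x)" and f': "\<And>x. (f' has_real_derivative f'' x) (at x)" and h: "h > 0"
  shows "\<exists>\<xi>. \<bar>\<xi> - x\<bar> \<le> h \<and> f (x + h) - 2 * f x + f (x - h) = h\<^sup>2 * f'' \<xi>"
proof -
  define F where "F y = f (y + h) - f y" for y
  have dF: "(F has_real_derivative f' (y + h) - f' y) (at y)" for y
    unfolding F_def by (auto intro!: derivative_eq_intros DERIV_chain2[OF f])
  obtain \<eta> where \<eta>: "x - h < \<eta>" "\<eta> < x" "F x - F (x - h) = (x - (x - h)) * (f' (\<eta> + h) - f' \<eta>)"
    using MVT2[of "x - h" x F "\<lambda>y. f' (y + h) - f' y"] dF h by auto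
  obtain \<xi> where \<xi>: "\<eta> < \<xi>" "\<xi> < \<eta> + h" "f' (\<eta> + h) - f' \<eta> = (\<eta> + h - \<eta>) * f'' \<xi>"
    using MVT2[of \<eta> "\<eta> + h" f' f''] f' h by auto
  show ?thesis
  proof (intro exI conjI)
    show "\<bar>\<xi> - x\<bar> \<le> h" using \<eta> \<xi> by auto
    show "f (x + h) - 2 * f x + f (x - h) = h\<^sup>2 * f'' \<xi>"
      using \<eta>(3) unfolding \<xi>(3) F_def by (simp add: power2_eq_square)
  qed
qed

text \<open>
  The powers of the positive part with exponent at least 2 are continuously differentiable; the
  cube is twice differentiable.
\<close>

lemma max0_power_deriv:
  "((\<lambda>s::real. max 0 s ^ Suc (Suc n)) has_real_derivative real (Suc (Suc n)) * max 0 s ^ Suc n) (at s)"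
proof -
  consider "s > 0" | "s < 0" | "s = 0" by linarith
  then show ?thesis
  proof cases
    case 1
    have "((\<lambda>s::real. s ^ Suc (Suc n)) has_real_derivative real (Suc (Suc n)) * max 0 s ^ Suc n) (at s)"
      using 1 DERIV_pow[of "Suc (Suc n)" s] by simp
    then show ?thesis
      by (rule has_field_derivative_transform_within_open[of _ _ _ "{0<..}"]) (use 1 in \<open>auto simp: max_def\<close>)
  next
    case 2
    have "((\<lambda>s::real. 0) has_real_derivative real (Suc (Suc n)) * max 0 s ^ Suc n) (at s)"
      using 2 by simp
    then show ?thesis
      by (rule has_field_derivative_transform_within_open[of _ _ _ "{..<0}"]) (use 2 in \<open>auto simp: max_def\<close>)
  next
    case 3
    have "((\<lambda>h::real. (max 0 (0 + h) ^ Suc (Suc n) - max 0 0 ^ Suc (Suc n)) / h) \<longlongrightarrow> 0) (at 0)"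
    proof (rule Lim_null_comparison)
      show "\<forall>\<^sub>F h::real in at 0. norm ((max 0 (0 + h) ^ Suc (Suc n) - max 0 0 ^ Suc (Suc n)) / h) \<le> \<bar>h\<bar> ^ Suc n"
      proof (intro always_eventually allI)
        fix h :: real
        have "0 \<le> \<bar>h\<bar> ^ Suc n" by (rule zero_le_power) simp
        then show "norm ((max 0 (0 + h) ^ Suc (Suc n) - max 0 0 ^ Suc (Suc n)) / h) \<le> \<bar>h\<bar> ^ Suc n"
          by (cases "h \<le> 0") (simp_all add: max_def abs_mult)
      qed
      show "((\<lambda>h::real. \<bar>h\<bar> ^ Suc n) \<longlongrightarrow> 0) (at 0)"
        by (intro tendsto_eq_intros) auto
    qed
    then show ?thesis unfolding 3 has_field_derivative_def DERIV_def by (simp add: DERIV_def[unfolded has_field_derivative_def, symmetric] has_field_derivative_def[symmetric] DERIV_def)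
  qed
qed

text \<open>
  A periodic, twice differentiable bump of width \<open>1/n\<close> centred at \<open>(l+1/2)/n\<close>. Taking the positive part of
  a shifted cosine makes periodicity and localisation immediate.
\<close>

definition bump :: "nat \<Rightarrow> nat \<Rightarrow> real \<Rightarrow> real" where
  "bump n l x = max 0 (cos (2 * pi * (x - (real l + 1/2) / real n)) - cos (pi / real n)) ^ 3"

lemma bump_nonneg: "bump n l x \<ge> 0" by (simp add: bump_def)

lemma bump_le: "bump n l x \<le> 8"
proof -
  have "cos (2 * pi * (x - (real l + 1/2) / real n)) - cos (pi / real n) \<le> 2"
    using cos_le_one[of "2 * pi * (x - (real l + 1/2) / real n)"] cos_ge_minus_one[of "pi / real n"] by linarith
  then have "max 0 (cos (2 * pi * (x - (real l + 1/2) / real n)) - cos (pi / real n)) \<le> 2" by simp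
  then have "bump n l x \<le> 2 ^ 3" unfolding bump_def by (intro power_mono) auto
  then show ?thesis by simp
qed

lemma bump_continuous: "continuous_on S (bump n l)"
  unfolding bump_def by (intro continuous_intros)

lemma bump_periodic: "bump n l (x + of_int p) = bump n l x"
proof -
  have "cos (2 * pi * (x + of_int p - (real l + 1/2) / real n)) = cos (2 * pi * (x - (real l + 1/2) / real n) + 2 * pi * of_int p)"
    by (simp add: algebra_simps)
  also have "\<dots> = cos (2 * pi * (x - (real l + 1/2) / real n))"
    by (simp add: cos_add sin_integer_2pi cos_integer_2pi)
  finally show ?thesis unfolding bump_def by simp
qed

lemma bump_second_difference:
  "\<exists>K\<ge>0. \<forall>h>0. \<forall>x. \<bar>bump n l (x + h) - 2 * bump n l x + bump n l (x - h)\<bar> \<le> K * h\<^sup>2"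
proof -
  define y where "y = (real l + 1/2) / real n"
  define c where "c = cos (pi / real n)"
  define a where "a x = cos (2 * pi * (x - y)) - c" for x
  define f' where "f' x = (3 * max 0 (a x) ^ 2) * (- sin (2 * pi * (x - y)) * (2 * pi))" for x
  define f'' where "f'' x = (3 * (2 * max 0 (a x) * (- sin (2 * pi * (x - y)) * (2 * pi)))) * (- sin (2 * pi * (x - y)) * (2 * pi))
     + (- cos (2 * pi * (x - y)) * (2 * pi) * (2 * pi)) * (3 * max 0 (a x) ^ 2)" for x
  have da: "(a has_real_derivative - sin (2 * pi * (x - y)) * (2 * pi)) (at x)" for x
    unfolding a_def by (auto intro!: derivative_eq_intros)
  have q3: "((\<lambda>s::real. max 0 s ^ 3) has_real_derivative 3 * max 0 s ^ 2) (at s)" for s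
    using max0_power_deriv[of 1 s] by (simp add: numeral_eq_Suc)
  have q2: "((\<lambda>s::real. max 0 s ^ 2) has_real_derivative 2 * max 0 s) (at s)" for s
    using max0_power_deriv[of 0 s] by (simp add: numeral_eq_Suc)
  have b: "bump n l = (\<lambda>x. max 0 (a x) ^ 3)" by (auto simp: bump_def a_def c_def y_def)
  have d1: "(bump n l has_real_derivative f' x) (at x)" for x
    unfolding b f'_def by (rule DERIV_chain2[OF q3 da])
  have d2': "((\<lambda>x. 3 * max 0 (a x) ^ 2) has_real_derivative 3 * (2 * max 0 (a x) * (- sin (2 * pi * (x - y)) * (2 * pi)))) (at x)" for x
    by (rule DERIV_cmult, rule DERIV_chain2[OF q2 da])
  have d2'': "((\<lambda>x. - sin (2 * pi * (x - y)) * (2 * pi)) has_real_derivative - cos (2 * pi * (x - y)) * (2 * pi) * (2 * pi)) (at x)" for x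
    by (auto intro!: derivative_eq_intros)
  have d2: "(f' has_real_derivative f'' x) (at x)" for x
    unfolding f'_def f''_def by (rule DERIV_mult[OF d2' d2''])
  define K where "K = 3 * (2 * 2 * (1 * (2 * pi))) * (1 * (2 * pi)) + (1 * (2 * pi) * (2 * pi)) * (3 * 2 ^ 2)"
  have bd: "\<bar>f'' x\<bar> \<le> K" for x
  proof -
    have "a x \<le> 2"
      using cos_le_one[of "2 * pi * (x - y)"] cos_ge_minus_one[of "pi / real n"] unfolding a_def c_def by linarith
    then have m: "0 \<le> max 0 (a x)" "max 0 (a x) \<le> 2" by simp_all
    have s: "\<bar>sin (2 * pi * (x - y))\<bar> \<le> 1" "\<bar>cos (2 * pi * (x - y))\<bar> \<le> 1" by auto
    have "\<bar>f'' x\<bar> \<le> 3 * (2 * max 0 (a x) * (\<bar>sin (2 * pi * (x - y))\<bar> * (2 * pi))) * (\<bar>sin (2 * pi * (x - y))\<bar> * (2 * pi))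
       + \<bar>cos (2 * pi * (x - y))\<bar> * (2 * pi) * (2 * pi) * (3 * max 0 (a x) ^ 2)"
      unfolding f''_def by (rule order_trans[OF abs_triangle_ineq]) (simp add: abs_mult)
    also have "\<dots> \<le> K" unfolding K_def
      by (intro add_mono mult_mono power_mono s m order_refl) (auto intro!: mult_nonneg_nonneg simp: m)
    finally show ?thesis .
  qed
  show ?thesis
  proof (intro exI[of _ K] conjI allI impI)
    show "K \<ge> 0" using bd[of 0] by linarith
    fix h x :: real assume h: "h > 0"
    obtain \<xi> where "bump n l (x + h) - 2 * bump n l x + bump n l (x - h) = h\<^sup>2 * f'' \<xi>"
      using second_difference_mvt[OF d1 d2 h, of x] by auto
    then show "\<bar>bump n l (x + h) - 2 * bump n l x + bump n l (x - h)\<bar> \<le> K * h\<^sup>2"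
      using mult_right_mono[OF bd[of \<xi>], of "h\<^sup>2"] by (simp add: abs_mult mult.commute)
  qed
qed

lemma bump_support:
  assumes n: "n \<ge> 1" and pos: "bump n l x > 0"
  shows "\<exists>p::int. \<bar>x - (real l + 1/2) / real n - of_int p\<bar> < 1 / (2 * real n)"
proof -
  define z where "z = x - (real l + 1/2) / real n"
  define p where "p = round z"
  have pz: "\<bar>z - of_int p\<bar> \<le> 1/2" using of_int_round_abs_le[of z] unfolding p_def by (simp add: abs_minus_commute)
  have "cos (2 * pi * z) = cos (2 * pi * (z - of_int p) + 2 * pi * of_int p)" by (simp add: algebra_simps)
  also have "\<dots> = cos (2 * pi * (z - of_int p))" by (simp add: cos_add sin_integer_2pi cos_integer_2pi)
  also have "\<dots> = cos (2 * pi * \<bar>z - of_int p\<bar>)" by (simp add: abs_if) (metis cos_minus minus_diff_eq mult_minus_right)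
  finally have e: "cos (2 * pi * z) = cos (2 * pi * \<bar>z - of_int p\<bar>)" .
  have "cos (2 * pi * z) > cos (pi / real n)"
  proof (rule ccontr)
    assume "\<not> ?thesis" then have "bump n l x = 0" unfolding bump_def z_def by (simp add: max_def)
    then show False using pos by simp
  qed
  then have c: "cos (pi / real n) < cos (2 * pi * \<bar>z - of_int p\<bar>)" unfolding e .
  have "2 * pi * \<bar>z - of_int p\<bar> < pi / real n"
  proof (rule ccontr)
    assume "\<not> ?thesis"
    then have "cos (2 * pi * \<bar>z - of_int p\<bar>) \<le> cos (pi / real n)"
      using n pz by (intro cos_monotone_0_pi_le) auto
    then show False using c by simp
  qed
  then have "pi * (2 * \<bar>z - of_int p\<bar>) < pi * (1 / real n)" by (simp add: mult_ac)
  then have "2 * \<bar>z - of_int p\<bar> < 1 / real n" by (simp only: mult_less_cancel_left_pos[OF pi_gt_zero])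
  then show ?thesis unfolding z_def by (auto intro!: exI[of _ p] simp: field_simps)
qed

text \<open>
  The discrete pairing of a grid function with a bump sampled at the cell centres.
\<close>

definition bump_sum :: "nat \<Rightarrow> nat \<Rightarrow> nat \<Rightarrow> (int \<Rightarrow> real) \<Rightarrow> real" where
  "bump_sum N n l v = (\<Sum>i\<in>{0..<int N}. dx N * bump n l (of_int i * dx N) * v i)"

text \<open>
  The average of a grid function weighted by a bump, normalised by the discrete mass of the bump.
\<close>

definition local_avg :: "nat \<Rightarrow> nat \<Rightarrow> nat \<Rightarrow> (int \<Rightarrow> real) \<Rightarrow> real" where
  "local_avg N n l v = bump_sum N n l v / bump_sum N n l (\<lambda>_. 1)"

lemma grid_fun_sample:
  assumes "N \<ge> 1" "\<And>x p. f (x + real_of_int p) = f x" shows "grid_fun N (\<lambda>i. f (of_int i * dx N))"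
proof
  fix i
  have "of_int (i + int N) * dx N = of_int i * dx N + of_int 1" using dx_N[OF assms(1)] by (simp add: algebra_simps)
  then show "f (of_int (i + int N) * dx N) = f (of_int i * dx N)" by (simp only: assms(2))
qed

text \<open>
  The centre of every cell that contributes to the average is, modulo the period, within \<open>1/n + \<Delta>x/2\<close> of the centre
  of cell \<open>i\<close>.
\<close>

lemma local_avg_close:
  assumes N: "N \<ge> 1" and n: "n \<ge> 1" and v: "grid_fun N v" and S: "bump_sum N n l (\<lambda>_. 1) > 0"
    and i: "\<bar>of_int i * dx N - (real l + 1/2) / real n\<bar> \<le> 1 / (2 * real n) + dx N / 2"
    and R: "real N / real n + 1 \<le> real R"
  shows "\<bar>v i - local_avg N n l v\<bar> \<le> local_var v R i"
proof -
  note d = dx_pos[OF N]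
  define w where "w j = dx N * bump n l (of_int j * dx N)" for j
  have w0: "w j \<ge> 0" for j using d bump_nonneg by (simp add: w_def)
  have S1: "bump_sum N n l (\<lambda>_. 1) = (\<Sum>j\<in>{0..<int N}. w j)" by (simp add: bump_sum_def w_def)
  have close: "w j * \<bar>v i - v j\<bar> \<le> w j * local_var v R i" for j
  proof (cases "bump n l (of_int j * dx N) > 0")
    case True
    obtain p where p: "\<bar>of_int j * dx N - (real l + 1/2) / real n - of_int p\<bar> < 1 / (2 * real n)"
      using bump_support[OF n True] by blast
    \<comment> \<open>The representative of cell \<open>j\<close> modulo the period that lies near the centre of the bump.\<close>
    define j' where "j' = j + (- p) * int N"
    have vj: "v j' = v j" unfolding j'_def by (rule grid_fun_plus(2)[OF v])
    have "of_int j' * dx N = of_int j * dx N - of_int p * (real N * dx N)" by (simp add: j'_def algebra_simps)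
    then have j': "of_int j' * dx N = of_int j * dx N - of_int p" by (simp add: dx_N[OF N])
    have "\<bar>of_int i * dx N - of_int j' * dx N\<bar> \<le> 1 / (2 * real n) + dx N / 2 + 1 / (2 * real n)"
      unfolding j' using i p by linarith
    also have "\<dots> = (real N / real n + 1 / 2) * dx N" using N n by (simp add: dx_def field_simps)
    finally have "\<bar>of_int (i - j')\<bar> * dx N \<le> (real N / real n + 1 / 2) * dx N"
      using d by (simp add: left_diff_distrib[symmetric] abs_mult)
    then have "\<bar>of_int (i - j')\<bar> \<le> real N / real n + 1 / 2" using d by (simp add: mult_le_cancel_right)
    then have "\<bar>i - j'\<bar> \<le> int R" using R by linarith
    then have "\<bar>v i - v j'\<bar> \<le> local_var v R i" by (rule local_var_bound)
    then show ?thesis unfolding vj using w0 by (rule mult_left_mono)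
  next
    case False
    then have "w j = 0" using bump_nonneg[of n l "of_int j * dx N"] by (simp add: w_def)
    then show ?thesis by simp
  qed
  have e: "v i - local_avg N n l v = (\<Sum>j\<in>{0..<int N}. w j * (v i - v j)) / bump_sum N n l (\<lambda>_. 1)"
  proof -
    have "(\<Sum>j\<in>{0..<int N}. w j * (v i - v j)) = bump_sum N n l (\<lambda>_. 1) * v i - bump_sum N n l v"
      unfolding S1 by (simp add: right_diff_distrib sum_subtractf sum_distrib_right bump_sum_def w_def)
    then show ?thesis using S by (simp add: local_avg_def field_simps)
  qed
  have "\<bar>\<Sum>j\<in>{0..<int N}. w j * (v i - v j)\<bar> \<le> (\<Sum>j\<in>{0..<int N}. w j * \<bar>v i - v j\<bar>)"
    by (rule order_trans[OF sum_abs]) (simp add: abs_mult w0)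
  also have "\<dots> \<le> (\<Sum>j\<in>{0..<int N}. w j * local_var v R i)" by (intro sum_mono close)
  also have "\<dots> = bump_sum N n l (\<lambda>_. 1) * local_var v R i" by (simp add: S1 sum_distrib_right)
  finally show ?thesis unfolding e using S by (simp add: field_simps)
qed

text \<open>
  Summation by parts on the periodic grid.
\<close>

lemma discrete_green:
  fixes a b :: "int \<Rightarrow> real"
  assumes N: "N \<ge> 1" and a: "grid_fun N a" and b: "grid_fun N b"
  shows "(\<Sum>i\<in>{0..<int N}. a i * (b (i + 1) - 2 * b i + b (i - 1))) = (\<Sum>i\<in>{0..<int N}. (a (i + 1) - 2 * a i + a (i - 1)) * b i)"
proof -
  have *: "(\<Sum>i\<in>{0..<int N}. a i * b (i + 1)) = (\<Sum>i\<in>{0..<int N}. a (i - 1) * b i)" if a: "grid_fun N a" and b: "grid_fun N b" for a b :: "int \<Rightarrow> real"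
  proof -
    have "grid_fun N (\<lambda>i. a (i - 1) * b i)"
    proof
      fix i have "a (i + int N - 1) = a (i - 1)" using grid_fun_plus(1)[OF a, of "i - 1"] by (simp add: algebra_simps)
      then show "a (i + int N - 1) * b (i + int N) = a (i - 1) * b i" by (simp add: grid_fun_plus(1)[OF b])
    qed
    from grid_sum_shift1[OF N this] show ?thesis by simp
  qed
  have **: "(\<Sum>i\<in>{0..<int N}. a i * b (i - 1)) = (\<Sum>i\<in>{0..<int N}. a (i + 1) * b i)"
    using *[OF b a] by (simp add: mult.commute)
  show ?thesis
    by (simp add: algebra_simps sum.distrib sum_subtractf * [OF a b] ** sum_distrib_left[symmetric])
qed

lemma close_tendsto:
  fixes a b c :: "nat \<Rightarrow> real"
  assumes "\<And>m. \<bar>a m - b m\<bar> \<le> c m" "c \<longlonglongrightarrow> 0" "b \<longlonglongrightarrow> l"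
  shows "a \<longlonglongrightarrow> l"
proof -
  have "(\<lambda>m. a m - b m) \<longlonglongrightarrow> 0"
    by (rule Lim_null_comparison[OF always_eventually assms(2)]) (use assms(1) in simp)
  from tendsto_add[OF this assms(3)] show ?thesis by simp
qed

lemma cell_center_tendsto:
  assumes "\<And>m. N m \<ge> 1" "(\<lambda>m. dx (N m)) \<longlonglongrightarrow> 0"
  shows "(\<lambda>m. of_int (ix (N m) x) * dx (N m)) \<longlonglongrightarrow> x"
proof (rule close_tendsto[OF _ _ tendsto_const])
  show "\<bar>of_int (ix (N m) x) * dx (N m) - x\<bar> \<le> dx (N m) / 2" for m
    using ix_dist[OF assms(1), of x m] by (simp add: abs_minus_commute)
  show "(\<lambda>m. dx (N m) / 2) \<longlonglongrightarrow> 0" using tendsto_divide[OF assms(2) tendsto_const, of 2] by simp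
qed

text \<open>
  The discrete mass of a bump is a Riemann sum. Its limit is positive, so the normalisation in
  \<open>local_avg\<close> is eventually bounded below.
\<close>

lemma bump_sum_one_tendsto:
  assumes N: "\<And>m. N m \<ge> 1" and d: "(\<lambda>m. dx (N m)) \<longlonglongrightarrow> 0" and n: "n \<ge> 1" and l: "l < n"
  shows "\<exists>s>0. (\<lambda>m. bump_sum (N m) n l (\<lambda>_. 1)) \<longlonglongrightarrow> s"
proof -
  interpret finite_measure XM by (rule finite_measure_XM)
  define y where "y = (real l + 1/2) / real n"
  have bm: "bump n l \<in> borel_measurable borel" by (rule borel_measurable_continuous_onI[OF bump_continuous])
  have bX: "bump n l \<in> borel_measurable XM" using bm by (rule borel_XM)
  have ib: "integrable XM (bump n l)"
    by (rule integrable_const_bound[OF _ bX, of 8]) (use bump_le bump_nonneg in auto)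
  have e: "bump_sum (N m) n l (\<lambda>_. 1) = (LINT x|XM. bump n l (of_int (ix (N m) x) * dx (N m)))" for m
  proof -
    have "grid_fun (N m) (\<lambda>i. bump n l (of_int i * dx (N m)))" by (rule grid_fun_sample[where f="bump n l", OF N bump_periodic])
    have "(LINT x|XM. bump n l (of_int (ix (N m) x) * dx (N m))) = (\<Sum>i\<in>{0..<int (N m)}. dx (N m) * bump n l (of_int i * dx (N m)))"
      by (rule XM_step(2)[OF N]) fact
    then show ?thesis unfolding bump_sum_def by (simp only: mult_1_right)
  qed
  have lim: "(\<lambda>m. bump_sum (N m) n l (\<lambda>_. 1)) \<longlonglongrightarrow> (LINT x|XM. bump n l x)"
    unfolding e
  proof (rule integral_dominated_convergence[where w="\<lambda>_. 8"])
    show "(\<lambda>x. bump n l (of_int (ix (N m) x) * dx (N m))) \<in> borel_measurable XM" for m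
      by (rule measurable_compose[OF ix_XM]) simp
    show "AE x in XM. (\<lambda>m. bump n l (of_int (ix (N m) x) * dx (N m))) \<longlonglongrightarrow> bump n l x"
    proof (rule AE_I2)
      fix x
      have "(\<lambda>m. of_int (ix (N m) x) * dx (N m)) \<longlonglongrightarrow> x" by (rule cell_center_tendsto[OF N d])
      then show "(\<lambda>m. bump n l (of_int (ix (N m) x) * dx (N m))) \<longlonglongrightarrow> bump n l x"
        using continuous_on_tendsto_compose[OF bump_continuous[of UNIV n l]] by auto
    qed
  qed (use bX bump_le bump_nonneg in auto)
  have y: "0 < y" "y < 1" using n l by (auto simp: y_def field_simps)
  have py: "bump n l y > 0"
  proof -
    have "cos (pi / real n) < cos 0" using n divide_left_mono[of 1 "real n" pi] by (intro cos_monotone_0_pi) auto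
    then show ?thesis by (simp add: bump_def y_def)
  qed
  have "isCont (bump n l) y" using bump_continuous[of UNIV n l] by (simp add: continuous_on_eq_continuous_at)
  then obtain \<delta>0 where \<delta>0: "\<delta>0 > 0" "\<And>x. \<bar>x - y\<bar> < \<delta>0 \<Longrightarrow> \<bar>bump n l x - bump n l y\<bar> < bump n l y / 2"
    using py unfolding continuous_at_eps_delta by (metis dist_real_def half_gt_zero)
  \<comment> \<open>The interval to the right of the centre must stay inside the fundamental domain.\<close>
  define \<delta> where "\<delta> = min \<delta>0 (min y (1 - y))"
  have \<delta>: "\<delta> > 0" using \<delta>0(1) y by (auto simp: \<delta>_def)
  have mI: "{y<..<y+\<delta>} \<in> sets XM" unfolding XM_def by (subst sets_restrict_space_iff) (auto simp: \<delta>_def y)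
  have "0 < \<delta> * (bump n l y / 2)" using \<delta> py by simp
  also have "\<dots> = (LINT x|XM. indicator {y<..<y+\<delta>} x * (bump n l y / 2))"
  proof -
    have "measure XM {y<..<y+\<delta>} = \<delta>" unfolding XM_def
      by (subst measure_restrict_space) (use \<delta> y in \<open>auto simp: \<delta>_def\<close>)
    moreover have "{y<..<y+\<delta>} \<inter> space XM = {y<..<y+\<delta>}" using sets.sets_into_space[OF mI] by blast
    ultimately show ?thesis by simp
  qed
  also have "\<dots> \<le> (LINT x|XM. bump n l x)"
  proof (rule integral_mono[OF _ ib])
    show "integrable XM (\<lambda>x. indicator {y<..<y+\<delta>} x * (bump n l y / 2))"
      using mI by (intro integrable_mult_left integrable_real_indicator) (auto simp: less_top[symmetric])
    show "indicator {y<..<y+\<delta>} x * (bump n l y / 2) \<le> bump n l x" for x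
    proof (cases "x \<in> {y<..<y+\<delta>}")
      case True
      then have "\<bar>x - y\<bar> < \<delta>0" by (auto simp: \<delta>_def)
      from \<delta>0(2)[OF this] have "bump n l y / 2 \<le> bump n l x" by linarith
      then show ?thesis using True by simp
    qed (simp add: bump_nonneg)
  qed
  finally show ?thesis using lim by blast
qed

section \<open>Compactness of discrete solutions\<close>

text \<open>
  The bound may depend on the index \<open>x\<close>: rescaling reduces this to a common bound.
\<close>

lemma diagonal_convergent_subsequence:
  fixes f :: "nat \<Rightarrow> 'a \<Rightarrow> real"
  assumes "countable S" and b: "\<And>x. x \<in> S \<Longrightarrow> Bseq (\<lambda>n. f n x)"
  shows "\<exists>k. strict_mono (k::nat\<Rightarrow>nat) \<and> (\<forall>x\<in>S. convergent (\<lambda>n. f (k n) x))"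
proof -
  have "\<exists>B>0. \<forall>n. \<bar>f n x\<bar> \<le> B" if "x \<in> S" for x
    using b[OF that] unfolding Bseq_def by auto
  then obtain B where B: "\<And>x. x \<in> S \<Longrightarrow> B x > 0" "\<And>x n. x \<in> S \<Longrightarrow> \<bar>f n x\<bar> \<le> B x" by metis
  have "norm (f n x / B x) \<le> 1" if "x \<in> S" for n x using B[OF that] by simp
  then obtain k where k: "strict_mono (k::nat\<Rightarrow>nat)" "\<And>x. x \<in> S \<Longrightarrow> \<exists>l. (\<lambda>n. f (k n) x / B x) \<longlonglongrightarrow> l"
    using function_convergent_subsequence[OF assms(1), of "\<lambda>n x. f n x / B x" 1] by blast
  have "convergent (\<lambda>n. f (k n) x)" if x: "x \<in> S" for x
  proof -
    obtain l where "(\<lambda>n. f (k n) x / B x) \<longlonglongrightarrow> l" using k(2)[OF x] by blast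
    then have "(\<lambda>n. f (k n) x / B x * B x) \<longlonglongrightarrow> l * B x" by (intro tendsto_mult) auto
    then show ?thesis using B(1)[OF x] by (auto simp: convergent_def)
  qed
  then show ?thesis using k(1) by blast
qed

text \<open>
  Convergence at rational times propagates to all times when the functions are uniformly Lipschitz up to a
  vanishing error \<open>d m\<close>, which accounts for the jumps between time levels.
\<close>

lemma equi_lipschitz_convergent:
  fixes f :: "nat \<Rightarrow> real \<Rightarrow> real"
  assumes T: "T > 0" and L: "L \<ge> 0" and d: "d \<longlonglongrightarrow> 0"
    and lip: "\<And>m s t. m \<ge> m0 \<Longrightarrow> s \<in> {0<..<T} \<Longrightarrow> t \<in> {0<..<T} \<Longrightarrow> \<bar>f m t - f m s\<bar> \<le> L * (\<bar>t - s\<bar> + d m)"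
    and conv: "\<And>q. q \<in> \<rat> \<Longrightarrow> q \<in> {0<..<T} \<Longrightarrow> convergent (\<lambda>m. f m q)"
    and t: "t \<in> {0<..<T}"
  shows "convergent (\<lambda>m. f m t)"
proof -
  have "Cauchy (\<lambda>m. f m t)"
  proof (rule metric_CauchyI)
    fix e :: real assume e: "e > 0"
    define \<delta> where "\<delta> = e / (8 * (L + 1))"
    have \<delta>: "\<delta> > 0" "L * \<delta> \<le> e / 8" using e L by (auto simp: \<delta>_def field_simps)
    have "t < min T (t + \<delta>)" using t \<delta> by auto
    then obtain q where q: "q \<in> \<rat>" "t < q" "q < min T (t + \<delta>)" using Rats_dense_in_real by blast
    have qT: "q \<in> {0<..<T}" and tq: "\<bar>t - q\<bar> \<le> \<delta>" using q t by auto
    obtain m1 where m1: "\<And>m m'. m \<ge> m1 \<Longrightarrow> m' \<ge> m1 \<Longrightarrow> \<bar>f m q - f m' q\<bar> < e / 4"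
      using convergent_Cauchy[OF conv[OF q(1) qT]] e unfolding Cauchy_def dist_real_def by (meson divide_pos_pos zero_less_numeral)
    obtain m2 where m2: "\<And>m. m \<ge> m2 \<Longrightarrow> \<bar>d m\<bar> < \<delta>"
      using d \<delta>(1) unfolding lim_sequentially dist_real_def by (metis diff_zero)
    have l: "\<bar>f m t - f m q\<bar> \<le> e / 4" if "m \<ge> max m0 m2" for m
    proof -
      have "\<bar>f m t - f m q\<bar> \<le> L * (\<bar>t - q\<bar> + d m)" using lip[OF _ qT t] that by simp
      also have "\<dots> \<le> L * (\<delta> + \<delta>)" using L tq m2[of m] that by (intro mult_left_mono) auto
      finally show ?thesis using \<delta> by (simp add: algebra_simps)
    qed
    show "\<exists>M. \<forall>m\<ge>M. \<forall>n\<ge>M. dist (f m t) (f n t) < e"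
    proof (intro exI allI impI)
      fix m n assume mn: "m \<ge> max (max m0 m2) m1" "n \<ge> max (max m0 m2) m1"
      have "\<bar>f m t - f m q\<bar> \<le> e / 4" by (rule l) (use mn in simp)
      moreover have "\<bar>f n t - f n q\<bar> \<le> e / 4" by (rule l) (use mn in simp)
      moreover have "\<bar>f m q - f n q\<bar> < e / 4" by (rule m1) (use mn in simp_all)
      ultimately show "dist (f m t) (f n t) < e" using e unfolding dist_real_def by linarith
    qed
  qed
  then show ?thesis by (rule Cauchy_convergent)
qed

text \<open>
  A family of nonnegative discrete solutions \<open>U m\<close> of \<open>(U\<^sub>k - U\<^sub>k\<^sub>-\<^sub>1)/\<Delta>t = \<Delta>\<^sub>h g\<^sub>k\<close> on meshes with vanishing steps,
  with mass \<open>M\<close>, total variation bounded by \<open>B\<close> in \<open>L\<^sup>1\<close> in time, and a nonnegative flux \<open>g\<close> of mass at most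
  \<open>E\<close>. The form of the flux is irrelevant for compactness.
\<close>

locale discrete_family =
  fixes T :: real and N NT :: "nat \<Rightarrow> nat" and U g :: "nat \<Rightarrow> nat \<Rightarrow> int \<Rightarrow> real" and M B E :: real
  assumes T: "T > 0" and N: "\<And>m. N m \<ge> 1" and NT: "\<And>m. NT m \<ge> 1"
    and dx0: "(\<lambda>m. dx (N m)) \<longlonglongrightarrow> 0" and dt0: "(\<lambda>m. dt T (NT m)) \<longlonglongrightarrow> 0"
    and U_grid: "\<And>m k. k \<le> NT m \<Longrightarrow> grid_fun (N m) (U m k)"
    and g_grid: "\<And>m k. k \<in> {1..NT m} \<Longrightarrow> grid_fun (N m) (g m k)"
    and U_nonneg: "\<And>m k i. k \<le> NT m \<Longrightarrow> U m k i \<ge> 0"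
    and U_mass: "\<And>m k. k \<le> NT m \<Longrightarrow> (\<Sum>i\<in>{0..<int (N m)}. dx (N m) * U m k i) = M"
    and U_TV: "\<And>m. (\<Sum>k\<in>{1..NT m}. dt T (NT m) * TV (N m) (U m k)) \<le> B"
    and U_step: "\<And>m k i. k \<in> {1..NT m} \<Longrightarrow>
       U m k i - U m (k - 1) i = dt T (NT m) / (dx (N m))\<^sup>2 * (g m k (i + 1) - 2 * g m k i + g m k (i - 1))"
    and g_nonneg: "\<And>m k i. k \<in> {1..NT m} \<Longrightarrow> g m k i \<ge> 0"
    and g_mass: "\<And>m k. k \<in> {1..NT m} \<Longrightarrow> (\<Sum>i\<in>{0..<int (N m)}. dx (N m) * g m k i) \<le> E"
begin

text \<open>
  The piecewise constant reconstruction on the cylinder.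
\<close>

abbreviation step :: "nat \<Rightarrow> real \<times> real \<Rightarrow> real" where
  "step m \<equiv> \<lambda>(x, t). U m (kt T (NT m) t) (ix (N m) x)"

lemma discrete_family_subseq: "strict_mono (r :: nat \<Rightarrow> nat) \<Longrightarrow> discrete_family T (\<lambda>m. N (r m)) (\<lambda>m. NT (r m)) (\<lambda>m. U (r m)) (\<lambda>m. g (r m)) M B E"
  using T N NT U_grid g_grid U_nonneg U_mass U_TV U_step g_nonneg g_mass 
    LIMSEQ_subseq_LIMSEQ[OF dx0, of r] LIMSEQ_subseq_LIMSEQ[OF dt0, of r]
  by (intro discrete_family.intro) (simp_all add: o_def)

text \<open>
  The scheme is tested with a bump. Both discrete derivatives are moved onto the bump, whose second
  difference is of order \<open>\<Delta>x\<^sup>2\<close>; the flux is only needed in \<open>L\<^sup>1\<close>.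
\<close>

lemma bump_sum_step:
  assumes K: "\<And>h x. h > 0 \<Longrightarrow> \<bar>bump n l (x + h) - 2 * bump n l x + bump n l (x - h)\<bar> \<le> K * h\<^sup>2" 
    and k: "k \<in> {1..NT m}" and K0: "K \<ge> 0"
  shows "\<bar>bump_sum (N m) n l (U m k) - bump_sum (N m) n l (U m (k - 1))\<bar> \<le> dt T (NT m) * (K * E)"
proof -
  let ?d = "dx (N m)" and ?t = "dt T (NT m)" and ?I = "{0..<int (N m)}"
  note d = dx_pos[OF N, of m] and t = dt_pos[OF T NT, of m]
  define \<psi> where "\<psi> i = bump n l (of_int i * ?d)" for i
  have gp: "grid_fun (N m) \<psi>" unfolding \<psi>_def by (rule grid_fun_sample[where f="bump n l", OF N bump_periodic])
  have K': "\<bar>\<psi> (i + 1) - 2 * \<psi> i + \<psi> (i - 1)\<bar> \<le> K * ?d\<^sup>2" for i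
    using K[OF d, of "of_int i * ?d"] by (simp add: \<psi>_def algebra_simps)
  have "bump_sum (N m) n l (U m k) - bump_sum (N m) n l (U m (k - 1)) = (\<Sum>i\<in>?I. ?d * \<psi> i * (U m k i - U m (k - 1) i))"
    by (simp add: bump_sum_def \<psi>_def sum_subtractf right_diff_distrib)
  also have "\<dots> = ?t / ?d * (\<Sum>i\<in>?I. \<psi> i * (g m k (i + 1) - 2 * g m k i + g m k (i - 1)))"
    unfolding U_step[OF k] sum_distrib_left using d by (intro sum.cong) (auto simp: power2_eq_square)
  also have "\<dots> = ?t / ?d * (\<Sum>i\<in>?I. (\<psi> (i + 1) - 2 * \<psi> i + \<psi> (i - 1)) * g m k i)"
    by (simp only: discrete_green[OF N gp g_grid[OF k]])
  finally have "\<bar>bump_sum (N m) n l (U m k) - bump_sum (N m) n l (U m (k - 1))\<bar> = ?t / ?d * \<bar>\<Sum>i\<in>?I. (\<psi> (i + 1) - 2 * \<psi> i + \<psi> (i - 1)) * g m k i\<bar>"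
    using d t by (simp add: abs_mult)
  also have "\<dots> \<le> ?t / ?d * (\<Sum>i\<in>?I. K * ?d\<^sup>2 * g m k i)"
  proof (intro mult_left_mono order_trans[OF sum_abs] sum_mono)
    fix i show "\<bar>(\<psi> (i + 1) - 2 * \<psi> i + \<psi> (i - 1)) * g m k i\<bar> \<le> K * ?d\<^sup>2 * g m k i"
      unfolding abs_mult using g_nonneg[OF k, of i] mult_right_mono[OF K'[of i] g_nonneg[OF k, of i]] by simp
  qed (use d t in auto)
  also have "\<dots> = ?t * (K * (\<Sum>i\<in>?I. ?d * g m k i))"
    using d by (simp add: sum_distrib_left power2_eq_square mult_ac)
  also have "\<dots> \<le> ?t * (K * E)"
    using t K0 g_mass[OF k] by (intro mult_left_mono) auto
  finally show ?thesis .
qed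

lemma bump_sum_lipschitz:
  assumes K: "\<And>h x. h > 0 \<Longrightarrow> \<bar>bump n l (x + h) - 2 * bump n l x + bump n l (x - h)\<bar> \<le> K * h\<^sup>2" 
    and K0: "K \<ge> 0" and j: "j \<le> k" and k: "k \<le> NT m"
  shows "\<bar>bump_sum (N m) n l (U m k) - bump_sum (N m) n l (U m j)\<bar> \<le> (real k - real j) * dt T (NT m) * (K * E)"
  using j k
proof (induction k rule: dec_induct)
  case (step k)
  have "\<bar>bump_sum (N m) n l (U m (Suc k)) - bump_sum (N m) n l (U m k)\<bar> \<le> dt T (NT m) * (K * E)"
    using bump_sum_step[OF K, of "Suc k" m] step.prems K0 by simp
  moreover have "\<bar>bump_sum (N m) n l (U m k) - bump_sum (N m) n l (U m j)\<bar> \<le> (real k - real j) * dt T (NT m) * (K * E)"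
    using step by simp
  ultimately have "\<bar>bump_sum (N m) n l (U m (Suc k)) - bump_sum (N m) n l (U m j)\<bar> \<le> dt T (NT m) * (K * E) + (real k - real j) * dt T (NT m) * (K * E)"
    by linarith
  then show ?case by (simp add: algebra_simps)
qed simp

lemma E_nonneg: "E \<ge> 0"
proof -
  have "0 \<le> (\<Sum>i\<in>{0..<int (N 0)}. dx (N 0) * g 0 1 i)"
    using dx_pos[OF N, of 0] g_nonneg[of 1 0] NT[of 0] by (intro sum_nonneg) auto
  also have "\<dots> \<le> E" using g_mass[of 1 0] NT[of 0] by simp
  finally show ?thesis .
qed

lemma M_nonneg: "M \<ge> 0"
  unfolding U_mass[OF le0, symmetric, of 0] using dx_pos[OF N, of 0] U_nonneg[OF le0, of 0] by (intro sum_nonneg) auto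

text \<open>
  The local average of the step function as a function of time.
\<close>

definition avg :: "nat \<Rightarrow> nat \<Rightarrow> nat \<Rightarrow> real \<Rightarrow> real" where
  "avg n l m t = local_avg (N m) n l (U m (kt T (NT m) t))"

lemma avg_eventually:
  assumes n: "n \<ge> 1" and l: "l < n"
  shows "\<exists>m0 L C. L \<ge> 0 \<and> (\<forall>m\<ge>m0. bump_sum (N m) n l (\<lambda>_. 1) > 0
     \<and> (\<forall>t\<in>{0<..<T}. \<bar>avg n l m t\<bar> \<le> C)
     \<and> (\<forall>s\<in>{0<..<T}. \<forall>t\<in>{0<..<T}. \<bar>avg n l m t - avg n l m s\<bar> \<le> L * (\<bar>t - s\<bar> + dt T (NT m))))"
proof -
  obtain s where s: "s > 0" "(\<lambda>m. bump_sum (N m) n l (\<lambda>_. 1)) \<longlonglongrightarrow> s"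
    using bump_sum_one_tendsto[OF N dx0 n l] by blast
  then have "\<forall>\<^sub>F m in sequentially. bump_sum (N m) n l (\<lambda>_. 1) > s / 2"
    by (intro order_tendstoD) auto
  then obtain m0 where m0: "\<And>m. m \<ge> m0 \<Longrightarrow> bump_sum (N m) n l (\<lambda>_. 1) > s / 2" by (auto simp: eventually_sequentially)
  obtain K where K: "K \<ge> 0" "\<And>h x. h > 0 \<Longrightarrow> \<bar>bump n l (x + h) - 2 * bump n l x + bump n l (x - h)\<bar> \<le> K * h\<^sup>2"
    using bump_second_difference[of n l] by blast
  define L where "L = K * E / (s / 2)"
  have KE: "K * E \<ge> 0" using K E_nonneg by simp
  have L0: "L \<ge> 0" using KE s unfolding L_def by simp
  have "\<bar>avg n l m t\<bar> \<le> 8 * M / (s / 2)" if m: "m \<ge> m0" and t: "t \<in> {0<..<T}" for m t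
  proof -
    have k: "kt T (NT m) t \<le> NT m" using kt_range[OF T NT, of t m] t by auto
    have d: "dx (N m) > 0" by (rule dx_pos[OF N])
    have b0: "0 \<le> bump_sum (N m) n l (U m (kt T (NT m) t))" unfolding bump_sum_def
      using d bump_nonneg U_nonneg[OF k] by (intro sum_nonneg) auto
    have "bump_sum (N m) n l (U m (kt T (NT m) t)) \<le> (\<Sum>i\<in>{0..<int (N m)}. 8 * (dx (N m) * U m (kt T (NT m) t) i))"
      unfolding bump_sum_def
    proof (rule sum_mono)
      fix i 
      have "bump n l (of_int i * dx (N m)) * (dx (N m) * U m (kt T (NT m) t) i) \<le> 8 * (dx (N m) * U m (kt T (NT m) t) i)"
        using d bump_le U_nonneg[OF k] by (intro mult_right_mono) auto
      then show "dx (N m) * bump n l (of_int i * dx (N m)) * U m (kt T (NT m) t) i \<le> 8 * (dx (N m) * U m (kt T (NT m) t) i)"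
        by (simp add: mult_ac)
    qed
    also have "\<dots> = 8 * M" by (subst sum_distrib_left[symmetric]) (simp only: U_mass[OF k])
    finally have "bump_sum (N m) n l (U m (kt T (NT m) t)) / bump_sum (N m) n l (\<lambda>_. 1) \<le> 8 * M / (s / 2)"
      using m0[OF m] s(1) M_nonneg by (intro frac_le) linarith+
    then show ?thesis unfolding avg_def local_avg_def
      using b0 m0[OF m] s(1) by simp
  qed
  moreover have "\<bar>avg n l m t - avg n l m s'\<bar> \<le> L * (\<bar>t - s'\<bar> + dt T (NT m))" 
    if m: "m \<ge> m0" and s': "s' \<in> {0<..<T}" and t: "t \<in> {0<..<T}" for m t s'
  proof -
    have *: "\<bar>bump_sum (N m) n l (U m (kt T (NT m) t)) - bump_sum (N m) n l (U m (kt T (NT m) s'))\<bar> \<le> (\<bar>t - s'\<bar> + dt T (NT m)) * (K * E)"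
      if s': "s' \<in> {0<..<T}" and t: "t \<in> {0<..<T}" and le: "kt T (NT m) s' \<le> kt T (NT m) t" for s' t
    proof -
      have k: "kt T (NT m) t \<le> NT m" using kt_range[OF T NT, of t m] t by auto
      have "\<bar>bump_sum (N m) n l (U m (kt T (NT m) t)) - bump_sum (N m) n l (U m (kt T (NT m) s'))\<bar> 
          \<le> (real (kt T (NT m) t) - real (kt T (NT m) s')) * dt T (NT m) * (K * E)"
        by (rule bump_sum_lipschitz[OF K(2,1) le k])
      also have "\<dots> \<le> (\<bar>t - s'\<bar> + dt T (NT m)) * (K * E)"
        using kt_bounds[OF T NT, of t m] kt_bounds[OF T NT, of s' m] s' t
        by (intro mult_right_mono KE) (auto simp: algebra_simps abs_if)
      finally show ?thesis .
    qed
    have **: "\<bar>bump_sum (N m) n l (U m (kt T (NT m) t)) - bump_sum (N m) n l (U m (kt T (NT m) s'))\<bar> \<le> (\<bar>t - s'\<bar> + dt T (NT m)) * (K * E)"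
      using *[OF s' t] *[OF t s'] by (cases "kt T (NT m) s' \<le> kt T (NT m) t") (auto simp: abs_minus_commute)
    have "\<bar>avg n l m t - avg n l m s'\<bar> = \<bar>bump_sum (N m) n l (U m (kt T (NT m) t)) - bump_sum (N m) n l (U m (kt T (NT m) s'))\<bar> / bump_sum (N m) n l (\<lambda>_. 1)"
      unfolding avg_def local_avg_def using m0[OF m] s(1) by (simp add: diff_divide_distrib[symmetric])
    also have "\<dots> \<le> ((\<bar>t - s'\<bar> + dt T (NT m)) * (K * E)) / (s / 2)"
      using ** m0[OF m] s(1) dt_pos[OF T NT, of m] KE by (intro frac_le) auto
    also have "\<dots> = L * (\<bar>t - s'\<bar> + dt T (NT m))" by (simp add: L_def)
    finally show ?thesis .
  qed
  moreover have "bump_sum (N m) n l (\<lambda>_. 1) > 0" if m: "m \<ge> m0" for m using m0[OF m] s(1) by linarith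
  ultimately show ?thesis
    by (intro exI[of _ m0] exI[of _ L] exI[of _ "8 * M / (s/2)"] conjI L0 allI impI ballI)
qed

lemma step_integrable: "integrable (PM T) (step m)"
proof -
  have "k \<in> {1..NT m} \<Longrightarrow> grid_fun (N m) (U m k)" for k by (rule U_grid) simp
  from PM_step(1)[OF T N NT this] show ?thesis .
qed

text \<open>
  On the space interval \<open>[l/n, (l+1)/n)\<close> the step function differs from its local average by a local
  variation, whose space-time integral is of order \<open>1/n + \<Delta>x\<close> uniformly in \<open>m\<close>. For fixed \<open>n\<close> there are
  finitely many averages, and they converge pointwise and boundedly in time.
\<close>

lemma L1_Cauchy_of_avg:
  assumes conv: "\<And>n l q. n \<ge> 1 \<Longrightarrow> l < n \<Longrightarrow> q \<in> \<rat> \<Longrightarrow> q \<in> {0<..<T} \<Longrightarrow> convergent (\<lambda>m. avg n l m q)"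
    and e: "e > 0"
  shows "\<exists>m0. \<forall>i\<ge>m0. \<forall>j\<ge>m0. (LINT z|PM T. norm (step i z - step j z)) < e"
proof -
  interpret Y: finite_measure "YM T" by (rule finite_measure_YM)
  interpret pair_sigma_finite XM "YM T" by (rule pair_XY)
  have B0: "B \<ge> 0" using U_TV[of 0] by (rule order_trans[rotated]) (use dt_pos[OF T NT, of 0] TV_nonneg in \<open>intro sum_nonneg, auto\<close>)
  obtain n :: nat where n: "n \<ge> 1" "2 * B / real n < e / 4"
  proof -
    obtain n :: nat where "8 * B / e < real n" using reals_Archimedean2 by blast
    then have "2 * B / real (Suc n) < e / 4" using e B0 by (simp add: field_simps)
    then show ?thesis using that[of "Suc n"] by simp
  qed
  have "\<exists>m0. \<forall>l<n. \<exists>C. \<forall>m\<ge>m0. bump_sum (N m) n l (\<lambda>_. 1) > 0 \<and> (\<forall>t\<in>{0<..<T}. \<bar>avg n l m t\<bar> \<le> C)"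
  proof -
    have "\<forall>l\<in>{..<n}. \<exists>m0. \<exists>C. \<forall>m\<ge>m0. bump_sum (N m) n l (\<lambda>_. 1) > 0 \<and> (\<forall>t\<in>{0<..<T}. \<bar>avg n l m t\<bar> \<le> C)"
      using avg_eventually[OF n(1)] by (metis lessThan_iff)
    then obtain f where f: "\<And>l. l < n \<Longrightarrow> \<exists>C. \<forall>m\<ge>f l. bump_sum (N m) n l (\<lambda>_. 1) > 0 \<and> (\<forall>t\<in>{0<..<T}. \<bar>avg n l m t\<bar> \<le> C)"
      by (metis lessThan_iff)
    show ?thesis
    proof (intro exI[of _ "\<Sum>l<n. f l"] allI impI)
      fix l assume l: "l < n"
      have "f l \<le> (\<Sum>l<n. f l)" using l by (intro member_le_sum) auto
      then show "\<exists>C. \<forall>m\<ge>\<Sum>l<n. f l. bump_sum (N m) n l (\<lambda>_. 1) > 0 \<and> (\<forall>t\<in>{0<..<T}. \<bar>avg n l m t\<bar> \<le> C)"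
        using f[OF l] by (meson order_trans)
    qed
  qed
  then obtain m1 C where m1: "\<And>l m. l < n \<Longrightarrow> m \<ge> m1 \<Longrightarrow> bump_sum (N m) n l (\<lambda>_. 1) > 0"
    and C: "\<And>l m t. l < n \<Longrightarrow> m \<ge> m1 \<Longrightarrow> t \<in> {0<..<T} \<Longrightarrow> \<bar>avg n l m t\<bar> \<le> C l" by metis
  define c where "c l t = lim (\<lambda>m. avg n l m t)" for l t
  have lim: "(\<lambda>m. avg n l m t) \<longlonglongrightarrow> c l t" if l: "l < n" and t: "t \<in> {0<..<T}" for l t
  proof -
    obtain m0 L where L: "L \<ge> 0" "\<And>m s t. m \<ge> m0 \<Longrightarrow> s \<in> {0<..<T} \<Longrightarrow> t \<in> {0<..<T} \<Longrightarrow> \<bar>avg n l m t - avg n l m s\<bar> \<le> L * (\<bar>t - s\<bar> + dt T (NT m))"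
      using avg_eventually[OF n(1) l] by blast
    have "convergent (\<lambda>m. avg n l m t)"
      by (rule equi_lipschitz_convergent[OF T L(1) dt0 L(2) conv[OF n(1) l] t])
    then show ?thesis unfolding c_def by (simp add: convergent_LIMSEQ_iff)
  qed
  have am[measurable]: "(\<lambda>t. avg n l m t) \<in> borel_measurable (YM T)" for l m
    unfolding avg_def by (rule measurable_compose[OF kt_YM]) simp
  have cm[measurable]: "c l \<in> borel_measurable (YM T)" for l unfolding c_def[abs_def] by measurable
  have cC: "\<bar>c l t\<bar> \<le> C l" if "l < n" "t \<in> {0<..<T}" for l t
    by (rule LIMSEQ_le_const2[OF tendsto_rabs[OF lim[OF that]]]) (use C that in blast)
  have dC: "\<bar>avg n l m t - c l t\<bar> \<le> C l + C l" if "l < n" "m \<ge> m1" "t \<in> {0<..<T}" for l m t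
    using C[OF that] cC[OF that(1,3)] by linarith
  define D where "D l m = (LINT t|YM T. \<bar>avg n l m t - c l t\<bar>)" for l m
  have Di: "integrable (YM T) (\<lambda>t. \<bar>avg n l m t - c l t\<bar>)" if "l < n" "m \<ge> m1" for l m
    by (rule Y.integrable_const_bound[of _ "C l + C l"]) 
       (use dC[OF that] in auto)
  have D0: "(\<lambda>m. D l (m + m1)) \<longlonglongrightarrow> 0" if l: "l < n" for l
  proof -
    have "(\<lambda>m. LINT t|YM T. \<bar>avg n l (m + m1) t - c l t\<bar>) \<longlonglongrightarrow> (LINT t|YM T. 0)"
    proof (rule integral_dominated_convergence[where w="\<lambda>_. C l + C l"])
      show "AE t in YM T. (\<lambda>m. \<bar>avg n l (m + m1) t - c l t\<bar>) \<longlonglongrightarrow> 0"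
      proof (rule AE_I2)
        fix t assume "t \<in> space (YM T)"
        then have "(\<lambda>m. avg n l (m + m1) t) \<longlonglongrightarrow> c l t" using LIMSEQ_ignore_initial_segment[OF lim[OF l]] by simp
        then show "(\<lambda>m. \<bar>avg n l (m + m1) t - c l t\<bar>) \<longlonglongrightarrow> 0" using tendsto_rabs_zero LIM_zero by blast
      qed
      show "AE t in YM T. norm \<bar>avg n l (m + m1) t - c l t\<bar> \<le> C l + C l" for m
        using dC[OF l, of "m + m1"] by auto
    qed auto
    then show ?thesis by (simp add: D_def)
  qed
  \<comment> \<open>The number of cells in an interval of length \<open>1/n\<close>, with a margin for the position inside the cell.\<close>
  define R where "R m = nat \<lceil>real (N m) / real n\<rceil> + 1" for m
  have R1: "real (N m) / real n + 1 \<le> real (R m)" for m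
    unfolding R_def using le_of_int_ceiling[of "real (N m) / real n"] by linarith
  have R2: "real (R m) * dx (N m) \<le> 1 / real n + 2 * dx (N m)" for m
  proof -
    have "real (R m) \<le> real (N m) / real n + 2" unfolding R_def 
      using of_int_ceiling_le_add_one[of "real (N m) / real n"] by (simp add: ceiling_le_zero) linarith
    then have "real (R m) * dx (N m) \<le> (real (N m) / real n + 2) * dx (N m)"
      using dx_pos[OF N, of m] by (intro mult_right_mono) auto
    also have "\<dots> = (real (N m) * dx (N m)) / real n + 2 * dx (N m)" by (simp add: algebra_simps)
    finally show ?thesis by (simp only: dx_N[OF N])
  qed
  define lv where "lv m = (\<lambda>(x, t). local_var (U m (kt T (NT m) t)) (R m) (ix (N m) x))" for m
  have lvi: "integrable (PM T) (lv m)" 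
    and lvI: "(LINT z|PM T. lv m z) \<le> 2 * (1 / real n + 2 * dx (N m)) * B" for m
  proof -
    have gf: "k \<in> {1..NT m} \<Longrightarrow> grid_fun (N m) (local_var (U m k) (R m))" for k
      using grid_fun_local_var U_grid by auto
    show "integrable (PM T) (lv m)" unfolding lv_def by (rule PM_step(1)[OF T N NT gf])
    have "(LINT z|PM T. lv m z) = (\<Sum>k\<in>{1..NT m}. dt T (NT m) * (\<Sum>i\<in>{0..<int (N m)}. dx (N m) * local_var (U m k) (R m) i))"
      unfolding lv_def by (rule PM_step(2)[OF T N NT gf])
    also have "\<dots> = 2 * (real (R m) * dx (N m)) * (\<Sum>k\<in>{1..NT m}. dt T (NT m) * TV (N m) (U m k))"
      unfolding sum_distrib_left[of "2 * (real (R m) * dx (N m))"]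
    proof (rule sum.cong[OF refl])
      fix k assume "k \<in> {1..NT m}"
      then have "k \<le> NT m" by simp
      then show "dt T (NT m) * (\<Sum>i\<in>{0..<int (N m)}. dx (N m) * local_var (U m k) (R m) i) = 2 * (real (R m) * dx (N m)) * (dt T (NT m) * TV (N m) (U m k))"
        unfolding sum_local_var[OF N U_grid[OF \<open>k \<le> NT m\<close>]] by (simp only: mult_ac)
    qed
    also have "\<dots> \<le> 2 * (1 / real n + 2 * dx (N m)) * B"
    proof (rule mult_mono)
      show "0 \<le> (\<Sum>k\<in>{1..NT m}. dt T (NT m) * TV (N m) (U m k))"
        using dt_pos[OF T NT, of m] TV_nonneg by (intro sum_nonneg mult_nonneg_nonneg) auto
      show "0 \<le> 2 * (1 / real n + 2 * dx (N m))" using dx_pos[OF N, of m] by simp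
    qed (use R2[of m] U_TV[of m] in auto)
    finally show "(LINT z|PM T. lv m z) \<le> 2 * (1 / real n + 2 * dx (N m)) * B" .
  qed
  \<comment> \<open>The \<open>L\<^sup>1\<close> distance between the step function and its limiting local averages is at most \<open>err m\<close>.\<close>
  define err where "err m = 2 * (1 / real n + 2 * dx (N m)) * B + (\<Sum>l<n. D l m)" for m
  have bound: "(LINT z|PM T. norm (step i z - step j z)) \<le> err i + err j" if i: "i \<ge> m1" and j: "j \<ge> m1" for i j
  proof -
    define Q where "Q m = (\<lambda>(x::real, t). lv m (x, t) + (\<Sum>l<n. \<bar>avg n l m t - c l t\<bar>))" for m
    have ci: "integrable (PM T) (\<lambda>(x, t). \<bar>avg n l m t - c l t\<bar>)" and cI: "(LINT (x, t)|PM T. \<bar>avg n l m t - c l t\<bar>) = D l m"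
      if "l < n" "m \<ge> m1" for l m
    proof -
      have mm: "(\<lambda>(x, t). \<bar>avg n l m t - c l t\<bar>) \<in> borel_measurable (PM T)" unfolding PM_def by measurable
      interpret P: finite_measure "PM T" by (rule finite_measure_PM)
      show ci: "integrable (PM T) (\<lambda>(x, t). \<bar>avg n l m t - c l t\<bar>)"
        by (rule P.integrable_const_bound[OF _ mm, of "C l + C l"])
          (use dC[OF that] in \<open>auto simp: space_PM QT_def\<close>)
      have "(LINT (x, t)|PM T. \<bar>avg n l m t - c l t\<bar>) = (LINT t|YM T. LINT x|XM. \<bar>avg n l m t - c l t\<bar>)"
        using integral_snd[of "\<lambda>x t. \<bar>avg n l m t - c l t\<bar>"] ci by (simp add: PM_def)
      also have "\<dots> = D l m" unfolding D_def using measure_XM by simp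
      finally show "(LINT (x, t)|PM T. \<bar>avg n l m t - c l t\<bar>) = D l m" .
    qed
    have Qi: "integrable (PM T) (Q m)" and QI: "(LINT z|PM T. Q m z) \<le> err m" if "m \<ge> m1" for m
    proof -
      have Qe: "Q m = (\<lambda>z. lv m z + (\<Sum>l<n. (\<lambda>(x, t). \<bar>avg n l m t - c l t\<bar>) z))" by (auto simp: Q_def fun_eq_iff)
      show "integrable (PM T) (Q m)" unfolding Qe
        by (intro Bochner_Integration.integrable_add Bochner_Integration.integrable_sum lvi ci) (use that in auto)
      have "(LINT z|PM T. Q m z) = (LINT z|PM T. lv m z) + (\<Sum>l<n. LINT (x, t)|PM T. \<bar>avg n l m t - c l t\<bar>)"
        unfolding Qe using ci that
        by (subst Bochner_Integration.integral_add[OF lvi]) (auto intro!: Bochner_Integration.integrable_sum Bochner_Integration.integral_sum)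
      also have "\<dots> \<le> err m" unfolding err_def using lvI[of m] cI that by simp
      finally show "(LINT z|PM T. Q m z) \<le> err m" .
    qed
    have close: "\<bar>step m (x, t) - c (nat \<lfloor>real n * x\<rfloor>) t\<bar> \<le> Q m (x, t)" if m: "m \<ge> m1" and x: "x \<in> {0..<1}" and t: "t \<in> {0<..<T}" for m x t
    proof -
      define l where "l = nat \<lfloor>real n * x\<rfloor>"
      have fl: "0 \<le> \<lfloor>real n * x\<rfloor>" using x by auto
      have rl: "real l \<le> real n * x" "real n * x < real l + 1" unfolding l_def using fl by linarith+
      have "real n * x < real n" using x n(1) by simp
      then have ln: "l < n" using rl by linarith
      have xl: "\<bar>x - (real l + 1/2) / real n\<bar> \<le> 1 / (2 * real n)"
      proof -
        have "x - (real l + 1/2) / real n = (real n * x - real l - 1/2) / real n" using n(1) by (simp add: field_simps)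
        also have "\<bar>\<dots>\<bar> \<le> (1/2) / real n"
        proof -
          have "\<bar>real n * x - real l - 1/2\<bar> \<le> 1/2" using rl by linarith
          from divide_right_mono[OF this, of "real n"] show ?thesis by (simp add: abs_divide)
        qed
        finally show ?thesis by simp
      qed
      have "\<bar>of_int (ix (N m) x) * dx (N m) - (real l + 1/2) / real n\<bar> \<le> 1 / (2 * real n) + dx (N m) / 2"
        using ix_dist[OF N, of x m] xl by linarith
      then have 1: "\<bar>U m (kt T (NT m) t) (ix (N m) x) - avg n l m t\<bar> \<le> lv m (x, t)"
        unfolding avg_def lv_def prod.case
        using kt_range(2)[OF T NT, of t m] t by (intro local_avg_close[OF N n(1) U_grid m1[OF ln m] _ R1]) simp_all
      have "\<bar>avg n l m t - c l t\<bar> \<le> (\<Sum>l<n. \<bar>avg n l m t - c l t\<bar>)"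
        using ln by (intro member_le_sum[of l _ "\<lambda>l. \<bar>avg n l m t - c l t\<bar>"]) auto
      then show ?thesis using 1 unfolding Q_def prod.case l_def[symmetric] by linarith
    qed
    have "(LINT z|PM T. norm (step i z - step j z)) \<le> (LINT z|PM T. Q i z + Q j z)"
    proof (rule integral_mono)
      show "integrable (PM T) (\<lambda>z. norm (step i z - step j z))" by (intro integrable_norm Bochner_Integration.integrable_diff step_integrable)
      show "integrable (PM T) (\<lambda>z. Q i z + Q j z)" by (intro Bochner_Integration.integrable_add Qi i j)
      fix z assume "z \<in> space (PM T)"
      then obtain x t where z: "z = (x, t)" "x \<in> {0..<1}" "t \<in> {0<..<T}" by (auto simp: space_PM QT_def)
      show "norm (step i z - step j z) \<le> Q i z + Q j z"
        using close[OF i z(2,3)] close[OF j z(2,3)] unfolding z(1) real_norm_def by linarith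
    qed
    also have "\<dots> \<le> err i + err j" using Qi QI i j by (simp add: add_mono)
    finally show ?thesis .
  qed
  have "(\<lambda>m. err (m + m1)) \<longlonglongrightarrow> 2 * (1 / real n + 2 * 0) * B + (\<Sum>l<n. 0)"
    unfolding err_def by (intro tendsto_intros LIMSEQ_ignore_initial_segment[OF dx0] D0) auto
  then have "(\<lambda>m. err (m + m1)) \<longlonglongrightarrow> 2 * B / real n" by simp
  then have "\<forall>\<^sub>F m in sequentially. err (m + m1) < e / 4"
    using n(2) by (rule order_tendstoD)
  then obtain m2 where m2: "\<And>m. m \<ge> m2 \<Longrightarrow> err (m + m1) < e / 4" by (auto simp: eventually_sequentially)
  show ?thesis
  proof (intro exI allI impI)
    fix i j assume "i \<ge> m2 + m1" "j \<ge> m2 + m1"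
    then have i: "i \<ge> m1" "j \<ge> m1" "i - m1 \<ge> m2" "j - m1 \<ge> m2" by auto
    have "err i < e / 4" "err j < e / 4" using m2[OF i(3)] m2[OF i(4)] i(1,2) by auto
    then show "(LINT z|PM T. norm (step i z - step j z)) < e"
      using bound[OF i(1,2)] e by linarith
  qed
qed

lemma avg_subsequence:
  "\<exists>r. strict_mono (r::nat\<Rightarrow>nat) \<and> (\<forall>n\<ge>1. \<forall>l<n. \<forall>q\<in>\<rat> \<inter> {0<..<T}. convergent (\<lambda>m. avg n l (r m) q))"
proof -
  define S where "S = {(n, l, q). n \<ge> (1::nat) \<and> l < n \<and> q \<in> \<rat> \<inter> {0<..<T}}"
  have "S \<subseteq> UNIV \<times> UNIV \<times> \<rat>" by (auto simp: S_def)
  moreover have "countable (UNIV \<times> UNIV \<times> \<rat> :: (nat \<times> nat \<times> real) set)"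
    by (intro countable_SIGMA countable_rat) auto
  ultimately have cS: "countable S" by (rule countable_subset)
  have bs: "Bseq (\<lambda>m. (\<lambda>(n, l, q). avg n l m q) z)" if zS: "z \<in> S" for z
  proof -
    obtain n l q where z: "z = (n, l, q)" "n \<ge> 1" "l < n" "q \<in> {0<..<T}" using zS unfolding S_def by blast
    obtain m0 C where C: "\<And>m. m \<ge> m0 \<Longrightarrow> \<bar>avg n l m q\<bar> \<le> C" using avg_eventually[OF z(2,3)] z(4) by metis
    have "Bseq (\<lambda>m. avg n l (m + m0) q)" by (rule BseqI'[of _ C]) (use C in auto)
    then show ?thesis unfolding z(1) prod.case by (rule Bseq_offset)
  qed
  from diagonal_convergent_subsequence[where f="\<lambda>m (n, l, q). avg n l m q", OF cS bs] obtain r where r: "strict_mono (r::nat\<Rightarrow>nat)"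
    "\<forall>z\<in>S. convergent (\<lambda>m. (\<lambda>(n, l, q). avg n l (r m) q) z)" by blast
  show ?thesis using r unfolding S_def by (intro exI[of _ r]) auto
qed

theorem L1_Cauchy_subsequence:
  "\<exists>r. strict_mono (r::nat\<Rightarrow>nat) \<and> (\<forall>e>0. \<exists>m0. \<forall>i\<ge>m0. \<forall>j\<ge>m0. (LINT z|PM T. norm (step (r i) z - step (r j) z)) < e)"
proof -
  obtain r where r: "strict_mono (r::nat\<Rightarrow>nat)" "\<And>n l q. n \<ge> 1 \<Longrightarrow> l < n \<Longrightarrow> q \<in> \<rat> \<inter> {0<..<T} \<Longrightarrow> convergent (\<lambda>m. avg n l (r m) q)"
    using avg_subsequence by blast
  interpret S: discrete_family T "\<lambda>m. N (r m)" "\<lambda>m. NT (r m)" "\<lambda>m. U (r m)" "\<lambda>m. g (r m)" M B E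
    by (rule discrete_family_subseq[OF r(1)])
  have "S.avg n l m q = avg n l (r m) q" for n l m q by (simp add: S.avg_def avg_def)
  then show ?thesis using S.L1_Cauchy_of_avg r by (intro exI[of _ r]) auto
qed

end

section \<open>Limits of uniformly bounded sequences\<close>

lemma fatou_bound:
  fixes f :: "nat \<Rightarrow> 'a \<Rightarrow> real"
  assumes i: "\<And>j. integrable M (f j)" and pos: "\<And>j x. x \<in> space M \<Longrightarrow> f j x \<ge> 0" and C: "\<And>j. (LINT x|M. f j x) \<le> C"
    and lim: "AE x in M. (\<lambda>j. f j x) \<longlonglongrightarrow> F x" and m: "F \<in> borel_measurable M"
  shows "integrable M F" "(LINT x|M. F x) \<le> C"
proof -
  have pF: "AE x in M. F x \<ge> 0"
    using lim AE_space by eventually_elim (rule LIMSEQ_le_const, auto intro: pos)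
  have "0 \<le> (LINT x|M. f 0 x)" by (rule Bochner_Integration.integral_nonneg) (rule pos)
  then have C0: "C \<ge> 0" using C[of 0] by linarith
  have "(\<integral>\<^sup>+x. ennreal (F x) \<partial>M) = (\<integral>\<^sup>+x. liminf (\<lambda>j. ennreal (f j x)) \<partial>M)"
  proof (rule nn_integral_cong_AE)
    show "AE x in M. ennreal (F x) = liminf (\<lambda>j. ennreal (f j x))"
      using lim
    proof eventually_elim
      case (elim x)
      then have "(\<lambda>j. ennreal (f j x)) \<longlonglongrightarrow> ennreal (F x)" by (rule tendsto_ennrealI)
      then show ?case using lim_imp_Liminf[OF sequentially_bot] by metis
    qed
  qed
  also have "\<dots> \<le> liminf (\<lambda>j. \<integral>\<^sup>+x. ennreal (f j x) \<partial>M)"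
    using i by (intro nn_integral_liminf) auto
  also have "\<dots> \<le> ennreal C"
  proof (rule Liminf_le)
    show "\<forall>\<^sub>F j in sequentially. (\<integral>\<^sup>+x. ennreal (f j x) \<partial>M) \<le> ennreal C"
    proof (intro always_eventually allI)
      fix j
      have "(\<integral>\<^sup>+x. ennreal (f j x) \<partial>M) = ennreal (LINT x|M. f j x)"
        by (rule nn_integral_eq_integral[OF i]) (use pos in auto)
      then show "(\<integral>\<^sup>+x. ennreal (f j x) \<partial>M) \<le> ennreal C" using C[of j] by (simp add: ennreal_leI)
    qed
  qed simp
  finally have b: "(\<integral>\<^sup>+x. ennreal (F x) \<partial>M) \<le> ennreal C" .
  show "integrable M F"
  proof (rule integrableI_bounded[OF m])
    have "(\<integral>\<^sup>+x. ennreal (norm (F x)) \<partial>M) = (\<integral>\<^sup>+x. ennreal (F x) \<partial>M)"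
      by (rule nn_integral_cong_AE) (use pF in eventually_elim, auto)
    then show "(\<integral>\<^sup>+x. ennreal (norm (F x)) \<partial>M) < \<infinity>" using b by (simp add: le_less_trans)
  qed
  show "(LINT x|M. F x) \<le> C" by (rule integral_real_bounded[OF C0 b])
qed

lemma L1_product_limit:
  fixes f :: "nat \<Rightarrow> 'a \<Rightarrow> real"
  assumes i: "\<And>m. integrable M (f m)" "integrable M F" and L1: "(\<lambda>m. LINT x|M. \<bar>f m x - F x\<bar>) \<longlonglongrightarrow> 0"
    and p: "\<And>m. p m \<in> borel_measurable M" "P \<in> borel_measurable M"
    and b: "\<And>m x. x \<in> space M \<Longrightarrow> \<bar>p m x\<bar> \<le> K"
    and lim: "\<And>x. x \<in> space M \<Longrightarrow> (\<lambda>m. p m x) \<longlonglongrightarrow> P x"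
  shows "integrable M (\<lambda>x. F x * P x)" "(\<lambda>m. LINT x|M. f m x * p m x) \<longlonglongrightarrow> (LINT x|M. F x * P x)"
proof -
  define K' where "K' = \<bar>K\<bar>"
  have K0: "K' \<ge> 0" and b: "\<And>m x. x \<in> space M \<Longrightarrow> \<bar>p m x\<bar> \<le> K'"
    using b by (auto simp: K'_def intro: order_trans[OF _ abs_ge_self])
  have bP: "\<bar>P x\<bar> \<le> K'" if "x \<in> space M" for x
    by (rule LIMSEQ_le_const2[OF tendsto_rabs[OF lim[OF that]]]) (use b that in blast)
  have mF[measurable]: "F \<in> borel_measurable M" "f m \<in> borel_measurable M" for m using i by auto
  note [measurable] = p
  have iK: "integrable M (\<lambda>x. K' * \<bar>F x\<bar>)" using i(2) by simp
  have iFp: "integrable M (\<lambda>x. F x * q x)" if q: "q \<in> borel_measurable M" "\<And>x. x \<in> space M \<Longrightarrow> \<bar>q x\<bar> \<le> K'" for q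
  proof (rule Bochner_Integration.integrable_bound[OF iK])
    show "(\<lambda>x. F x * q x) \<in> borel_measurable M" using q(1) by measurable
    show "AE x in M. norm (F x * q x) \<le> norm (K' * \<bar>F x\<bar>)"
    proof (rule AE_I2)
      fix x assume "x \<in> space M"
      then show "norm (F x * q x) \<le> norm (K' * \<bar>F x\<bar>)"
        using mult_right_mono[OF q(2), of x "\<bar>F x\<bar>"] by (simp add: abs_mult mult.commute K0)
    qed
  qed
  show "integrable M (\<lambda>x. F x * P x)" by (rule iFp[OF p(2) bP])
  have l1: "(\<lambda>m. LINT x|M. F x * p m x) \<longlonglongrightarrow> (LINT x|M. F x * P x)"
  proof (rule integral_dominated_convergence[OF _ _ iK])
    show "AE x in M. (\<lambda>m. F x * p m x) \<longlonglongrightarrow> F x * P x"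
      by (rule AE_I2) (intro tendsto_intros lim)
    show "AE x in M. norm (F x * p m x) \<le> K' * \<bar>F x\<bar>" for m
    proof (rule AE_I2)
      fix x assume "x \<in> space M"
      from mult_right_mono[OF b[OF this], of "\<bar>F x\<bar>" m]
      show "norm (F x * p m x) \<le> K' * \<bar>F x\<bar>" by (simp add: abs_mult mult.commute)
    qed
  qed auto
  have id: "integrable M (\<lambda>x. \<bar>f m x - F x\<bar>)" for m using i by auto
  have l2: "(\<lambda>m. LINT x|M. (f m x - F x) * p m x) \<longlonglongrightarrow> 0"
  proof (rule Lim_null_comparison[OF always_eventually])
    show "\<forall>m. norm (LINT x|M. (f m x - F x) * p m x) \<le> (LINT x|M. K' * \<bar>f m x - F x\<bar>)"
    proof
      fix m
      have "norm (LINT x|M. (f m x - F x) * p m x) \<le> (LINT x|M. norm ((f m x - F x) * p m x))" by simp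
      also have "\<dots> \<le> (LINT x|M. K' * \<bar>f m x - F x\<bar>)"
      proof (rule integral_mono')
        show "integrable M (\<lambda>x. K' * \<bar>f m x - F x\<bar>)" using id by simp
        show "norm ((f m x - F x) * p m x) \<le> K' * \<bar>f m x - F x\<bar>" if "x \<in> space M" for x
          using mult_right_mono[OF b[OF that], of "\<bar>f m x - F x\<bar>" m] by (simp add: abs_mult mult.commute K0)
        show "0 \<le> K' * \<bar>f m x - F x\<bar>" if "x \<in> space M" for x
          using b[OF that, of m] by (intro mult_nonneg_nonneg) auto
      qed
      finally show "norm (LINT x|M. (f m x - F x) * p m x) \<le> (LINT x|M. K' * \<bar>f m x - F x\<bar>)" .
    qed
    show "(\<lambda>m. LINT x|M. K' * \<bar>f m x - F x\<bar>) \<longlonglongrightarrow> 0" using tendsto_mult_right_zero[OF L1, of K'] by simp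
  qed
  have "(LINT x|M. f m x * p m x) = (LINT x|M. F x * p m x) + (LINT x|M. (f m x - F x) * p m x)" for m
  proof -
    have i1: "integrable M (\<lambda>x. F x * p m x)" by (rule iFp[OF p(1) b])
    have "integrable M (\<lambda>x. (f m x - F x) * p m x)"
    proof (rule Bochner_Integration.integrable_bound)
      show "integrable M (\<lambda>x. K' * \<bar>f m x - F x\<bar>)" using id by simp
      show "AE x in M. norm ((f m x - F x) * p m x) \<le> norm (K' * \<bar>f m x - F x\<bar>)"
      proof (rule AE_I2)
        fix x assume "x \<in> space M"
        from mult_right_mono[OF b[OF this], of "\<bar>f m x - F x\<bar>" m]
        show "norm ((f m x - F x) * p m x) \<le> norm (K' * \<bar>f m x - F x\<bar>)" by (simp add: abs_mult mult.commute K0)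
      qed
    qed measurable
    then show ?thesis by (subst Bochner_Integration.integral_add[OF i1, symmetric]) (auto simp: algebra_simps)
  qed
  then show "(\<lambda>m. LINT x|M. f m x * p m x) \<longlonglongrightarrow> (LINT x|M. F x * P x)"
    using tendsto_add[OF l1 l2] by simp
qed

text \<open>
  Interpolation of the power \<open>p\<close> between 1 and 3, by splitting at the level \<open>K\<close>. For large \<open>K\<close> the weight
  of the cubic term is small because \<open>p < 3\<close>.
\<close>

lemma powr_interpolation:
  fixes a K p :: real
  assumes p: "1 \<le> p" "p < 3" and K: "K > 0" and a: "a \<ge> 0"
  shows "a powr p \<le> K powr (p - 1) * a + K powr (p - 3) * a ^ 3"
proof (cases "a = 0")
  case False
  then have a: "a > 0" using a by simp
  have r1: "0 \<le> K powr (p - 1) * a" and r2: "0 \<le> K powr (p - 3) * a ^ 3" using a by auto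
  show ?thesis
  proof (cases "a \<le> K")
    case True
    have "a powr p = a powr (p - 1) * a" using a by (simp add: powr_diff)
    also have "\<dots> \<le> K powr (p - 1) * a" using True p a by (intro mult_right_mono powr_mono2) auto
    finally show ?thesis using r2 by linarith
  next
    case False
    have "a powr p = a powr (p - 3) * a ^ 3" using a by (simp add: powr_diff)
    also have "\<dots> \<le> K powr (p - 3) * a ^ 3" using False p a K by (intro mult_right_mono powr_mono2') auto
    finally show ?thesis using r1 by linarith
  qed
qed simp

lemma in_Lp_QT:
  fixes f :: "real \<times> real \<Rightarrow> real"
  assumes m: "f \<in> borel_measurable (PM T)" and i: "integrable (PM T) f" "integrable (PM T) (\<lambda>z. \<bar>f z\<bar> ^ 3)" and p: "1 \<le> p" "p < 3"
  shows "in_Lp p (QT T) f" "integrable (PM T) (\<lambda>z. \<bar>f z\<bar> powr p)"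
proof -
  note [measurable] = m
  show 1: "integrable (PM T) (\<lambda>z. \<bar>f z\<bar> powr p)"
  proof (rule Bochner_Integration.integrable_bound)
    show "integrable (PM T) (\<lambda>z. \<bar>f z\<bar> + \<bar>f z\<bar> ^ 3)" using i by simp
    show "AE z in PM T. norm (\<bar>f z\<bar> powr p) \<le> norm (\<bar>f z\<bar> + \<bar>f z\<bar> ^ 3)"
      using powr_interpolation[OF p, of 1] by (intro AE_I2) auto
  qed measurable
  then show "in_Lp p (QT T) f" unfolding in_Lp_def
    using set_borel_measurable_QT[OF m] by (subst set_integrable_QT) auto
qed

lemma Lp_converges_QT:
  fixes f :: "nat \<Rightarrow> real \<times> real \<Rightarrow> real"
  assumes i: "\<And>m. integrable (PM T) (f m)" "integrable (PM T) F"
    and i3: "\<And>m. integrable (PM T) (\<lambda>z. \<bar>f m z\<bar> ^ 3)" "integrable (PM T) (\<lambda>z. \<bar>F z\<bar> ^ 3)"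
    and C: "\<And>m. (LINT z|PM T. \<bar>f m z\<bar> ^ 3) \<le> C"
    and L1: "(\<lambda>m. LINT z|PM T. \<bar>f m z - F z\<bar>) \<longlonglongrightarrow> 0" and p: "1 \<le> p" "p < 3"
  shows "Lp_converges p (QT T) f F"
proof -
  have m[measurable]: "F \<in> borel_measurable (PM T)" "f m \<in> borel_measurable (PM T)" for m using i by auto
  define v where "v m z = f m z - F z" for m z
  have vm[measurable]: "v m \<in> borel_measurable (PM T)" for m unfolding v_def by measurable
  have vi: "integrable (PM T) (v m)" for m unfolding v_def using i by auto
  have cub: "\<bar>a - b\<bar> ^ 3 \<le> 8 * \<bar>a\<bar> ^ 3 + 8 * \<bar>b\<bar> ^ 3" for a b :: real
  proof -
    have "\<bar>a - b\<bar> \<le> 2 * max \<bar>a\<bar> \<bar>b\<bar>" by auto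
    then have "\<bar>a - b\<bar> ^ 3 \<le> (2 * max \<bar>a\<bar> \<bar>b\<bar>) ^ 3" by (intro power_mono) auto
    also have "\<dots> = 8 * (max \<bar>a\<bar> \<bar>b\<bar>) ^ 3" by (simp add: power_mult_distrib)
    also have "\<dots> \<le> 8 * (\<bar>a\<bar> ^ 3 + \<bar>b\<bar> ^ 3)" by (intro mult_left_mono) (auto simp: max_def)
    finally show ?thesis by simp
  qed
  have i8: "integrable (PM T) (\<lambda>z. 8 * \<bar>f m z\<bar> ^ 3 + 8 * \<bar>F z\<bar> ^ 3)" for m using i3 by simp
  have v3: "integrable (PM T) (\<lambda>z. \<bar>v m z\<bar> ^ 3)" for m
    by (rule Bochner_Integration.integrable_bound[OF i8[of m]]) (use cub in \<open>auto simp: v_def\<close>)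
  define C' where "C' = 8 * C + 8 * (LINT z|PM T. \<bar>F z\<bar> ^ 3)"
  have C': "(LINT z|PM T. \<bar>v m z\<bar> ^ 3) \<le> C'" for m
  proof -
    have "(LINT z|PM T. \<bar>v m z\<bar> ^ 3) \<le> (LINT z|PM T. 8 * \<bar>f m z\<bar> ^ 3 + 8 * \<bar>F z\<bar> ^ 3)"
      by (rule integral_mono[OF v3 i8]) (simp add: v_def cub)
    also have "\<dots> \<le> C'" unfolding C'_def using i3 C[of m] by simp
    finally show ?thesis .
  qed
  have C'0: "C' \<ge> 0" using C'[of 0] by (rule order_trans[rotated]) simp
  have vp: "integrable (PM T) (\<lambda>z. \<bar>v m z\<bar> powr p)" for m by (rule in_Lp_QT(2)[OF vm vi v3 p])
  have lim: "(\<lambda>m. LINT z|PM T. \<bar>v m z\<bar> powr p) \<longlonglongrightarrow> 0"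
  proof (rule tendstoI)
    fix e :: real assume e: "e > 0"
    \<comment> \<open>With this \<open>K\<close> the cubic term contributes less than \<open>e/2\<close>.\<close>
    define K where "K = (e / (2 * (C' + 1))) powr (1 / (p - 3))"
    have K: "K > 0" unfolding K_def using e C'0 by simp
    have Kp: "K powr (p - 3) * C' < e / 2"
    proof -
      have "K powr (p - 3) = e / (2 * (C' + 1))" unfolding K_def powr_powr using p e C'0 by simp
      also have "e / (2 * (C' + 1)) * C' < e / 2" using e C'0 by (simp add: field_simps)
      finally show ?thesis .
    qed
    have "(\<lambda>m. K powr (p - 1) * (LINT z|PM T. \<bar>v m z\<bar>)) \<longlonglongrightarrow> 0"
      using tendsto_mult_right_zero[OF L1] by (simp add: v_def)
    then have "\<forall>\<^sub>F m in sequentially. K powr (p - 1) * (LINT z|PM T. \<bar>v m z\<bar>) < e / 2"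
      using e by (intro order_tendstoD) auto
    then show "\<forall>\<^sub>F m in sequentially. dist (LINT z|PM T. \<bar>v m z\<bar> powr p) 0 < e"
    proof eventually_elim
      case (elim m)
      have "(LINT z|PM T. \<bar>v m z\<bar> powr p) \<le> (LINT z|PM T. K powr (p - 1) * \<bar>v m z\<bar> + K powr (p - 3) * \<bar>v m z\<bar> ^ 3)"
        by (rule integral_mono[OF vp]) (use vi v3 powr_interpolation[OF p K] in auto)
      also have "\<dots> = K powr (p - 1) * (LINT z|PM T. \<bar>v m z\<bar>) + K powr (p - 3) * (LINT z|PM T. \<bar>v m z\<bar> ^ 3)"
        using vi v3 by simp
      also have "\<dots> \<le> K powr (p - 1) * (LINT z|PM T. \<bar>v m z\<bar>) + K powr (p - 3) * C'"
        using C'[of m] by (intro add_left_mono mult_left_mono) auto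
      also have "\<dots> < e" using elim Kp by simp
      finally show ?case by (simp add: dist_real_def)
    qed
  qed
  have "(\<lambda>m. (LINT z|PM T. \<bar>v m z\<bar> powr p) powr (1 / p)) \<longlonglongrightarrow> 0 powr (1 / p)"
    by (rule tendsto_powr2[OF lim tendsto_const always_eventually]) (use p in auto)
  moreover have "Lp_norm p (QT T) (\<lambda>z. f m z - F z) = (LINT z|PM T. \<bar>v m z\<bar> powr p) powr (1 / p)" for m
    unfolding Lp_norm_def by (subst set_integral_QT) (auto simp: v_def)
  ultimately show ?thesis unfolding Lp_converges_def
    using in_Lp_QT(1)[OF _ i(1) i3(1) p] in_Lp_QT(1)[OF _ i(2) i3(2) p] by auto
qed

context discrete_family
begin

lemma step_borel_measurable: "step m \<in> borel_measurable borel" by (rule step_borel)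

lemma step_cube:
  "integrable (PM T) (\<lambda>z. \<bar>step m z\<bar> ^ 3)"
  "(LINT z|PM T. \<bar>step m z\<bar> ^ 3) = (\<Sum>k\<in>{1..NT m}. dt T (NT m) * (\<Sum>i\<in>{0..<int (N m)}. dx (N m) * \<bar>U m k i\<bar> ^ 3))"
proof -
  have gf: "grid_fun (N m) (\<lambda>i. \<bar>U m k i\<bar> ^ 3)" if "k \<in> {1..NT m}" for k
    by standard (use that in \<open>simp add: grid_fun_plus(1)[OF U_grid]\<close>)
  have e: "(\<lambda>z. \<bar>step m z\<bar> ^ 3) = (\<lambda>(x, t). \<bar>U m (kt T (NT m) t) (ix (N m) x)\<bar> ^ 3)" by auto
  show "integrable (PM T) (\<lambda>z. \<bar>step m z\<bar> ^ 3)" unfolding e by (rule PM_step(1)[OF T N NT gf])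
  show "(LINT z|PM T. \<bar>step m z\<bar> ^ 3) = (\<Sum>k\<in>{1..NT m}. dt T (NT m) * (\<Sum>i\<in>{0..<int (N m)}. dx (N m) * \<bar>U m k i\<bar> ^ 3))"
    unfolding e by (rule PM_step(2)[OF T N NT gf])
qed

text \<open>
  The limit is taken as the positive part of the pointwise limit along an almost everywhere convergent
  subsequence. This choice is Borel, and it is nonnegative and periodic at every time, not just almost
  everywhere.
\<close>

theorem limit_exists:
  assumes C3: "\<And>m. (LINT z|PM T. \<bar>step m z\<bar> ^ 3) \<le> C3"
  shows "\<exists>r (u :: real \<Rightarrow> real \<Rightarrow> real). strict_mono (r::nat\<Rightarrow>nat) \<and> (\<lambda>(x, t). u x t) \<in> borel_measurable borel
    \<and> (\<forall>t\<in>{0<..<T}. torus_fun (\<lambda>x. u x t)) \<and> (\<forall>x t. u x t \<ge> 0)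
    \<and> integrable (PM T) (\<lambda>(x, t). u x t) \<and> integrable (PM T) (\<lambda>z. \<bar>(\<lambda>(x, t). u x t) z\<bar> ^ 3)
    \<and> (\<lambda>m. LINT z|PM T. \<bar>step (r m) z - (\<lambda>(x, t). u x t) z\<bar>) \<longlonglongrightarrow> 0"
proof -
  obtain r1 where r1: "strict_mono (r1::nat\<Rightarrow>nat)"
    "\<And>e. e > 0 \<Longrightarrow> \<exists>m0. \<forall>i\<ge>m0. \<forall>j\<ge>m0. (LINT z|PM T. norm (step (r1 i) z - step (r1 j) z)) < e"
    using L1_Cauchy_subsequence by blast
  obtain r2 where r2: "strict_mono (r2::nat\<Rightarrow>nat)" "AE z in PM T. Cauchy (\<lambda>i. step (r1 (r2 i)) z)"
    using cauchy_L1_AE_cauchy_subseq[OF step_integrable r1(2)] by blast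
  define r where "r i = r1 (r2 i)" for i
  have r: "strict_mono r" using r1(1) r2(1) by (auto simp: r_def strict_mono_def)
  define u where "u x t = max 0 (lim (\<lambda>i. step (r i) (x, t)))" for x t
  define v where "v = (\<lambda>(x, t). u x t)"
  have vz: "v z = max 0 (lim (\<lambda>i. step (r i) z))" for z by (cases z) (simp add: v_def u_def)
  have vm: "v \<in> borel_measurable borel"
    unfolding vz[abs_def] by (intro borel_measurable_max borel_measurable_const borel_measurable_lim_metric step_borel_measurable)
  have vmP: "v \<in> borel_measurable (PM T)" by (rule borel_measurable_PM[OF vm])
  have pos: "step m z \<ge> 0" if "z \<in> space (PM T)" for m z
    using that kt_range(2)[OF T NT, of "snd z" m] U_nonneg by (auto simp: space_PM QT_def)
  have lim: "AE z in PM T. (\<lambda>i. step (r i) z) \<longlonglongrightarrow> v z"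
    using r2(2) AE_space
  proof eventually_elim
    case (elim z)
    then have c: "(\<lambda>i. step (r i) z) \<longlonglongrightarrow> lim (\<lambda>i. step (r i) z)"
      using Cauchy_convergent convergent_LIMSEQ_iff unfolding r_def by blast
    have "0 \<le> lim (\<lambda>i. step (r i) z)" by (rule LIMSEQ_le_const[OF c]) (use pos[OF elim(2)] in blast)
    then show ?case using c by (simp add: vz)
  qed
  have T3: "integrable (PM T) (\<lambda>z. \<bar>v z\<bar> ^ 3)"
  proof (rule fatou_bound(1)[where f="\<lambda>j z. \<bar>step (r j) z\<bar> ^ 3" and C=C3])
    show "AE z in PM T. (\<lambda>j. \<bar>step (r j) z\<bar> ^ 3) \<longlonglongrightarrow> \<bar>v z\<bar> ^ 3"
      using lim by eventually_elim (intro tendsto_intros)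
    show "(\<lambda>z. \<bar>v z\<bar> ^ 3) \<in> borel_measurable (PM T)" using vmP by measurable
  qed (rule step_cube(1), simp, rule C3)
  have close: "integrable (PM T) (\<lambda>z. \<bar>step (r m) z - v z\<bar>) \<and> (LINT z|PM T. \<bar>step (r m) z - v z\<bar>) \<le> e"
    if m0: "\<And>i j. i \<ge> m0 \<Longrightarrow> j \<ge> m0 \<Longrightarrow> (LINT z|PM T. norm (step (r1 i) z - step (r1 j) z)) < e" and m: "m \<ge> m0" for m m0 e
  proof -
    have rm: "r2 i \<ge> i" for i by (rule seq_suble[OF r2(1)])
    have i: "integrable (PM T) (\<lambda>z. \<bar>step (r m) z - step (r (j + m0)) z\<bar>)" for j
      by (intro integrable_abs Bochner_Integration.integrable_diff step_integrable)
    have C: "(LINT z|PM T. \<bar>step (r m) z - step (r (j + m0)) z\<bar>) \<le> e" for j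
    proof -
      have "m0 \<le> r2 m" "m0 \<le> r2 (j + m0)" using rm[of m] rm[of "j + m0"] m by linarith+
      from m0[OF this] show ?thesis unfolding r_def real_norm_def by (rule less_imp_le)
    qed
    have l: "AE z in PM T. (\<lambda>j. \<bar>step (r m) z - step (r (j + m0)) z\<bar>) \<longlonglongrightarrow> \<bar>step (r m) z - v z\<bar>"
      using lim by eventually_elim (intro tendsto_intros LIMSEQ_ignore_initial_segment)
    have me: "(\<lambda>z. \<bar>step (r m) z - v z\<bar>) \<in> borel_measurable (PM T)"
      using vmP borel_measurable_integrable[OF step_integrable[of "r m"]] by (intro borel_measurable_abs borel_measurable_diff)
    show ?thesis using fatou_bound[OF i _ C l me] by simp
  qed
  obtain m1 where m1: "\<And>i j. i \<ge> m1 \<Longrightarrow> j \<ge> m1 \<Longrightarrow> (LINT z|PM T. norm (step (r1 i) z - step (r1 j) z)) < 1" using r1(2)[OF zero_less_one] by blast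
  have iv: "integrable (PM T) v"
  proof (rule Bochner_Integration.integrable_bound)
    show "integrable (PM T) (\<lambda>z. \<bar>step (r m1) z\<bar> + \<bar>step (r m1) z - v z\<bar>)"
      using close[OF m1, of m1] step_integrable by simp
    show "AE z in PM T. norm (v z) \<le> norm (\<bar>step (r m1) z\<bar> + \<bar>step (r m1) z - v z\<bar>)"
    proof (rule AE_I2)
      fix z 
      have "\<bar>a\<bar> \<le> \<bar>\<bar>b\<bar> + \<bar>b - a\<bar>\<bar>" for a b :: real by linarith
      then show "norm (v z) \<le> norm (\<bar>step (r m1) z\<bar> + \<bar>step (r m1) z - v z\<bar>)" unfolding real_norm_def .
    qed
  qed (rule vmP)
  have conv: "(\<lambda>m. LINT z|PM T. \<bar>step (r m) z - v z\<bar>) \<longlonglongrightarrow> 0"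
  proof (rule LIMSEQ_I)
    fix e :: real assume "e > 0"
    then obtain m0 where m0: "\<And>i j. i \<ge> m0 \<Longrightarrow> j \<ge> m0 \<Longrightarrow> (LINT z|PM T. norm (step (r1 i) z - step (r1 j) z)) < e / 2" using r1(2)[OF half_gt_zero] by blast
    have "norm ((LINT z|PM T. \<bar>step (r m) z - v z\<bar>) - 0) < e" if "m \<ge> m0" for m
    proof -
      have "(LINT z|PM T. \<bar>step (r m) z - v z\<bar>) \<le> e / 2" using close[OF m0 that] by blast
      moreover have "0 \<le> (LINT z|PM T. \<bar>step (r m) z - v z\<bar>)" by simp
      ultimately show ?thesis using \<open>e > 0\<close> by simp
    qed
    then show "\<exists>no. \<forall>m\<ge>no. norm ((LINT z|PM T. \<bar>step (r m) z - v z\<bar>) - 0) < e" by blast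
  qed
  have per: "torus_fun (\<lambda>x. u x t)" if t: "t \<in> {0<..<T}" for t
  proof
    fix x
    have "step m (x + 1, t) = step m (x, t)" for m
      using kt_range(2)[OF T NT, of t m] t by (simp add: ix_plus1[OF N] grid_fun_plus(1)[OF U_grid])
    then show "u (x + 1) t = u x t" by (simp add: u_def del: prod.case)
  qed
  have "u x t \<ge> 0" for x t by (simp add: u_def)
  then show ?thesis
    using r vm iv T3 conv per unfolding v_def by blast
qed

end

section \<open>Convolution with bounded kernels\<close>

lemma torus_fun_reflect: 
  assumes "torus_fun \<sigma>" shows "torus_fun (\<lambda>y. \<sigma> (x - y))"
proof
  fix y show "\<sigma> (x - (y + 1)) = \<sigma> (x - y)" using torus_fun_plus_int[OF assms, of "x - y - 1" 1] by (simp add: algebra_simps)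
qed

lemma reflect_measurable:
  fixes \<sigma> :: "real \<Rightarrow> real"
  assumes "\<sigma> \<in> borel_measurable lebesgue" shows "(\<lambda>y. \<sigma> (x - y)) \<in> borel_measurable lebesgue"
proof -
  have "(\<lambda>y. x + (-1) * y) \<in> lebesgue \<rightarrow>\<^sub>M lebesgue"
    using lebesgue_affine_measurable[where c="\<lambda>_::real. -1" and t=x] by simp
  from measurable_compose[OF this assms] show ?thesis by simp
qed

lemma AE_reflect:
  fixes x :: real
  assumes "AE y in lborel. P y" shows "AE y in lborel. P (x - y)"
proof -
  obtain A where A: "{y. \<not> P y} \<subseteq> A" "A \<in> sets lborel" "emeasure lborel A = 0"
    using assms by (auto elim!: AE_E simp: subset_eq)
  have "AE y in lborel. y \<notin> A" using A by (intro AE_not_in) (auto simp: null_sets_def)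
  then have "AE y in lborel. x + (-1) * y \<notin> A"
    using A(2) by (intro AE_borel_affine) auto
  then show ?thesis by eventually_elim (use A(1) in auto)
qed

text \<open>
  A bounded kernel agrees almost everywhere with a bounded Borel function, which defines the same
  convolution at every point.
\<close>

lemma torus_conv_borel_kernel:
  assumes s: "Linf_torus \<sigma>" and C: "AE x in lebesgue. \<bar>\<sigma> x\<bar> \<le> C"
  shows "\<exists>s \<in> borel_measurable borel. (\<forall>x. \<bar>s x\<bar> \<le> C) \<and> 
    (\<forall>f x. f \<in> borel_measurable XM \<longrightarrow> torus_conv \<sigma> f x = (LINT y|XM. s (x - y) * f y))"
proof -
  have ms: "\<sigma> \<in> borel_measurable lebesgue" using s by (auto simp: Linf_torus_def)
  then obtain g where g: "g \<in> borel_measurable lborel" "AE x in lborel. \<sigma> x = g x"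
    using completion_ex_borel_measurable_real by blast
  have C0: "C \<ge> 0"
  proof (rule ccontr)
    assume "\<not> C \<ge> 0"
    then have "\<And>x. \<bar>\<sigma> x\<bar> \<le> C \<Longrightarrow> x \<in> {}" by (metis abs_ge_zero order_trans)
    then have "AE x in lborel. x \<in> ({} :: real set)"
      using C unfolding AE_completion_iff by (rule eventually_mono[rotated])
    then show False by (simp add: AE_iff_null null_sets_def)
  qed
  define s where "s x = max (-C) (min C (g x))" for x
  have sm: "s \<in> borel_measurable borel" using g(1) unfolding s_def by simp
  have sC: "\<bar>s x\<bar> \<le> C" for x using C0 by (auto simp: s_def)
  have C': "AE x in lborel. \<bar>\<sigma> x\<bar> \<le> C" using C unfolding AE_completion_iff .
  have e: "AE x in lborel. \<sigma> x = s x"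
    using g(2) C' by eventually_elim (auto simp: s_def)
  have "torus_conv \<sigma> f x = (LINT y|XM. s (x - y) * f y)" if f: "f \<in> borel_measurable XM" for f x
  proof -
    have fm: "(\<lambda>z. indicat_real {0..<1} z *\<^sub>R f z) \<in> borel_measurable lebesgue"
      using f unfolding XM_def by (subst (asm) borel_measurable_restrict_space_iff) (auto intro: measurable_completion)
    have sx: "(\<lambda>y. s (x - y)) \<in> borel_measurable borel" 
      using measurable_compose[OF _ sm, of "\<lambda>y. x - y" borel] by simp
    have "torus_conv \<sigma> f x = (LINT y|lebesgue. \<sigma> (x - y) * (indicat_real {0..<1} y *\<^sub>R f y))"
      unfolding torus_conv_def set_lebesgue_integral_def by (simp add: mult_ac)
    also have "\<dots> = (LINT y|lebesgue. s (x - y) * (indicat_real {0..<1} y *\<^sub>R f y))"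
    proof (rule integral_cong_AE)
      show "(\<lambda>y. \<sigma> (x - y) * (indicat_real {0..<1} y *\<^sub>R f y)) \<in> borel_measurable lebesgue"
        by (intro borel_measurable_times fm reflect_measurable[OF ms])
      show "(\<lambda>y. s (x - y) * (indicat_real {0..<1} y *\<^sub>R f y)) \<in> borel_measurable lebesgue"
        using sx by (intro borel_measurable_times fm measurable_completion) simp
      have "AE y in lborel. \<sigma> (x - y) = s (x - y)" by (rule AE_reflect[OF e])
      then have "AE y in lebesgue. \<sigma> (x - y) = s (x - y)" by (rule AE_completion)
      then show "AE y in lebesgue. \<sigma> (x - y) * (indicat_real {0..<1} y *\<^sub>R f y) = s (x - y) * (indicat_real {0..<1} y *\<^sub>R f y)"
        by eventually_elim simp
    qed
    also have "\<dots> = (LINT y:{0..<1}|lebesgue. s (x - y) * f y)"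
      unfolding set_lebesgue_integral_def by (simp add: mult_ac)
    also have "\<dots> = (LINT y|XM. s (x - y) * f y)"
      by (rule set_integral_XM) (use borel_XM[OF sx] f in measurable)
    finally show ?thesis .
  qed
  then show ?thesis using sm sC by blast
qed

lemma cell_integral_reflect:
  assumes N: "N \<ge> 1"
  shows "(LINT y:cell N n|lebesgue. \<sigma> (of_int i * dx N - y)) = dx N * cell_avg N \<sigma> (i - n)"
proof -
  have "(LINT y:cell N (i - n)|lebesgue. \<sigma> y) = (LINT y|lebesgue. indicat_real (cell N (i - n)) (of_int i * dx N + (-1) * y) *\<^sub>R \<sigma> (of_int i * dx N + (-1) * y))"
    unfolding set_lebesgue_integral_def by (subst lebesgue_integral_real_affine[of "-1" _ "of_int i * dx N"]) auto
  also have "\<dots> = (LINT y:cell N n|lebesgue. \<sigma> (of_int i * dx N - y))"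
    unfolding set_lebesgue_integral_def
  proof (rule Bochner_Integration.integral_cong[OF refl])
    fix y
    have "of_int i * dx N + (-1) * y \<in> cell N (i - n) \<longleftrightarrow> y \<in> cell N n"
      unfolding cell_def by (auto simp: algebra_simps)
    then show "indicat_real (cell N (i - n)) (of_int i * dx N + (-1) * y) *\<^sub>R \<sigma> (of_int i * dx N + (-1) * y)
      = indicat_real (cell N n) y *\<^sub>R \<sigma> (of_int i * dx N - y)" by (simp add: indicator_def)
  qed
  finally show ?thesis using dx_pos[OF N] by (simp add: cell_avg_def)
qed

lemma conv_step_integrable:
  fixes v :: "int \<Rightarrow> real"
  assumes N: "N \<ge> 1" and s: "Linf_torus \<sigma>" and v: "grid_fun N v"
  shows "torus_fun (\<lambda>y. \<sigma> (x - y) * v (ix N y))" "set_integrable lebesgue {0..<1} (\<lambda>y. \<sigma> (x - y) * v (ix N y))"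
proof -
  have ts: "torus_fun \<sigma>" using s by (auto simp: Linf_torus_def)
  have ms: "\<sigma> \<in> borel_measurable lebesgue" using s by (auto simp: Linf_torus_def)
  obtain C where C: "AE x in lebesgue. \<bar>\<sigma> x\<bar> \<le> C" using s by (auto simp: Linf_torus_def)
  have "AE y in lborel. \<bar>\<sigma> (x - y)\<bar> \<le> C" by (rule AE_reflect[OF C[unfolded AE_completion_iff]])
  then have C': "AE y in lebesgue. \<bar>\<sigma> (x - y)\<bar> \<le> C" by (rule AE_completion)
  show "torus_fun (\<lambda>y. \<sigma> (x - y) * v (ix N y))"
  proof
    fix y show "\<sigma> (x - (y + 1)) * v (ix N (y + 1)) = \<sigma> (x - y) * v (ix N y)"
      using periodic_fun_simple'.plus_period[OF torus_fun_reflect[OF ts, of x], of y] by (simp add: ix_plus1[OF N] grid_fun_plus(1)[OF v])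
  qed
  obtain B where B: "\<And>i. \<bar>v i\<bar> \<le> B" using grid_fun_bounded[OF N v] by blast
  have i: "integrable lebesgue (\<lambda>y::real. indicat_real {0..<1} y *\<^sub>R (C * B))" by (auto simp: integrable_indicator_iff)
  show "set_integrable lebesgue {0..<1} (\<lambda>y. \<sigma> (x - y) * v (ix N y))"
    unfolding set_integrable_def
  proof (rule Bochner_Integration.integrable_bound[OF i])
    have "(\<lambda>y. v (ix N y)) \<in> borel_measurable borel" by (rule measurable_compose[OF ix_borel]) simp
    then have "(\<lambda>y. v (ix N y)) \<in> borel_measurable lebesgue" by (intro measurable_completion) simp
    then show "(\<lambda>y. indicat_real {0..<1} y *\<^sub>R (\<sigma> (x - y) * v (ix N y))) \<in> borel_measurable lebesgue"
      by (intro borel_measurable_scaleR borel_measurable_indicator borel_measurable_times reflect_measurable[OF ms]) auto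
    show "AE y in lebesgue. norm (indicat_real {0..<1} y *\<^sub>R (\<sigma> (x - y) * v (ix N y))) \<le> norm (indicat_real {0..<1} y *\<^sub>R (C * B))"
      using C'
    proof eventually_elim
      case (elim y)
      have "\<bar>\<sigma> (x - y)\<bar> * \<bar>v (ix N y)\<bar> \<le> C * B" using elim B by (intro mult_mono) auto
      moreover have "C * B \<le> \<bar>C\<bar> * \<bar>B\<bar>" by (simp add: abs_mult[symmetric])
      ultimately show ?case by (auto simp: indicator_def abs_mult)
    qed
  qed
qed

text \<open>
  The discrete convolution with the cell averages of the kernel is the exact convolution of the kernel
  with the step function, evaluated at the cell centre: reflection about \<open>i\<Delta>x\<close> exchanges the cells \<open>n\<close> and
  \<open>i - n\<close>.
\<close>

lemma grid_conv_eq_torus_conv: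
  assumes N: "N \<ge> 1" and s: "Linf_torus \<sigma>" and v: "grid_fun N v"
  shows "grid_conv N (cell_avg N \<sigma>) v i = torus_conv \<sigma> (\<lambda>y. v (ix N y)) (of_int i * dx N)"
proof -
  have "torus_conv \<sigma> (\<lambda>y. v (ix N y)) (of_int i * dx N) = (\<Sum>n\<in>{0..<int N}. LINT y:cell N n|lebesgue. \<sigma> (of_int i * dx N - y) * v (ix N y))"
    unfolding torus_conv_def by (rule torus_integral_cells(1)[OF N conv_step_integrable[OF N s v]])
  also have "\<dots> = (\<Sum>n\<in>{0..<int N}. dx N * cell_avg N \<sigma> (i - n) * v n)"
  proof (rule sum.cong[OF refl])
    fix n
    have "(LINT y:cell N n|lebesgue. \<sigma> (of_int i * dx N - y) * v (ix N y)) = (LINT y:cell N n|lebesgue. \<sigma> (of_int i * dx N - y) * v n)"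
      by (rule set_lebesgue_integral_cong) (auto simp: ix_cell[OF N], simp add: cell_def)
    then show "(LINT y:cell N n|lebesgue. \<sigma> (of_int i * dx N - y) * v (ix N y)) = dx N * cell_avg N \<sigma> (i - n) * v n"
      by (simp add: cell_integral_reflect[OF N])
  qed
  finally show ?thesis by (simp add: grid_conv_def)
qed

lemma torus_conv_shift:
  assumes N: "N \<ge> 1" and s: "Linf_torus \<sigma>" and v: "grid_fun N v"
  shows "torus_conv \<sigma> (\<lambda>y. v (ix N y)) x = torus_conv \<sigma> (\<lambda>y. v (ix N (y + (x - x')))) x'"
proof -
  have "(LINT y:{0..<1}|lebesgue. \<sigma> (x - (y + (x - x'))) * v (ix N (y + (x - x')))) = (LINT y:{0..<1}|lebesgue. \<sigma> (x - y) * v (ix N y))"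
    by (rule torus_integral_shift(2)[OF conv_step_integrable[OF N s v]])
  then show ?thesis by (simp add: torus_conv_def algebra_simps)
qed

text \<open>
  A shift by at most half a cell reaches neighbouring cells only.
\<close>

lemma step_shift_L1:
  fixes v :: "int \<Rightarrow> real"
  assumes N: "N \<ge> 1" and v: "grid_fun N v" and \<delta>: "\<bar>\<delta>\<bar> \<le> dx N / 2"
  shows "integrable XM (\<lambda>y. v (ix N (y + \<delta>)))"
    "(LINT y|XM. \<bar>v (ix N y) - v (ix N (y + \<delta>))\<bar>) \<le> 2 * dx N * TV N v"
proof -
  interpret finite_measure XM by (rule finite_measure_XM)
  note d = dx_pos[OF N]
  obtain B where B: "\<And>i. \<bar>v i\<bar> \<le> B" using grid_fun_bounded[OF N v] by blast
  have m: "(\<lambda>y. v (ix N (y + \<delta>))) \<in> borel_measurable XM"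
  proof (rule borel_XM)
    have "(\<lambda>y. ix N (y + \<delta>)) \<in> borel \<rightarrow>\<^sub>M count_space UNIV" by measurable
    then show "(\<lambda>y. v (ix N (y + \<delta>))) \<in> borel_measurable borel" by (rule measurable_compose) simp
  qed
  show i: "integrable XM (\<lambda>y. v (ix N (y + \<delta>)))"
    by (rule integrable_const_bound[OF _ m, of B]) (use B in auto)
  have c: "\<bar>v (ix N y) - v (ix N (y + \<delta>))\<bar> \<le> local_var v 1 (ix N y)" for y
  proof (rule local_var_bound)
    \<comment> \<open>The cell centres differ by at most \<open>3\<Delta>x/2\<close>, hence by at most one cell.\<close>
    have "\<bar>of_int (ix N y) * dx N - of_int (ix N (y + \<delta>)) * dx N\<bar> \<le> dx N / 2 + dx N / 2 + dx N / 2"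
      using ix_dist[OF N, of y] ix_dist[OF N, of "y + \<delta>"] \<delta> by linarith
    then have "\<bar>of_int (ix N y - ix N (y + \<delta>))\<bar> * dx N \<le> (3/2) * dx N"
      using d by (simp add: left_diff_distrib[symmetric] abs_mult)
    then have "\<bar>of_int (ix N y - ix N (y + \<delta>))\<bar> \<le> (3/2 :: real)" using d by (simp only: mult_le_cancel_right)
    then show "\<bar>ix N y - ix N (y + \<delta>)\<bar> \<le> int 1" by linarith
  qed
  have "(LINT y|XM. \<bar>v (ix N y) - v (ix N (y + \<delta>))\<bar>) \<le> (LINT y|XM. local_var v 1 (ix N y))"
    by (rule integral_mono) (use i XM_step(1)[OF N v] XM_step(1)[OF N grid_fun_local_var[OF v]] c in auto)
  also have "\<dots> = 2 * dx N * TV N v"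
    unfolding XM_step(2)[OF N grid_fun_local_var[OF v]] sum_local_var[OF N v] by simp
  finally show "(LINT y|XM. \<bar>v (ix N y) - v (ix N (y + \<delta>))\<bar>) \<le> 2 * dx N * TV N v" .
qed

lemma kernel_integral_bound:
  fixes s f :: "real \<Rightarrow> real" and C :: real
  assumes s: "s \<in> borel_measurable borel" "\<And>x. \<bar>s x\<bar> \<le> C" and f: "integrable XM f"
  shows "integrable XM (\<lambda>y. s (x - y) * f y)" "\<bar>LINT y|XM. s (x - y) * f y\<bar> \<le> C * (LINT y|XM. \<bar>f y\<bar>)"
proof -
  have C0: "C \<ge> 0" using s(2)[of 0] by linarith
  have m: "(\<lambda>y. s (x - y)) \<in> borel_measurable XM" 
    using measurable_compose[OF _ s(1), of "\<lambda>y. x - y" borel] by (intro borel_XM) simp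
  have b: "norm (s (x - y) * f y) \<le> C * \<bar>f y\<bar>" for y using s(2) by (auto simp: abs_mult intro: mult_right_mono)
  show i: "integrable XM (\<lambda>y. s (x - y) * f y)"
  proof (rule Bochner_Integration.integrable_bound)
    show "integrable XM (\<lambda>y. C * \<bar>f y\<bar>)" using f by simp
    show "AE y in XM. norm (s (x - y) * f y) \<le> norm (C * \<bar>f y\<bar>)"
      by (rule AE_I2) (use b C0 in \<open>simp add: abs_mult\<close>)
  qed (use m f in measurable)
  have "\<bar>LINT y|XM. s (x - y) * f y\<bar> \<le> (LINT y|XM. norm (s (x - y) * f y))"
    using integral_norm_bound[of XM "\<lambda>y. s (x - y) * f y"] by simp
  also have "\<dots> \<le> (LINT y|XM. C * \<bar>f y\<bar>)"
    by (rule integral_mono) (use i f b in auto)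
  finally show "\<bar>LINT y|XM. s (x - y) * f y\<bar> \<le> C * (LINT y|XM. \<bar>f y\<bar>)" by simp
qed

text \<open>
  Moving the evaluation point from the cell centre to \<open>x\<close> is the same as shifting the step function, which
  costs \<open>\<Delta>x\<close> times its total variation. No regularity of the kernel is used.
\<close>

lemma grid_conv_error:
  assumes N: "N \<ge> 1" and s: "Linf_torus \<sigma>" and C: "AE x in lebesgue. \<bar>\<sigma> x\<bar> \<le> C" and v: "grid_fun N v"
    and f: "integrable XM f"
  shows "\<bar>grid_conv N (cell_avg N \<sigma>) v (ix N x) - torus_conv \<sigma> f x\<bar>
    \<le> C * (2 * dx N * TV N v + (LINT y|XM. \<bar>v (ix N y) - f y\<bar>))"
proof -
  obtain s' where s': "s' \<in> borel_measurable borel" "\<And>x. \<bar>s' x\<bar> \<le> C"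
    "\<And>f x. f \<in> borel_measurable XM \<Longrightarrow> torus_conv \<sigma> f x = (LINT y|XM. s' (x - y) * f y)"
    using torus_conv_borel_kernel[OF s C] by blast
  have C0: "C \<ge> 0" using s'(2)[of 0] by linarith
  define x' where "x' = of_int (ix N x) * dx N"
  define \<delta> where "\<delta> = x - x'"
  have \<delta>: "\<bar>\<delta>\<bar> \<le> dx N / 2" using ix_dist[OF N, of x] by (simp add: \<delta>_def x'_def)
  have iv: "integrable XM (\<lambda>y. v (ix N y))" by (rule XM_step(1)[OF N v])
  have id: "integrable XM (\<lambda>y. v (ix N (y + \<delta>)))" by (rule step_shift_L1(1)[OF N v \<delta>])
  have "grid_conv N (cell_avg N \<sigma>) v (ix N x) - torus_conv \<sigma> (\<lambda>y. v (ix N y)) x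
     = torus_conv \<sigma> (\<lambda>y. v (ix N y)) x' - torus_conv \<sigma> (\<lambda>y. v (ix N (y + \<delta>))) x'"
    unfolding grid_conv_eq_torus_conv[OF N s v] x'_def[symmetric] torus_conv_shift[OF N s v, of x x'] \<delta>_def ..
  also have "\<dots> = (LINT y|XM. s' (x' - y) * (v (ix N y) - v (ix N (y + \<delta>))))"
    unfolding s'(3)[OF borel_measurable_integrable[OF iv]] s'(3)[OF borel_measurable_integrable[OF id]]
    by (subst Bochner_Integration.integral_diff[symmetric]) (auto intro!: kernel_integral_bound(1)[OF s'(1,2)] iv id simp: right_diff_distrib)
  also have "\<bar>\<dots>\<bar> \<le> C * (LINT y|XM. \<bar>v (ix N y) - v (ix N (y + \<delta>))\<bar>)"
    by (rule kernel_integral_bound(2)[OF s'(1,2)]) (use iv id in auto)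
  also have "\<dots> \<le> C * (2 * dx N * TV N v)" by (intro mult_left_mono step_shift_L1(2)[OF N v \<delta>] C0)
  finally have 1: "\<bar>grid_conv N (cell_avg N \<sigma>) v (ix N x) - torus_conv \<sigma> (\<lambda>y. v (ix N y)) x\<bar> \<le> C * (2 * dx N * TV N v)" .
  have "torus_conv \<sigma> (\<lambda>y. v (ix N y)) x - torus_conv \<sigma> f x = (LINT y|XM. s' (x - y) * (v (ix N y) - f y))"
    unfolding s'(3)[OF borel_measurable_integrable[OF iv]] s'(3)[OF borel_measurable_integrable[OF f]]
    by (subst Bochner_Integration.integral_diff[symmetric]) (auto intro!: kernel_integral_bound(1)[OF s'(1,2)] iv f simp: right_diff_distrib)
  also have "\<bar>\<dots>\<bar> \<le> C * (LINT y|XM. \<bar>v (ix N y) - f y\<bar>)"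
    by (rule kernel_integral_bound(2)[OF s'(1,2)]) (use iv f in auto)
  finally show ?thesis using 1 by (simp only: distrib_left)
qed

lemma torus_conv_bound:
  assumes s: "Linf_torus \<sigma>" and C: "AE x in lebesgue. \<bar>\<sigma> x\<bar> \<le> C" and f: "integrable XM f"
  shows "\<bar>torus_conv \<sigma> f x\<bar> \<le> C * (LINT y|XM. \<bar>f y\<bar>)"
proof -
  obtain s' where s': "s' \<in> borel_measurable borel" "\<And>x. \<bar>s' x\<bar> \<le> C"
    "\<And>f x. f \<in> borel_measurable XM \<Longrightarrow> torus_conv \<sigma> f x = (LINT y|XM. s' (x - y) * f y)"
    using torus_conv_borel_kernel[OF s C] by blast
  show ?thesis unfolding s'(3)[OF borel_measurable_integrable[OF f]] by (rule kernel_integral_bound(2)[OF s'(1,2) f])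
qed

lemma torus_conv_measurable:
  fixes u :: "real \<Rightarrow> real \<Rightarrow> real"
  assumes s: "Linf_torus \<sigma>" and u: "(\<lambda>(x, t). u x t) \<in> borel_measurable borel"
  shows "(\<lambda>(x, t). torus_conv \<sigma> (\<lambda>y. u y t) x) \<in> borel_measurable borel"
proof -
  interpret X: finite_measure XM by (rule finite_measure_XM)
  obtain C where C: "AE x in lebesgue. \<bar>\<sigma> x\<bar> \<le> C" using s by (auto simp: Linf_torus_def)
  obtain s' where s': "s' \<in> borel_measurable borel" 
    "\<And>f x. f \<in> borel_measurable XM \<Longrightarrow> torus_conv \<sigma> f x = (LINT y|XM. s' (x - y) * f y)"
    using torus_conv_borel_kernel[OF s C] by blast
  have ub: "(\<lambda>z. u (fst z) (snd z)) \<in> borel_measurable (borel \<Otimes>\<^sub>M borel)"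
    using u by (simp add: borel_prod split_beta')
  have ut: "(\<lambda>y. u y t) \<in> borel_measurable XM" for t
  proof (rule borel_XM)
    have "(\<lambda>y. (y, t)) \<in> borel \<rightarrow>\<^sub>M borel \<Otimes>\<^sub>M borel" by measurable
    from measurable_compose[OF this ub] show "(\<lambda>y. u y t) \<in> borel_measurable borel" by simp
  qed
  have idX: "(\<lambda>y. y) \<in> XM \<rightarrow>\<^sub>M borel" by (rule borel_XM) simp
  have "(\<lambda>z. LINT y|XM. s' (fst z - y) * u y (snd z)) \<in> borel_measurable (borel \<Otimes>\<^sub>M borel)"
  proof (rule X.borel_measurable_lebesgue_integral)
    have f1: "(\<lambda>w. fst (fst w) - snd w) \<in> ((borel \<Otimes>\<^sub>M borel) \<Otimes>\<^sub>M XM) \<rightarrow>\<^sub>M (borel :: real measure)"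
      using measurable_compose[OF measurable_snd idX] by (intro borel_measurable_diff measurable_compose[OF measurable_fst measurable_fst])
    have f2: "(\<lambda>w. (snd w, snd (fst w))) \<in> ((borel \<Otimes>\<^sub>M borel) \<Otimes>\<^sub>M XM) \<rightarrow>\<^sub>M (borel \<Otimes>\<^sub>M borel :: (real \<times> real) measure)"
      using measurable_compose[OF measurable_snd idX] by (intro measurable_Pair measurable_compose[OF measurable_fst measurable_snd])
    have "(\<lambda>w. s' (fst (fst w) - snd w) * u (snd w) (snd (fst w))) \<in> borel_measurable ((borel \<Otimes>\<^sub>M borel) \<Otimes>\<^sub>M XM)"
      using measurable_compose[OF f1 s'(1)] measurable_compose[OF f2 ub] by (intro borel_measurable_times) simp_all
    then show "case_prod (\<lambda>z y. s' (fst z - y) * u y (snd z)) \<in> borel_measurable ((borel \<Otimes>\<^sub>M borel) \<Otimes>\<^sub>M XM)"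
      by (simp add: split_beta')
  qed
  then show ?thesis by (simp add: s'(2)[OF ut] borel_prod split_beta')
qed

section \<open>Convergence of the fluxes\<close>

context discrete_family
begin

lemma limit_slices:
  fixes u :: "real \<Rightarrow> real \<Rightarrow> real"
  assumes ui: "integrable (PM T) (\<lambda>(x, t). u x t)"
  shows "AE t in YM T. integrable XM (\<lambda>x. u x t)"
    "integrable (YM T) (\<lambda>t. LINT x|XM. \<bar>U m (kt T (NT m) t) (ix (N m) x) - u x t\<bar>)"
    "(LINT t|YM T. LINT x|XM. \<bar>U m (kt T (NT m) t) (ix (N m) x) - u x t\<bar>) = (LINT z|PM T. \<bar>step m z - (\<lambda>(x, t). u x t) z\<bar>)"
proof -
  interpret pair_sigma_finite XM "YM T" by (rule pair_XY)
  show "AE t in YM T. integrable XM (\<lambda>x. u x t)"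
    using AE_integrable_snd[of u] ui unfolding PM_def by simp
  have i: "integrable (XM \<Otimes>\<^sub>M YM T) (case_prod (\<lambda>x t. \<bar>U m (kt T (NT m) t) (ix (N m) x) - u x t\<bar>))"
  proof -
    have "integrable (PM T) (\<lambda>z. \<bar>step m z - (\<lambda>(x, t). u x t) z\<bar>)"
      by (intro integrable_abs Bochner_Integration.integrable_diff step_integrable ui)
    then show ?thesis by (simp add: PM_def split_beta')
  qed
  show "integrable (YM T) (\<lambda>t. LINT x|XM. \<bar>U m (kt T (NT m) t) (ix (N m) x) - u x t\<bar>)"
    by (rule integrable_snd[OF i])
  show "(LINT t|YM T. LINT x|XM. \<bar>U m (kt T (NT m) t) (ix (N m) x) - u x t\<bar>) = (LINT z|PM T. \<bar>step m z - (\<lambda>(x, t). u x t) z\<bar>)"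
    using integral_snd[OF i] by (simp add: PM_def split_beta')
qed

lemma step_slice:
  assumes "t \<in> {0<..<T}"
  shows "grid_fun (N m) (U m (kt T (NT m) t))" "integrable XM (\<lambda>x. U m (kt T (NT m) t) (ix (N m) x))" "(LINT x|XM. U m (kt T (NT m) t) (ix (N m) x)) = M"
    "\<And>i. U m (kt T (NT m) t) i \<ge> 0"
proof -
  have k: "kt T (NT m) t \<le> NT m" using kt_range(2)[OF T NT, of t m] assms by auto
  show g: "grid_fun (N m) (U m (kt T (NT m) t))" by (rule U_grid[OF k])
  show "integrable XM (\<lambda>x. U m (kt T (NT m) t) (ix (N m) x))" by (rule XM_step(1)[OF N g])
  show "(LINT x|XM. U m (kt T (NT m) t) (ix (N m) x)) = M" unfolding XM_step(2)[OF N g] by (rule U_mass[OF k])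
  show "\<And>i. U m (kt T (NT m) t) i \<ge> 0" by (rule U_nonneg[OF k])
qed

text \<open>
  Conservation of mass passes to the limit for almost every time.
\<close>

lemma limit_mass:
  fixes u :: "real \<Rightarrow> real \<Rightarrow> real"
  assumes ui: "integrable (PM T) (\<lambda>(x, t). u x t)"
    and lim: "(\<lambda>m. LINT z|PM T. \<bar>step m z - (\<lambda>(x, t). u x t) z\<bar>) \<longlonglongrightarrow> 0"
  shows "AE t in YM T. (LINT x|XM. u x t) = M"
proof -
  interpret pair_sigma_finite XM "YM T" by (rule pair_XY)
  interpret Y: finite_measure "YM T" by (rule finite_measure_YM)
  have iI: "integrable (YM T) (\<lambda>t. LINT x|XM. u x t)" using integrable_snd[of u] ui by (simp add: PM_def)
  have i: "integrable (YM T) (\<lambda>t. \<bar>M - (LINT x|XM. u x t)\<bar>)"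
    by (intro integrable_abs Bochner_Integration.integrable_diff iI) simp
  have b: "(LINT t|YM T. \<bar>M - (LINT x|XM. u x t)\<bar>) \<le> (LINT z|PM T. \<bar>step m z - (\<lambda>(x, t). u x t) z\<bar>)" for m
  proof -
    have "(LINT t|YM T. \<bar>M - (LINT x|XM. u x t)\<bar>) \<le> (LINT t|YM T. LINT x|XM. \<bar>U m (kt T (NT m) t) (ix (N m) x) - u x t\<bar>)"
    proof (rule integral_mono_AE[OF i limit_slices(2)[OF ui]])
      show "AE t in YM T. \<bar>M - (LINT x|XM. u x t)\<bar> \<le> (LINT x|XM. \<bar>U m (kt T (NT m) t) (ix (N m) x) - u x t\<bar>)"
        using limit_slices(1)[OF ui] AE_space
      proof eventually_elim
        case (elim t)
        then have t: "t \<in> {0<..<T}" by simp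
        have "M - (LINT x|XM. u x t) = (LINT x|XM. U m (kt T (NT m) t) (ix (N m) x) - u x t)"
          using step_slice(2,3)[OF t, of m] elim by simp
        then show ?case using integral_norm_bound[of XM "\<lambda>x. U m (kt T (NT m) t) (ix (N m) x) - u x t"] by simp
      qed
    qed
    then show ?thesis unfolding limit_slices(3)[OF ui] .
  qed
  have "(LINT t|YM T. \<bar>M - (LINT x|XM. u x t)\<bar>) \<le> 0"
    by (rule LIMSEQ_le_const[OF lim]) (use b in blast)
  then have "(LINT t|YM T. \<bar>M - (LINT x|XM. u x t)\<bar>) = 0"
    by (intro antisym) simp_all
  then have "AE t in YM T. \<bar>M - (LINT x|XM. u x t)\<bar> = 0"
    using integral_nonneg_eq_0_iff_AE[OF i] by simp
  then show ?thesis by eventually_elim simp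
qed

lemma TV_time_integral:
  "integrable (YM T) (\<lambda>t. TV (N m) (U m (kt T (NT m) t)))" "(LINT t|YM T. TV (N m) (U m (kt T (NT m) t))) \<le> B"
  using YM_step[OF T NT, where b="\<lambda>k. TV (N m) (U m k)"] U_TV[of m] by simp_all

end

text \<open>
  Two discrete families on the same meshes whose step functions converge in \<open>L\<^sup>1\<close> of the cylinder to Borel
  functions \<open>u\<close> and \<open>w\<close>. The fluxes \<open>gU\<close> and \<open>gW\<close> are not yet related to the two species.
\<close>

locale convergent_pair = U: discrete_family T N NT U gU MU BU EU + W: discrete_family T N NT W gW MW BW EW
  for T :: real and N NT :: "nat \<Rightarrow> nat" and U gU :: "nat \<Rightarrow> nat \<Rightarrow> int \<Rightarrow> real" and MU BU EU :: real
    and W gW :: "nat \<Rightarrow> nat \<Rightarrow> int \<Rightarrow> real" and MW BW EW :: real +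
  fixes u w :: "real \<Rightarrow> real \<Rightarrow> real"
  assumes u_borel: "(\<lambda>(x, t). u x t) \<in> borel_measurable borel" and w_borel: "(\<lambda>(x, t). w x t) \<in> borel_measurable borel"
    and u_nonneg: "\<And>x t. u x t \<ge> 0" and w_nonneg: "\<And>x t. w x t \<ge> 0"
    and u_int: "integrable (PM T) (\<lambda>(x, t). u x t)" and w_int: "integrable (PM T) (\<lambda>(x, t). w x t)"
    and u_lim: "(\<lambda>m. LINT z|PM T. \<bar>U.step m z - (\<lambda>(x, t). u x t) z\<bar>) \<longlonglongrightarrow> 0"
    and w_lim: "(\<lambda>m. LINT z|PM T. \<bar>W.step m z - (\<lambda>(x, t). w x t) z\<bar>) \<longlonglongrightarrow> 0"
begin

text \<open>
  The diffusion coefficient converges in \<open>L\<^sup>1\<close> in time, uniformly in space, while the step functions have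
  a fixed mass at every time. Hence the products converge in \<open>L\<^sup>1\<close>.
\<close>

lemma flux_limit:
  fixes d ds dc :: real and \<sigma> \<rho> :: "real \<Rightarrow> real"
  assumes s: "Linf_torus \<sigma>" and r: "Linf_torus \<rho>"
  defines "fm \<equiv> \<lambda>m k i. mu (N m) d ds \<sigma> dc \<rho> (U m k) (W m k) i * U m k i"
  defines "f \<equiv> \<lambda>x t. (d + ds * torus_conv \<sigma> (\<lambda>y. u y t) x + dc * torus_conv \<rho> (\<lambda>y. w y t) x) * u x t"
  shows "\<And>m. integrable (PM T) (\<lambda>(x, t). fm m (kt T (NT m) t) (ix (N m) x))"
    and "integrable (PM T) (\<lambda>(x, t). f x t)"
    and "(\<lambda>m. LINT z|PM T. \<bar>(\<lambda>(x, t). fm m (kt T (NT m) t) (ix (N m) x)) z - (\<lambda>(x, t). f x t) z\<bar>) \<longlonglongrightarrow> 0"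
proof -
  interpret pair_sigma_finite XM "YM T" by (rule pair_XY)
  obtain Cs where Cs: "AE x in lebesgue. \<bar>\<sigma> x\<bar> \<le> Cs" using s by (auto simp: Linf_torus_def)
  obtain Cr where Cr: "AE x in lebesgue. \<bar>\<rho> x\<bar> \<le> Cr" using r by (auto simp: Linf_torus_def)
  have per: "torus_fun \<sigma>" "torus_fun \<rho>" using s r by (auto simp: Linf_torus_def)
  have Cs0: "Cs \<ge> 0" using torus_conv_borel_kernel[OF s Cs] by (meson abs_ge_zero order_trans)
  have Cr0: "Cr \<ge> 0" using torus_conv_borel_kernel[OF r Cr] by (meson abs_ge_zero order_trans)
  note T = U.T and N = U.N and NT = U.NT
  have gf: "grid_fun (N m) (fm m k)" if "k \<in> {1..NT m}" for m k
  proof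
    fix i
    have "grid_fun (N m) (grid_conv (N m) (cell_avg (N m) \<sigma>) (U m k))" "grid_fun (N m) (grid_conv (N m) (cell_avg (N m) \<rho>) (W m k))"
      by (intro grid_conv_grid_fun cell_avg_grid_fun N per)+
    then show "fm m k (i + int (N m)) = fm m k i"
      using U.U_grid[of k m] that by (simp add: fm_def mu_def grid_fun_plus(1))
  qed
  show ifm: "integrable (PM T) (\<lambda>(x, t). fm m (kt T (NT m) t) (ix (N m) x))" for m
    by (rule PM_step(1)[OF T N NT gf])
  define mul where "mul x t = d + ds * torus_conv \<sigma> (\<lambda>y. u y t) x + dc * torus_conv \<rho> (\<lambda>y. w y t) x" for x t
  define DU where "DU m t = (LINT x|XM. \<bar>U m (kt T (NT m) t) (ix (N m) x) - u x t\<bar>)" for m t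
  define DW where "DW m t = (LINT x|XM. \<bar>W m (kt T (NT m) t) (ix (N m) x) - w x t\<bar>)" for m t
  define VU where "VU m t = TV (N m) (U m (kt T (NT m) t))" for m t
  define VW where "VW m t = TV (N m) (W m (kt T (NT m) t))" for m t
  \<comment> \<open>\<open>A m t\<close> bounds the error of the diffusion coefficient uniformly in space, and \<open>Cm\<close> bounds the limiting coefficient.\<close>
  define A where "A m t = \<bar>ds\<bar> * (Cs * (2 * dx (N m) * VU m t + DU m t)) + \<bar>dc\<bar> * (Cr * (2 * dx (N m) * VW m t + DW m t))" for m t
  define Cm where "Cm = \<bar>d\<bar> + \<bar>ds\<bar> * (Cs * MU) + \<bar>dc\<bar> * (Cr * MW)"
  \<comment> \<open>The space integral of the flux error at time \<open>t\<close> is at most \<open>G m t\<close>, and \<open>e m\<close> bounds its time integral.\<close>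
  define G where "G m t = Cm * DU m t + A m t * MU" for m t
  define eU where "eU m = (LINT z|PM T. \<bar>U.step m z - (\<lambda>(x, t). u x t) z\<bar>)" for m
  define eW where "eW m = (LINT z|PM T. \<bar>W.step m z - (\<lambda>(x, t). w x t) z\<bar>)" for m
  define e where "e m = Cm * eU m + (\<bar>ds\<bar> * (Cs * (2 * dx (N m) * BU + eU m)) + \<bar>dc\<bar> * (Cr * (2 * dx (N m) * BW + eW m))) * MU" for m
  note MU0 = U.M_nonneg and MW0 = W.M_nonneg
  have Cm0: "Cm \<ge> 0" unfolding Cm_def using Cs0 Cr0 MU0 MW0 by simp
  have D0: "DU m t \<ge> 0" "DW m t \<ge> 0" for m t unfolding DU_def DW_def by simp_all
  have V0: "VU m t \<ge> 0" "VW m t \<ge> 0" for m t unfolding VU_def VW_def by (simp_all add: TV_nonneg)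
  have dx0: "dx (N m) > 0" for m by (rule dx_pos[OF N])
  have A0: "A m t \<ge> 0" for m t unfolding A_def using Cs0 Cr0 D0[of m t] V0[of m t] dx0[of m] by simp
  have G0: "G m t \<ge> 0" for m t unfolding G_def using Cm0 D0[of m t] A0[of m t] MU0 by simp
  have pt: "\<bar>fm m (kt T (NT m) t) (ix (N m) x) - f x t\<bar> \<le> Cm * \<bar>U m (kt T (NT m) t) (ix (N m) x) - u x t\<bar> + A m t * U m (kt T (NT m) t) (ix (N m) x)"
    if t: "t \<in> {0<..<T}" and iu: "integrable XM (\<lambda>x. u x t)" and iw: "integrable XM (\<lambda>x. w x t)"
      and mu: "(LINT x|XM. u x t) = MU" and mw: "(LINT x|XM. w x t) = MW" for m t x
  proof -
    define k where "k = kt T (NT m) t"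
    define i where "i = ix (N m) x"
    define a where "a = mu (N m) d ds \<sigma> dc \<rho> (U m k) (W m k) i"
    have au: "(LINT x|XM. \<bar>u x t\<bar>) = MU" "(LINT x|XM. \<bar>w x t\<bar>) = MW" using mu mw u_nonneg w_nonneg by simp_all
    have "\<bar>a - mul x t\<bar> = \<bar>ds * (grid_conv (N m) (cell_avg (N m) \<sigma>) (U m k) i - torus_conv \<sigma> (\<lambda>y. u y t) x)
        + dc * (grid_conv (N m) (cell_avg (N m) \<rho>) (W m k) i - torus_conv \<rho> (\<lambda>y. w y t) x)\<bar>"
      by (simp add: a_def mu_def mul_def algebra_simps)
    also have "\<dots> \<le> \<bar>ds\<bar> * \<bar>grid_conv (N m) (cell_avg (N m) \<sigma>) (U m k) i - torus_conv \<sigma> (\<lambda>y. u y t) x\<bar>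
        + \<bar>dc\<bar> * \<bar>grid_conv (N m) (cell_avg (N m) \<rho>) (W m k) i - torus_conv \<rho> (\<lambda>y. w y t) x\<bar>"
      by (rule order_trans[OF abs_triangle_ineq]) (simp add: abs_mult)
    also have "\<dots> \<le> A m t" unfolding A_def VU_def VW_def DU_def DW_def i_def k_def
      by (intro add_mono mult_left_mono grid_conv_error[OF N s Cs U.step_slice(1)[OF t] iu] grid_conv_error[OF N r Cr W.step_slice(1)[OF t] iw]) auto
    finally have 1: "\<bar>a - mul x t\<bar> \<le> A m t" .
    have "\<bar>mul x t\<bar> \<le> \<bar>d\<bar> + \<bar>ds\<bar> * \<bar>torus_conv \<sigma> (\<lambda>y. u y t) x\<bar> + \<bar>dc\<bar> * \<bar>torus_conv \<rho> (\<lambda>y. w y t) x\<bar>"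
      unfolding mul_def abs_mult[symmetric] by linarith
    also have "\<dots> \<le> Cm" unfolding Cm_def
      using torus_conv_bound[OF s Cs iu, of x] torus_conv_bound[OF r Cr iw, of x] unfolding au
      by (intro add_mono mult_left_mono order_refl) auto
    finally have 2: "\<bar>mul x t\<bar> \<le> Cm" .
    have "fm m k i - f x t = mul x t * (U m k i - u x t) + (a - mul x t) * U m k i"
      by (simp add: fm_def f_def a_def mul_def algebra_simps)
    also have "\<bar>\<dots>\<bar> \<le> \<bar>mul x t\<bar> * \<bar>U m k i - u x t\<bar> + \<bar>a - mul x t\<bar> * \<bar>U m k i\<bar>"
      by (rule order_trans[OF abs_triangle_ineq]) (simp add: abs_mult)
    also have "\<dots> \<le> Cm * \<bar>U m k i - u x t\<bar> + A m t * \<bar>U m k i\<bar>"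
      using 1 2 by (intro add_mono mult_right_mono) auto
    finally show ?thesis using U.step_slice(4)[OF t, of m i] by (simp add: k_def i_def)
  qed
  have mf: "(\<lambda>(x, t). f x t) \<in> borel_measurable (PM T)"
  proof -
    have "(\<lambda>z. (d + ds * (\<lambda>(x, t). torus_conv \<sigma> (\<lambda>y. u y t) x) z + dc * (\<lambda>(x, t). torus_conv \<rho> (\<lambda>y. w y t) x) z) * (\<lambda>(x, t). u x t) z) \<in> borel_measurable (PM T)"
      by (intro borel_measurable_times borel_measurable_add borel_measurable_const borel_measurable_PM
          torus_conv_measurable[OF s u_borel] torus_conv_measurable[OF r w_borel] u_borel)
    then show ?thesis by (simp add: f_def split_beta')
  qed
  have GI: "integrable (YM T) (G m)" "(LINT t|YM T. G m t) \<le> e m" for m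
  proof -
    have iDU: "integrable (YM T) (DU m)" "(LINT t|YM T. DU m t) = eU m"
      using U.limit_slices(2,3)[OF u_int, of m] by (simp_all add: DU_def[abs_def] eU_def)
    have iDW: "integrable (YM T) (DW m)" "(LINT t|YM T. DW m t) = eW m"
      using W.limit_slices(2,3)[OF w_int, of m] by (simp_all add: DW_def[abs_def] eW_def)
    have iVU: "integrable (YM T) (VU m)" "(LINT t|YM T. VU m t) \<le> BU"
      using U.TV_time_integral[of m] by (simp_all add: VU_def[abs_def])
    have iVW: "integrable (YM T) (VW m)" "(LINT t|YM T. VW m t) \<le> BW"
      using W.TV_time_integral[of m] by (simp_all add: VW_def[abs_def])
    show "integrable (YM T) (G m)" unfolding G_def[abs_def] A_def using iDU iDW iVU iVW by simp
    have "(LINT t|YM T. G m t) = Cm * eU m + (\<bar>ds\<bar> * (Cs * (2 * dx (N m) * (LINT t|YM T. VU m t) + eU m)) + \<bar>dc\<bar> * (Cr * (2 * dx (N m) * (LINT t|YM T. VW m t) + eW m))) * MU"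
      unfolding G_def A_def using iDU iDW iVU(1) iVW(1) by simp
    also have "\<dots> \<le> e m" unfolding e_def using iVU(2) iVW(2) MU0 Cs0 Cr0 dx0[of m]
      by (intro add_mono mult_left_mono mult_right_mono order_refl) auto
    finally show "(LINT t|YM T. G m t) \<le> e m" .
  qed
  have e0: "e m \<ge> 0" for m using GI(2)[of m] by (rule order_trans[rotated]) (simp add: G0)
  have md: "(\<lambda>z. \<bar>(\<lambda>(x, t). fm m (kt T (NT m) t) (ix (N m) x)) z - (\<lambda>(x, t). f x t) z\<bar>) \<in> borel_measurable (PM T)" for m
    using mf borel_measurable_integrable[OF ifm] by (intro borel_measurable_abs borel_measurable_diff)
  have nn: "(\<integral>\<^sup>+z. ennreal \<bar>(\<lambda>(x, t). fm m (kt T (NT m) t) (ix (N m) x)) z - (\<lambda>(x, t). f x t) z\<bar> \<partial>PM T) \<le> ennreal (e m)" for m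
  proof -
    have "(\<lambda>z. ennreal \<bar>(\<lambda>(x, t). fm m (kt T (NT m) t) (ix (N m) x)) z - (\<lambda>(x, t). f x t) z\<bar>) \<in> borel_measurable (XM \<Otimes>\<^sub>M YM T)"
      using measurable_compose[OF md measurable_ennreal] unfolding PM_def .
    from nn_integral_snd[OF this] have "(\<integral>\<^sup>+z. ennreal \<bar>(\<lambda>(x, t). fm m (kt T (NT m) t) (ix (N m) x)) z - (\<lambda>(x, t). f x t) z\<bar> \<partial>PM T)
      = (\<integral>\<^sup>+t. \<integral>\<^sup>+x. ennreal \<bar>fm m (kt T (NT m) t) (ix (N m) x) - f x t\<bar> \<partial>XM \<partial>YM T)" by (simp add: PM_def)
    also have "\<dots> \<le> (\<integral>\<^sup>+t. ennreal (G m t) \<partial>YM T)"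
    proof (rule nn_integral_mono_AE)
      show "AE t in YM T. (\<integral>\<^sup>+x. ennreal \<bar>fm m (kt T (NT m) t) (ix (N m) x) - f x t\<bar> \<partial>XM) \<le> ennreal (G m t)"
        using U.limit_slices(1)[OF u_int] W.limit_slices(1)[OF w_int] U.limit_mass[OF u_int u_lim] W.limit_mass[OF w_int w_lim] AE_space
      proof eventually_elim
        case (elim t)
        then have t: "t \<in> {0<..<T}" by simp
        let ?B = "\<lambda>x. Cm * \<bar>U m (kt T (NT m) t) (ix (N m) x) - u x t\<bar> + A m t * U m (kt T (NT m) t) (ix (N m) x)"
        have iB: "integrable XM ?B" using elim(1) U.step_slice(2)[OF t, of m] by simp
        have "(\<integral>\<^sup>+x. ennreal \<bar>fm m (kt T (NT m) t) (ix (N m) x) - f x t\<bar> \<partial>XM) \<le> (\<integral>\<^sup>+x. ennreal (?B x) \<partial>XM)"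
          by (rule nn_integral_mono) (intro ennreal_leI pt[OF t elim(1-4)])
        also have "\<dots> = ennreal (LINT x|XM. ?B x)"
          using Cm0 A0[of m t] U.step_slice(4)[OF t, of m] by (intro nn_integral_eq_integral[OF iB] AE_I2) simp
        also have "(LINT x|XM. ?B x) = G m t"
          using elim(1) U.step_slice(2,3)[OF t, of m] by (simp add: G_def DU_def)
        finally show ?case .
      qed
    qed
    also have "\<dots> = ennreal (LINT t|YM T. G m t)" by (rule nn_integral_eq_integral[OF GI(1)]) (simp add: G0)
    also have "\<dots> \<le> ennreal (e m)" using GI(2) by (rule ennreal_leI)
    finally show ?thesis .
  qed
  have le: "(LINT z|PM T. \<bar>(\<lambda>(x, t). fm m (kt T (NT m) t) (ix (N m) x)) z - (\<lambda>(x, t). f x t) z\<bar>) \<le> e m" for m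
    by (rule integral_real_bounded[OF e0 nn])
  have id: "integrable (PM T) (\<lambda>z. (\<lambda>(x, t). fm m (kt T (NT m) t) (ix (N m) x)) z - (\<lambda>(x, t). f x t) z)" for m
  proof (rule integrableI_bounded)
    show "(\<lambda>z. (\<lambda>(x, t). fm m (kt T (NT m) t) (ix (N m) x)) z - (\<lambda>(x, t). f x t) z) \<in> borel_measurable (PM T)"
      using mf borel_measurable_integrable[OF ifm] by (intro borel_measurable_diff)
    show "(\<integral>\<^sup>+z. ennreal (norm ((\<lambda>(x, t). fm m (kt T (NT m) t) (ix (N m) x)) z - (\<lambda>(x, t). f x t) z)) \<partial>PM T) < \<infinity>"
      using le_less_trans[OF nn[of m] ennreal_less_top] unfolding real_norm_def by simp
  qed
  have "integrable (PM T) (\<lambda>z. (\<lambda>(x, t). fm 0 (kt T (NT 0) t) (ix (N 0) x)) z - ((\<lambda>(x, t). fm 0 (kt T (NT 0) t) (ix (N 0) x)) z - (\<lambda>(x, t). f x t) z))"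
    by (rule Bochner_Integration.integrable_diff[OF ifm id])
  then show "integrable (PM T) (\<lambda>(x, t). f x t)" by (simp add: split_beta')
  show "(\<lambda>m. LINT z|PM T. \<bar>(\<lambda>(x, t). fm m (kt T (NT m) t) (ix (N m) x)) z - (\<lambda>(x, t). f x t) z\<bar>) \<longlonglongrightarrow> 0"
  proof (rule Lim_null_comparison[OF always_eventually])
    show "\<forall>m. norm (LINT z|PM T. \<bar>(\<lambda>(x, t). fm m (kt T (NT m) t) (ix (N m) x)) z - (\<lambda>(x, t). f x t) z\<bar>) \<le> e m"
      using le by (simp add: abs_of_nonneg)
    have "e \<longlonglongrightarrow> Cm * 0 + (\<bar>ds\<bar> * (Cs * (2 * 0 * BU + 0)) + \<bar>dc\<bar> * (Cr * (2 * 0 * BW + 0))) * MU"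
      unfolding e_def[abs_def] eU_def[abs_def] eW_def[abs_def] by (intro tendsto_intros U.dx0 u_lim w_lim)
    then show "e \<longlonglongrightarrow> 0" by simp
  qed
qed

end

section \<open>Test functions\<close>

lemma periodic_deriv:
  fixes f f' :: "real \<Rightarrow> real"
  assumes "torus_fun f" "\<And>x. (f has_real_derivative f' x) (at x)"
  shows "torus_fun f'"
proof
  fix x
  have "((\<lambda>y. f (y + 1)) has_real_derivative f' (x + 1)) (at x)"
    using assms(2)[of "x + 1"] DERIV_shift[of f "f' (x + 1)" x 1] by simp
  moreover have "(\<lambda>y. f (y + 1)) = f" using torus_fun_plus_int[OF assms(1), of _ 1] by auto
  ultimately show "f' (x + 1) = f' x" using DERIV_unique[OF _ assms(2)] by simp
qed

lemma periodic_bounded: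
  fixes F :: "real \<Rightarrow> real \<Rightarrow> real"
  assumes c: "continuous_on (UNIV \<times> {0..<T}) (\<lambda>(x, t). F x t)" and T': "0 \<le> T'" "T' < T"
    and per: "\<And>t. t \<in> S \<Longrightarrow> torus_fun (\<lambda>x. F x t)" and S: "S \<subseteq> {0..<T}"
    and z: "\<And>x t. t \<in> {T'<..<T} \<Longrightarrow> F x t = 0"
  shows "\<exists>K\<ge>0. \<forall>x. \<forall>t\<in>S. \<bar>F x t\<bar> \<le> K"
proof -
  have "compact ({0..1} \<times> {0..T'} :: (real \<times> real) set)" by (intro compact_Times) auto
  moreover have "continuous_on ({0..1} \<times> {0..T'}) (\<lambda>(x, t). F x t)"
    by (rule continuous_on_subset[OF c]) (use T' in auto)
  ultimately have "bounded ((\<lambda>(x, t). F x t) ` ({0..1} \<times> {0..T'}))"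
    by (intro compact_imp_bounded compact_continuous_image)
  then obtain K where K: "\<And>y. y \<in> (\<lambda>(x, t). F x t) ` ({0..1} \<times> {0..T'}) \<Longrightarrow> norm y \<le> K" unfolding bounded_iff by blast
  have "\<bar>F x t\<bar> \<le> max K 0" if t: "t \<in> S" for x t
  proof (cases "t \<le> T'")
    case True
    have "F x t = F (frac x + of_int \<lfloor>x\<rfloor>) t" by (simp add: frac_def)
    also have "\<dots> = F (frac x) t" by (rule torus_fun_plus_int[OF per[OF t]])
    finally have e: "F x t = F (frac x) t" .
    have "(frac x, t) \<in> {0..1} \<times> {0..T'}" using True S t by (auto simp: less_imp_le[OF frac_lt_1])
    then have "norm (F (frac x) t) \<le> K" by (intro K) force
    then show ?thesis unfolding e by simp
  next
    case False then show ?thesis using z[of t x] S t by auto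
  qed
  then show ?thesis by (intro exI[of _ "max K 0"]) auto
qed

text \<open>
  The derivatives of a test function that enter the weak equation, with a common bound: they are
  continuous, periodic in space and vanish near the final time.
\<close>

lemma test_functionE:
  assumes tf: "test_function T \<phi>" and T: "T > 0"
  obtains T' px pt p1 K where "0 \<le> T'" "T' < T"
    and "\<And>x t. t \<in> {T'<..<T} \<Longrightarrow> \<phi> x t = 0"
    and "\<And>t. t \<in> {0..<T} \<Longrightarrow> torus_fun (\<lambda>x. \<phi> x t)"
    and "continuous_on (UNIV \<times> {0..<T}) (\<lambda>(x, t). \<phi> x t)"
    and "continuous_on (UNIV \<times> {0..<T}) (\<lambda>(x, t). px x t)"
    and "continuous_on (UNIV \<times> {0..<T}) (\<lambda>(x, t). pt x t)"
    and "\<And>x t. t \<in> {0..<T} \<Longrightarrow> ((\<lambda>y. \<phi> y t) has_real_derivative p1 x t) (at x)"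
    and "\<And>x t. t \<in> {0..<T} \<Longrightarrow> ((\<lambda>y. p1 y t) has_real_derivative px x t) (at x)"
    and "\<And>x t. t \<in> {0<..<T} \<Longrightarrow> ((\<lambda>s. \<phi> x s) has_real_derivative pt x t) (at t)"
    and "K \<ge> 0" "\<And>x t. t \<in> {0..<T} \<Longrightarrow> \<bar>\<phi> x t\<bar> \<le> K" "\<And>x t. t \<in> {0..<T} \<Longrightarrow> \<bar>px x t\<bar> \<le> K" "\<And>x t. t \<in> {0<..<T} \<Longrightarrow> \<bar>pt x t\<bar> \<le> K"
proof -
  have per: "\<And>t. t \<in> {0..<T} \<Longrightarrow> torus_fun (\<lambda>x. \<phi> x t)" using tf unfolding test_function_def by blast
  obtain D where D0: "D 0 0 = \<phi>" and Dc: "\<And>i j. continuous_on (UNIV \<times> {0..<T}) (\<lambda>(x, t). D i j x t)"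
    and Dx: "\<And>i j x t. t \<in> {0..<T} \<Longrightarrow> ((\<lambda>y. D i j y t) has_real_derivative D (Suc i) j x t) (at x)"
    and Dt: "\<And>i j x t. t \<in> {0..<T} \<Longrightarrow> ((\<lambda>s. D i j x s) has_real_derivative D i (Suc j) x t) (at t within {0..<T})"
    using tf unfolding test_function_def by blast
  obtain T0 where T0: "T0 < T" "\<And>x t. t \<in> {T0<..<T} \<Longrightarrow> \<phi> x t = 0"
    using tf unfolding test_function_def by blast
  define T' where "T' = max T0 0"
  have T': "0 \<le> T'" "T' < T" using T0(1) T by (auto simp: T'_def)
  have z: "\<phi> x t = 0" if "t \<in> {T'<..<T}" for x t using T0(2)[of t x] that by (auto simp: T'_def)
  have d1: "((\<lambda>y. \<phi> y t) has_real_derivative D 1 0 x t) (at x)" if "t \<in> {0..<T}" for x t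
    using Dx[OF that, of 0 0 x] by (simp add: D0)
  have d2: "((\<lambda>y. D 1 0 y t) has_real_derivative D 2 0 x t) (at x)" if "t \<in> {0..<T}" for x t
    using Dx[OF that, of 1 0 x] by (simp add: numeral_2_eq_2)
  have dt: "((\<lambda>s. \<phi> x s) has_real_derivative D 0 1 x t) (at t)" if "t \<in> {0<..<T}" for x t
  proof -
    have "at t within {0..<T} = at t" by (rule at_within_interior) (use that in simp)
    then show ?thesis using Dt[of t 0 0 x] that by (simp add: D0)
  qed
  have z1: "D 1 0 x t = 0" if t: "t \<in> {T'<..<T}" for x t
  proof -
    have "((\<lambda>y. \<phi> y t) has_real_derivative D 1 0 x t) (at x)" using d1[of t x] t T' by auto
    moreover have "(\<lambda>y. \<phi> y t) = (\<lambda>_. 0)" using z[OF t] by auto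
    ultimately show ?thesis using DERIV_unique[OF _ DERIV_const] by auto
  qed
  have z2: "D 2 0 x t = 0" if t: "t \<in> {T'<..<T}" for x t
  proof -
    have "((\<lambda>y. D 1 0 y t) has_real_derivative D 2 0 x t) (at x)" using d2[of t x] t T' by auto
    moreover have "(\<lambda>y. D 1 0 y t) = (\<lambda>_. 0)" using z1[OF t] by auto
    ultimately show ?thesis using DERIV_unique[OF _ DERIV_const] by auto
  qed
  have zt: "D 0 1 x t = 0" if t: "t \<in> {T'<..<T}" for x t
  proof -
    have "((\<lambda>s. 0) has_real_derivative D 0 1 x t) (at t)"
      by (rule has_field_derivative_transform_within_open[OF dt, of t "{T'<..<T}"]) (use t T' z in auto)
    then show ?thesis using DERIV_unique[OF _ DERIV_const] by auto
  qed
  have per2: "torus_fun (\<lambda>x. D 2 0 x t)" if "t \<in> {0..<T}" for t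
    by (rule periodic_deriv[OF periodic_deriv[OF per[OF that] d1[OF that]] d2[OF that]])
  have pert: "torus_fun (\<lambda>x. D 0 1 x t)" if t: "t \<in> {0<..<T}" for t
  proof
    fix x
    have "((\<lambda>s. \<phi> x s) has_real_derivative D 0 1 (x + 1) t) (at t)"
    proof (rule has_field_derivative_transform_within_open[OF dt[OF t, of "x + 1"], of "{0<..<T}"])
      fix s assume "s \<in> {0<..<T}"
      then have s: "s \<in> {0..<T}" by auto
      from torus_fun_plus_int[OF per[OF s], of x 1] show "\<phi> (x + 1) s = \<phi> x s" by simp
    qed (use t in auto)
    then show "D 0 1 (x + 1) t = D 0 1 x t" using DERIV_unique[OF _ dt[OF t]] by blast
  qed
  have c\<phi>: "continuous_on (UNIV \<times> {0..<T}) (\<lambda>(x, t). \<phi> x t)" using Dc[of 0 0] by (simp add: D0)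
  obtain K0 where K0: "K0 \<ge> 0" "\<And>x t. t \<in> {0..<T} \<Longrightarrow> \<bar>\<phi> x t\<bar> \<le> K0"
  proof -
    have "\<exists>K\<ge>0. \<forall>x. \<forall>t\<in>{0..<T}. \<bar>(\<phi>) x t\<bar> \<le> K"
    proof (rule periodic_bounded[where F="\<phi>" and T=T and T'=T'])
      show "continuous_on (UNIV \<times> {0..<T}) (\<lambda>(x, t). (\<phi>) x t)" by (rule c\<phi>)
      show "torus_fun (\<lambda>x. (\<phi>) x t)" if "t \<in> {0..<T}" for t using that by (rule per)
      show "(\<phi>) x t = 0" if "t \<in> {T'<..<T}" for x t using that by (rule z)
    qed (use T' in auto)
    then show thesis using that by blast
  qed
  obtain K1 where K1: "K1 \<ge> 0" "\<And>x t. t \<in> {0..<T} \<Longrightarrow> \<bar>D 2 0 x t\<bar> \<le> K1"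
  proof -
    have "\<exists>K\<ge>0. \<forall>x. \<forall>t\<in>{0..<T}. \<bar>(D 2 0) x t\<bar> \<le> K"
    proof (rule periodic_bounded[where F="D 2 0" and T=T and T'=T'])
      show "continuous_on (UNIV \<times> {0..<T}) (\<lambda>(x, t). (D 2 0) x t)" by (rule Dc)
      show "torus_fun (\<lambda>x. (D 2 0) x t)" if "t \<in> {0..<T}" for t using that by (rule per2)
      show "(D 2 0) x t = 0" if "t \<in> {T'<..<T}" for x t using that by (rule z2)
    qed (use T' in auto)
    then show thesis using that by blast
  qed
  obtain K2 where K2: "K2 \<ge> 0" "\<And>x t. t \<in> {0<..<T} \<Longrightarrow> \<bar>D 0 1 x t\<bar> \<le> K2"
  proof -
    have "\<exists>K\<ge>0. \<forall>x. \<forall>t\<in>{0<..<T}. \<bar>(D 0 1) x t\<bar> \<le> K"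
    proof (rule periodic_bounded[where F="D 0 1" and T=T and T'=T'])
      show "continuous_on (UNIV \<times> {0..<T}) (\<lambda>(x, t). (D 0 1) x t)" by (rule Dc)
      show "torus_fun (\<lambda>x. (D 0 1) x t)" if "t \<in> {0<..<T}" for t using that by (rule pert)
      show "(D 0 1) x t = 0" if "t \<in> {T'<..<T}" for x t using that by (rule zt)
    qed (use T' in auto)
    then show thesis using that by blast
  qed
  define K where "K = K0 + K1 + K2"
  show thesis
  proof (rule that[of T' "D 2 0" "D 0 1" "D 1 0" K])
    show "0 \<le> T'" "T' < T" by fact+
    show "\<And>x t. t \<in> {T'<..<T} \<Longrightarrow> \<phi> x t = 0" by (rule z)
    show "\<And>t. t \<in> {0..<T} \<Longrightarrow> torus_fun (\<lambda>x. \<phi> x t)" by (rule per)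
    show "continuous_on (UNIV \<times> {0..<T}) (\<lambda>(x, t). \<phi> x t)" by (rule c\<phi>)
    show "continuous_on (UNIV \<times> {0..<T}) (\<lambda>(x, t). D 2 0 x t)" by (rule Dc)
    show "continuous_on (UNIV \<times> {0..<T}) (\<lambda>(x, t). D 0 1 x t)" by (rule Dc)
    show "\<And>x t. t \<in> {0..<T} \<Longrightarrow> ((\<lambda>y. \<phi> y t) has_real_derivative D 1 0 x t) (at x)" by (rule d1)
    show "\<And>x t. t \<in> {0..<T} \<Longrightarrow> ((\<lambda>y. D 1 0 y t) has_real_derivative D 2 0 x t) (at x)" by (rule d2)
    show "\<And>x t. t \<in> {0<..<T} \<Longrightarrow> ((\<lambda>s. \<phi> x s) has_real_derivative D 0 1 x t) (at t)" by (rule dt)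
    show "K \<ge> 0" using K0 K1 K2 by (simp add: K_def)
    show "\<bar>\<phi> x t\<bar> \<le> K" if "t \<in> {0..<T}" for x t using K0(2)[OF that, of x] K1(1) K2(1) by (simp add: K_def)
    show "\<bar>D 2 0 x t\<bar> \<le> K" if "t \<in> {0..<T}" for x t using K1(2)[OF that, of x] K0(1) K2(1) by (simp add: K_def)
    show "\<bar>D 0 1 x t\<bar> \<le> K" if "t \<in> {0<..<T}" for x t using K2(2)[OF that, of x] K0(1) K1(1) by (simp add: K_def)
  qed
qed

text \<open>
  A test function is only specified before time \<open>T\<close>. Its extension by zero satisfies the mean value theorem
  on every time step, including the last one.
\<close>

lemma zero_extension_mvt:
  fixes f :: "real \<Rightarrow> real"
  assumes T': "0 \<le> T'" "T' < T" and z: "\<And>t. t \<in> {T'<..<T} \<Longrightarrow> f t = 0"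
    and c: "continuous_on {0..<T} f" and d: "\<And>t. t \<in> {0<..<T} \<Longrightarrow> (f has_real_derivative f' t) (at t)"
    and st: "0 \<le> a" "a < b" "b \<le> T"
  shows "\<exists>\<xi>. a < \<xi> \<and> \<xi> < b \<and> (if b < T then f b else 0) - (if a < T then f a else 0) = (b - a) * f' \<xi>"
proof -
  define F where "F t = (if t < T then f t else 0)" for t
  define c0 where "c0 = (T' + T) / 2"
  have c0: "T' < c0" "c0 < T" using T' by (auto simp: c0_def)
  have "continuous_on ({0..c0} \<union> {c0..T}) F"
  proof (rule continuous_on_closed_Un)
    have "continuous_on {0..c0} f" by (rule continuous_on_subset[OF c]) (use c0 in auto)
    then show "continuous_on {0..c0} F" using c0 by (subst continuous_on_cong[of _ _ F f]) (auto simp: F_def)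
    have "continuous_on {c0..T} (\<lambda>_. 0::real)" by simp
    then show "continuous_on {c0..T} F" using c0 z by (subst continuous_on_cong[of _ _ F "\<lambda>_. 0"]) (auto simp: F_def)
  qed auto
  then have cF: "continuous_on {a..b} F" by (rule continuous_on_subset) (use st c0 T' in auto)
  have dF: "(F has_real_derivative f' t) (at t)" if "t \<in> {0<..<T}" for t
    by (rule has_field_derivative_transform_within_open[OF d[OF that], of "{..<T}"]) (use that in \<open>auto simp: F_def\<close>)
  have "\<exists>l \<xi>. a < \<xi> \<and> \<xi> < b \<and> DERIV F \<xi> :> l \<and> F b - F a = (b - a) * l"
  proof (rule MVT[OF st(2) cF])
    fix x assume "a < x" "x < b" then show "F differentiable (at x)" using dF[of x] st by (auto simp: real_differentiable_def)
  qed
  then obtain l \<xi> where x: "a < \<xi>" "\<xi> < b" "DERIV F \<xi> :> l" "F b - F a = (b - a) * l" by blast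
  have "l = f' \<xi>" using DERIV_unique[OF x(3) dF] x(1,2) st by auto
  then show ?thesis using x unfolding F_def by blast
qed

section \<open>The weak equation in the limit\<close>

context discrete_family
begin

text \<open>
  The scheme tested with nodal values \<open>p\<close> that vanish at the final time level: Abel summation in time and
  summation by parts in space.
\<close>

lemma discrete_weak_form:
  assumes p: "\<And>k. k \<le> NT m \<Longrightarrow> grid_fun (N m) (p k)" and pT: "\<And>i. p (NT m) i = 0"
  shows "(\<Sum>k\<in>{1..NT m}. dt T (NT m) * (\<Sum>i\<in>{0..<int (N m)}. dx (N m) *
      (U m k i * ((p k i - p (k - 1) i) / dt T (NT m))
       + g m k i * ((p (k - 1) (i + 1) - 2 * p (k - 1) i + p (k - 1) (i - 1)) / (dx (N m))\<^sup>2))))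
    = - (\<Sum>i\<in>{0..<int (N m)}. dx (N m) * U m 0 i * p 0 i)"
proof -
  let ?I = "{0..<int (N m)}" and ?d = "dx (N m)" and ?t = "dt T (NT m)"
  note d = dx_pos[OF N, of m] and t = dt_pos[OF T NT, of m]
  define S where "S k = (\<Sum>i\<in>?I. ?d * U m k i * p k i)" for k
  have e: "?t * (\<Sum>i\<in>?I. ?d * (U m k i * ((p k i - p (k - 1) i) / ?t)
       + g m k i * ((p (k - 1) (i + 1) - 2 * p (k - 1) i + p (k - 1) (i - 1)) / ?d\<^sup>2))) = S k - S (k - 1)"
    if k: "k \<in> {1..NT m}" for k
  proof -
    have gp: "grid_fun (N m) (p (k - 1))" using k by (intro p) auto
    have "?t * (\<Sum>i\<in>?I. ?d * (U m k i * ((p k i - p (k - 1) i) / ?t)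
       + g m k i * ((p (k - 1) (i + 1) - 2 * p (k - 1) i + p (k - 1) (i - 1)) / ?d\<^sup>2)))
      = (\<Sum>i\<in>?I. ?d * (U m k i * (p k i - p (k - 1) i))) + ?t / ?d * (\<Sum>i\<in>?I. g m k i * (p (k - 1) (i + 1) - 2 * p (k - 1) i + p (k - 1) (i - 1)))"
      unfolding sum_distrib_left sum.distrib[symmetric] using d t
      by (intro sum.cong refl) (simp add: field_simps power2_eq_square)
    also have "(\<Sum>i\<in>?I. g m k i * (p (k - 1) (i + 1) - 2 * p (k - 1) i + p (k - 1) (i - 1)))
      = (\<Sum>i\<in>?I. (g m k (i + 1) - 2 * g m k i + g m k (i - 1)) * p (k - 1) i)"
      by (rule discrete_green[OF N g_grid[OF k] gp])
    also have "?t / ?d * \<dots> = (\<Sum>i\<in>?I. ?d * ((U m k i - U m (k - 1) i) * p (k - 1) i))"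
      unfolding U_step[OF k] sum_distrib_left using d by (intro sum.cong refl) (simp add: power2_eq_square)
    also have "(\<Sum>i\<in>?I. ?d * (U m k i * (p k i - p (k - 1) i))) + \<dots> = S k - S (k - 1)"
      unfolding S_def sum_subtractf[symmetric] sum.distrib[symmetric] by (intro sum.cong refl) (simp add: algebra_simps)
    finally show ?thesis .
  qed
  have "(\<Sum>k\<in>{1..NT m}. S k - S (k - 1)) = S (NT m) - S 0"
    using sum_telescope''[of 0 "NT m" S] by simp
  also have "\<dots> = - (\<Sum>i\<in>?I. ?d * U m 0 i * p 0 i)" by (simp add: S_def pT)
  finally show ?thesis using e by simp
qed

text \<open>
  The discrete initial term is the integral of the datum against the test function evaluated at cell
  centres, so that convergence needs no approximation property of the datum.
\<close>

lemma initial_term_limit: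
  fixes q :: "real \<Rightarrow> real"
  assumes u0: "L1_torus u0" and q: "torus_fun q" "continuous_on UNIV q" and K: "\<And>x. \<bar>q x\<bar> \<le> K"
  shows "(\<lambda>m. \<Sum>i\<in>{0..<int (N m)}. dx (N m) * cell_avg (N m) u0 i * q (of_int i * dx (N m)))
    \<longlonglongrightarrow> (LINT x:{0..<1}|lebesgue. u0 x * q x)"
proof -
  define F where "F x = indicat_real {0..<1} x *\<^sub>R u0 x" for x
  have u0t: "torus_fun u0" and u0i: "set_integrable lebesgue {0..<1} u0" using u0 by (auto simp: L1_torus_def)
  have Fi: "integrable lebesgue F" using u0i unfolding F_def[abs_def] set_integrable_def .
  define qm where "qm m x = q (of_int (ix (N m) x) * dx (N m))" for m x
  have qb: "qm m \<in> borel_measurable lebesgue" for m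
  proof -
    have "(\<lambda>x. (\<lambda>i. q (of_int i * dx (N m))) (ix (N m) x)) \<in> borel_measurable borel"
      by (rule measurable_compose[OF ix_borel]) simp
    then show ?thesis unfolding qm_def[abs_def] by (intro measurable_completion) simp
  qed
  have qq: "q \<in> borel_measurable lebesgue" using borel_measurable_continuous_onI[OF q(2)] by (intro measurable_completion) simp
  have lim: "(\<lambda>m. qm m x) \<longlonglongrightarrow> q x" for x
    unfolding qm_def using continuous_on_tendsto_compose[OF q(2) cell_center_tendsto[OF N dx0, of x]] by simp
  have L: "(\<lambda>m. LINT x|lebesgue. F x * qm m x) \<longlonglongrightarrow> (LINT x|lebesgue. F x * q x)"
    by (rule L1_product_limit(2)[where f="\<lambda>_. F", OF Fi Fi _ qb qq _ lim]) (use K in \<open>auto simp: qm_def\<close>)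
  have e: "(LINT x|lebesgue. F x * qm m x) = (\<Sum>i\<in>{0..<int (N m)}. dx (N m) * cell_avg (N m) u0 i * q (of_int i * dx (N m)))" for m
  proof -
    have gq: "grid_fun (N m) (\<lambda>i. q (of_int i * dx (N m)))" by (rule grid_fun_sample[where f=q, OF N torus_fun_plus_int[OF q(1)]])
    have tq: "torus_fun (\<lambda>x. u0 x * qm m x)"
    proof
      fix x show "u0 (x + 1) * qm m (x + 1) = u0 x * qm m x"
        using torus_fun_plus_int[OF u0t, of x 1] grid_fun_plus(1)[OF gq, of "ix (N m) x"] by (simp add: qm_def ix_plus1[OF N])
    qed
    have iq: "set_integrable lebesgue {0..<1} (\<lambda>x. u0 x * qm m x)"
    proof -
      have "integrable lebesgue (\<lambda>x. F x * qm m x)"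
        by (rule L1_product_limit(1)[where f="\<lambda>_. F" and p="\<lambda>_. qm m", OF Fi Fi _ qb qb]) (use K in \<open>auto simp: qm_def\<close>)
      then show ?thesis unfolding set_integrable_def F_def by (simp add: mult_ac)
    qed
    have "(LINT x|lebesgue. F x * qm m x) = (LINT x:{0..<1}|lebesgue. u0 x * qm m x)"
      unfolding set_lebesgue_integral_def F_def by (simp add: mult_ac)
    also have "\<dots> = (\<Sum>n\<in>{0..<int (N m)}. LINT x:cell (N m) n|lebesgue. u0 x * qm m x)"
      by (rule torus_integral_cells(1)[OF N tq iq])
    also have "\<dots> = (\<Sum>i\<in>{0..<int (N m)}. dx (N m) * cell_avg (N m) u0 i * q (of_int i * dx (N m)))"
    proof (rule sum.cong[OF refl])
      fix n
      have "(LINT x:cell (N m) n|lebesgue. u0 x * qm m x) = (LINT x:cell (N m) n|lebesgue. u0 x * q (of_int n * dx (N m)))"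
        by (rule set_lebesgue_integral_cong) (auto simp: qm_def ix_cell[OF N], simp add: cell_def)
      also have "\<dots> = dx (N m) * cell_avg (N m) u0 n * q (of_int n * dx (N m))"
        using dx_pos[OF N, of m] by (simp add: cell_avg_def)
      finally show "(LINT x:cell (N m) n|lebesgue. u0 x * qm m x) = dx (N m) * cell_avg (N m) u0 n * q (of_int n * dx (N m))" .
    qed
    finally show ?thesis .
  qed
  have "(LINT x|lebesgue. F x * q x) = (LINT x:{0..<1}|lebesgue. u0 x * q x)"
    unfolding set_lebesgue_integral_def F_def by (simp add: mult_ac)
  then show ?thesis using L unfolding e by simp
qed

end

context convergent_pair
begin

text \<open>
  Both terms of the discrete weak form are space-time integrals of a step function converging in \<open>L\<^sup>1\<close>
  against a difference quotient of the test function, which is bounded and converges pointwise.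
\<close>

theorem weak_equation_limit:
  fixes d ds dc :: real and \<sigma> \<rho> u0 :: "real \<Rightarrow> real"
  assumes s: "Linf_torus \<sigma>" and r: "Linf_torus \<rho>" and u0: "L1_torus u0"
    and gU: "\<And>m k i. k \<in> {1..NT m} \<Longrightarrow> gU m k i = mu (N m) d ds \<sigma> dc \<rho> (U m k) (W m k) i * U m k i"
    and init: "\<And>m i. U m 0 i = cell_avg (N m) u0 i"
  shows "weak_equation T d ds \<sigma> dc \<rho> u0 u w"
  unfolding weak_equation_def
proof (intro allI impI)
  fix \<phi> assume tf: "test_function T \<phi>"
  note T = U.T and N = U.N and NT = U.NT
  let ?wi = "\<lambda>(x, t). weak_integrand d ds \<sigma> dc \<rho> u w \<phi> x t"
  show "set_integrable lebesgue (QT T) ?wi \<and> (LINT z:QT T|lebesgue. ?wi z) = - (LINT x:{0..<1}|lebesgue. u0 x * \<phi> x 0)"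
  proof (rule test_functionE[OF tf T])
    fix T' px pt p1 K assume T': "0 \<le> T'" "T' < T"
      and z: "\<And>x t. t \<in> {T'<..<T} \<Longrightarrow> \<phi> x t = 0"
      and per: "\<And>t. t \<in> {0..<T} \<Longrightarrow> torus_fun (\<lambda>x. \<phi> x t)"
      and c0: "continuous_on (UNIV \<times> {0..<T}) (\<lambda>(x, t). \<phi> x t)"
      and cx: "continuous_on (UNIV \<times> {0..<T}) (\<lambda>(x, t). px x t)"
      and ct: "continuous_on (UNIV \<times> {0..<T}) (\<lambda>(x, t). pt x t)"
      and d1: "\<And>x t. t \<in> {0..<T} \<Longrightarrow> ((\<lambda>y. \<phi> y t) has_real_derivative p1 x t) (at x)"
      and d2: "\<And>x t. t \<in> {0..<T} \<Longrightarrow> ((\<lambda>y. p1 y t) has_real_derivative px x t) (at x)"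
      and dt': "\<And>x t. t \<in> {0<..<T} \<Longrightarrow> ((\<lambda>s. \<phi> x s) has_real_derivative pt x t) (at t)"
      and K: "K \<ge> 0" "\<And>x t. t \<in> {0..<T} \<Longrightarrow> \<bar>\<phi> x t\<bar> \<le> K" "\<And>x t. t \<in> {0..<T} \<Longrightarrow> \<bar>px x t\<bar> \<le> K" "\<And>x t. t \<in> {0<..<T} \<Longrightarrow> \<bar>pt x t\<bar> \<le> K"
    \<comment> \<open>Nodal values of the test function, with value 0 at the final time, where the test function is unspecified.\<close>
    define p where "p m k i = (if real k * dt T (NT m) < T then \<phi> (of_int i * dx (N m)) (real k * dt T (NT m)) else 0)" for m k i
    have dtp: "dt T (NT m) > 0" for m by (rule dt_pos[OF T NT])
    have dxp: "dx (N m) > 0" for m by (rule dx_pos[OF N])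
    have pg: "grid_fun (N m) (p m k)" for m k
    proof (cases "real k * dt T (NT m) < T")
      case True
      then have "real k * dt T (NT m) \<in> {0..<T}" using dtp[of m] by simp
      then have "grid_fun (N m) (\<lambda>i. \<phi> (of_int i * dx (N m)) (real k * dt T (NT m)))"
        by (intro grid_fun_sample[where f="\<lambda>x. \<phi> x (real k * dt T (NT m))"] N torus_fun_plus_int[OF per])
      then show ?thesis using True by (simp add: p_def[abs_def])
    next
      case False then show ?thesis by (simp add: p_def[abs_def] periodic_fun_simple_def)
    qed
    have pT: "p m (NT m) i = 0" for m i using dt_NT[OF NT, of m T] by (simp add: p_def)
    define \<Psi> where "\<Psi> m k i = (p m k i - p m (k - 1) i) / dt T (NT m)" for m k i
    define \<Phi> where "\<Phi> m k i = (p m (k - 1) (i + 1) - 2 * p m (k - 1) i + p m (k - 1) (i - 1)) / (dx (N m))\<^sup>2" for m k i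
    have kd: "real k * dt T (NT m) \<le> T" if "k \<le> NT m" for k m
      using that dtp[of m] dt_NT[OF NT, of m T] mult_right_mono[of "real k" "real (NT m)" "dt T (NT m)"] by simp
    have \<Psi>: "\<exists>\<xi>. (real k - 1) * dt T (NT m) < \<xi> \<and> \<xi> < real k * dt T (NT m) \<and> \<Psi> m k i = pt (of_int i * dx (N m)) \<xi>"
      if k: "k \<in> {1..NT m}" for m k i
    proof -
      have "continuous_on {0..<T} (\<lambda>t. (\<lambda>(x, t). \<phi> x t) (of_int i * dx (N m), t))"
        by (rule continuous_on_compose2[OF c0]) (auto intro!: continuous_intros)
      then have c: "continuous_on {0..<T} (\<lambda>t. \<phi> (of_int i * dx (N m)) t)" by simp
      have ab: "0 \<le> (real k - 1) * dt T (NT m)" "(real k - 1) * dt T (NT m) < real k * dt T (NT m)" "real k * dt T (NT m) \<le> T"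
        using k dtp[of m] kd[of k m] by auto
      have rk: "real (k - 1) = real k - 1" using k by auto
      obtain \<xi> where \<xi>: "(real k - 1) * dt T (NT m) < \<xi>" "\<xi> < real k * dt T (NT m)"
        "p m k i - p m (k - 1) i = (real k * dt T (NT m) - (real k - 1) * dt T (NT m)) * pt (of_int i * dx (N m)) \<xi>"
        using zero_extension_mvt[OF T' z c dt' ab] unfolding p_def rk by blast
      have "\<Psi> m k i = pt (of_int i * dx (N m)) \<xi>" unfolding \<Psi>_def \<xi>(3) using dtp[of m] by (simp add: algebra_simps)
      then show ?thesis using \<xi>(1,2) by blast
    qed
    have \<Phi>: "\<exists>\<xi>. \<bar>\<xi> - of_int i * dx (N m)\<bar> \<le> dx (N m) \<and> \<Phi> m k i = px \<xi> ((real k - 1) * dt T (NT m))"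
      if k: "k \<in> {1..NT m}" for m k i
    proof -
      have rk: "real (k - 1) = real k - 1" using k by auto
      have tau: "(real k - 1) * dt T (NT m) \<in> {0..<T}" using k dtp[of m] kd[of k m] by (auto simp: algebra_simps)
      obtain \<xi> where \<xi>: "\<bar>\<xi> - of_int i * dx (N m)\<bar> \<le> dx (N m)"
        "\<phi> (of_int i * dx (N m) + dx (N m)) ((real k - 1) * dt T (NT m)) - 2 * \<phi> (of_int i * dx (N m)) ((real k - 1) * dt T (NT m))
          + \<phi> (of_int i * dx (N m) - dx (N m)) ((real k - 1) * dt T (NT m)) = (dx (N m))\<^sup>2 * px \<xi> ((real k - 1) * dt T (NT m))"
        using second_difference_mvt[OF d1[OF tau] d2[OF tau] dxp[of m], of "of_int i * dx (N m)"] by blast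
      have "\<Phi> m k i = px \<xi> ((real k - 1) * dt T (NT m))"
        using \<xi>(2) tau dxp[of m] unfolding \<Phi>_def p_def rk by (simp add: algebra_simps)
      then show ?thesis using \<xi>(1) by blast
    qed
    have ktr: "kt T (NT m) t \<in> {1..NT m}" if "t \<in> {0<..<T}" for m t using kt_range[OF T NT, of t m] that by auto
    have ktb: "(real (kt T (NT m) t) - 1) * dt T (NT m) < t" "t \<le> real (kt T (NT m) t) * dt T (NT m)" if "t \<in> {0<..<T}" for m t 
      using kt_bounds[OF T NT, of t m] that by auto
    define hP where "hP m = (\<lambda>(x, t). \<Psi> m (kt T (NT m) t) (ix (N m) x))" for m
    define hQ where "hQ m = (\<lambda>(x, t). \<Phi> m (kt T (NT m) t) (ix (N m) x))" for m
    have mP: "hP m \<in> borel_measurable (PM T)" "hQ m \<in> borel_measurable (PM T)" for m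
      unfolding hP_def hQ_def by (intro borel_measurable_PM step_borel)+
    have mc: "(\<lambda>(x, t). F x t) \<in> borel_measurable (PM T)" if "continuous_on (UNIV \<times> {0..<T}) (\<lambda>(x, t). F x t)" for F :: "real \<Rightarrow> real \<Rightarrow> real"
    proof -
      have "continuous_on (QT T) (\<lambda>(x, t). F x t)" by (rule continuous_on_subset[OF that]) (auto simp: QT_def)
      then have "(\<lambda>z. indicator (QT T) z *\<^sub>R (\<lambda>(x, t). F x t) z) \<in> borel_measurable borel"
        by (rule borel_measurable_continuous_on_indicator[OF QT_borel])
      then show ?thesis unfolding borel_measurable_PM_iff by simp
    qed
    have bP: "\<bar>hP m q\<bar> \<le> K" and bQ: "\<bar>hQ m q\<bar> \<le> K" if qs: "q \<in> space (PM T)" for m q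
    proof -
      obtain x t where q: "q = (x, t)" "t \<in> {0<..<T}" using qs by (auto simp: space_PM QT_def)
      have k: "kt T (NT m) t \<in> {1..NT m}" by (rule ktr[OF q(2)])
      obtain \<xi> where \<xi>: "(real (kt T (NT m) t) - 1) * dt T (NT m) < \<xi>" "\<xi> < real (kt T (NT m) t) * dt T (NT m)"
        "hP m q = pt (of_int (ix (N m) x) * dx (N m)) \<xi>"
        using \<Psi>[OF k, of "ix (N m) x"] unfolding hP_def q(1) prod.case by blast
      have "0 \<le> (real (kt T (NT m) t) - 1) * dt T (NT m)" using k dtp[of m] by auto
      then have "\<xi> \<in> {0<..<T}" using \<xi>(1,2) kd[of "kt T (NT m) t" m] k by auto
      then show "\<bar>hP m q\<bar> \<le> K" unfolding \<xi>(3) by (rule K(4))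
      have "(real (kt T (NT m) t) - 1) * dt T (NT m) \<in> {0..<T}" using k dtp[of m] ktb[OF q(2), of m] q(2) by auto
      then show "\<bar>hQ m q\<bar> \<le> K" using \<Phi>[OF k, of "ix (N m) x"] K(3) unfolding hQ_def q(1) prod.case by metis
    qed
    have lP: "(\<lambda>m. hP m q) \<longlonglongrightarrow> (\<lambda>(x, t). pt x t) q" and lQ: "(\<lambda>m. hQ m q) \<longlonglongrightarrow> (\<lambda>(x, t). px x t) q" if qs: "q \<in> space (PM T)" for q
    proof -
      obtain x t where q: "q = (x, t)" "t \<in> {0<..<T}" using qs by (auto simp: space_PM QT_def)
      have k: "kt T (NT m) t \<in> {1..NT m}" for m by (rule ktr[OF q(2)])
      have k0: "0 \<le> (real (kt T (NT m) t) - 1) * dt T (NT m)" for m using k[of m] dtp[of m] by auto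
      have qT: "q \<in> UNIV \<times> {0..<T}" using q by auto
      have "\<forall>m. \<exists>\<xi>. (real (kt T (NT m) t) - 1) * dt T (NT m) < \<xi> \<and> \<xi> < real (kt T (NT m) t) * dt T (NT m) \<and>
        hP m q = pt (of_int (ix (N m) x) * dx (N m)) \<xi>"
        using \<Psi>[OF k] unfolding hP_def q(1) prod.case by blast
      then obtain \<xi> where \<xi>: "\<And>m. (real (kt T (NT m) t) - 1) * dt T (NT m) < \<xi> m" "\<And>m. \<xi> m < real (kt T (NT m) t) * dt T (NT m)"
        "\<And>m. hP m q = pt (of_int (ix (N m) x) * dx (N m)) (\<xi> m)" by metis
      have \<xi>T: "\<xi> m \<in> {0..<T}" for m
      proof -
        have "real (kt T (NT m) t) * dt T (NT m) \<le> T" using k[of m] by (intro kd) simp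
        then show ?thesis using \<xi>(1,2)[of m] k0[of m] by simp
      qed
      have "\<bar>\<xi> m - t\<bar> \<le> dt T (NT m)" for m using \<xi>(1,2)[of m] ktb[OF q(2), of m] by (simp add: algebra_simps abs_le_iff)
      then have "\<xi> \<longlonglongrightarrow> t" by (rule close_tendsto[OF _ U.dt0 tendsto_const])
      then have "(\<lambda>m. (of_int (ix (N m) x) * dx (N m), \<xi> m)) \<longlonglongrightarrow> q" unfolding q(1) by (intro tendsto_Pair cell_center_tendsto[OF N U.dx0])
      from continuous_on_tendsto_compose[OF ct this qT] show "(\<lambda>m. hP m q) \<longlonglongrightarrow> (\<lambda>(x, t). pt x t) q"
        using \<xi>T by (simp add: \<xi>(3))
      have "\<forall>m. \<exists>\<eta>. \<bar>\<eta> - of_int (ix (N m) x) * dx (N m)\<bar> \<le> dx (N m) \<and> hQ m q = px \<eta> ((real (kt T (NT m) t) - 1) * dt T (NT m))"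
        using \<Phi>[OF k] unfolding hQ_def q(1) prod.case by blast
      then obtain \<eta> where \<eta>: "\<And>m. \<bar>\<eta> m - of_int (ix (N m) x) * dx (N m)\<bar> \<le> dx (N m)"
        "\<And>m. hQ m q = px (\<eta> m) ((real (kt T (NT m) t) - 1) * dt T (NT m))" by metis
      have 1: "\<eta> \<longlonglongrightarrow> x" by (rule close_tendsto[OF \<eta>(1) U.dx0 cell_center_tendsto[OF N U.dx0]])
      have "\<bar>(real (kt T (NT m) t) - 1) * dt T (NT m) - t\<bar> \<le> dt T (NT m)" for m using ktb[OF q(2), of m] by (simp add: algebra_simps abs_le_iff)
      then have 2: "(\<lambda>m. (real (kt T (NT m) t) - 1) * dt T (NT m)) \<longlonglongrightarrow> t" by (rule close_tendsto[OF _ U.dt0 tendsto_const])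
      have "(\<lambda>m. (\<eta> m, (real (kt T (NT m) t) - 1) * dt T (NT m))) \<longlonglongrightarrow> q" unfolding q(1) by (intro tendsto_Pair 1 2)
      moreover have "(real (kt T (NT m) t) - 1) * dt T (NT m) \<in> {0..<T}" for m
        using k0[of m] ktb(1)[OF q(2), of m] q(2) by auto
      ultimately show "(\<lambda>m. hQ m q) \<longlonglongrightarrow> (\<lambda>(x, t). px x t) q"
        using continuous_on_tendsto_compose[OF cx _ qT, of "\<lambda>m. (\<eta> m, (real (kt T (NT m) t) - 1) * dt T (NT m))"] by (simp add: \<eta>(2))
    qed
    define f where "f = (\<lambda>(x, t). (d + ds * torus_conv \<sigma> (\<lambda>y. u y t) x + dc * torus_conv \<rho> (\<lambda>y. w y t) x) * u x t)"
    define fm where "fm m = (\<lambda>(x, t). (\<lambda>k i. mu (N m) d ds \<sigma> dc \<rho> (U m k) (W m k) i * U m k i) (kt T (NT m) t) (ix (N m) x))" for m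
    have fi: "integrable (PM T) (fm m)" "integrable (PM T) f" for m
      unfolding fm_def f_def by (rule flux_limit(1)[OF s r], rule flux_limit(2)[OF s r])
    have fl: "(\<lambda>m. LINT z|PM T. \<bar>fm m z - f z\<bar>) \<longlonglongrightarrow> 0"
      unfolding fm_def f_def by (rule flux_limit(3)[OF s r])
    let ?u = "\<lambda>(x, t). u x t" and ?pt = "\<lambda>(x, t). pt x t" and ?px = "\<lambda>(x, t). px x t"
    note LP = L1_product_limit[OF U.step_integrable u_int u_lim mP(1) mc[OF ct] bP lP]
    note LQ = L1_product_limit[OF fi fl mP(2) mc[OF cx] bQ lQ]
    have sumlim: "(\<lambda>m. (LINT z|PM T. U.step m z * hP m z) + (LINT z|PM T. fm m z * hQ m z)) \<longlonglongrightarrow> (LINT z|PM T. ?u z * ?pt z) + (LINT z|PM T. f z * ?px z)"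
      by (rule tendsto_add[OF LP(2) LQ(2)])
    have disc: "(LINT z|PM T. U.step m z * hP m z) + (LINT z|PM T. fm m z * hQ m z)
      = - (\<Sum>i\<in>{0..<int (N m)}. dx (N m) * cell_avg (N m) u0 i * \<phi> (of_int i * dx (N m)) 0)" for m
    proof -
      have gP: "grid_fun (N m) (\<Psi> m k)" if "k \<in> {1..NT m}" for k
        by standard (simp add: \<Psi>_def grid_fun_plus(1)[OF pg])
      have gQ: "grid_fun (N m) (\<Phi> m k)" if "k \<in> {1..NT m}" for k
      proof
        fix i
        have a: "p m (k-1) (i + int (N m) + 1) = p m (k-1) (i + 1)" "p m (k-1) (i + int (N m) - 1) = p m (k-1) (i - 1)"
          using grid_fun_plus(1)[OF pg, of m "k-1" "i+1"] grid_fun_plus(1)[OF pg, of m "k-1" "i-1"] by (simp_all add: algebra_simps)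
        show "\<Phi> m k (i + int (N m)) = \<Phi> m k i" unfolding \<Phi>_def a grid_fun_plus(1)[OF pg] ..
      qed
      have g1: "grid_fun (N m) (\<lambda>i. U m k i * \<Psi> m k i)" if k: "k \<in> {1..NT m}" for k
        by standard (use k in \<open>simp add: grid_fun_plus(1)[OF gP[OF k]] grid_fun_plus(1)[OF U.U_grid]\<close>)
      have g2: "grid_fun (N m) (\<lambda>i. gU m k i * \<Phi> m k i)" if k: "k \<in> {1..NT m}" for k
        by standard (simp add: grid_fun_plus(1)[OF gQ[OF k]] grid_fun_plus(1)[OF U.g_grid[OF k]])
      have e1: "(\<lambda>z. U.step m z * hP m z) = (\<lambda>(x, t). (\<lambda>k i. U m k i * \<Psi> m k i) (kt T (NT m) t) (ix (N m) x))"
        by (auto simp: hP_def)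
      have e2: "(LINT z|PM T. fm m z * hQ m z) = (LINT (x, t)|PM T. (\<lambda>k i. gU m k i * \<Phi> m k i) (kt T (NT m) t) (ix (N m) x))"
      proof (rule Bochner_Integration.integral_cong[OF refl])
        fix z assume "z \<in> space (PM T)"
        then obtain x t where q: "z = (x, t)" "t \<in> {0<..<T}" by (auto simp: space_PM QT_def)
        show "fm m z * hQ m z = (case z of (x, t) \<Rightarrow> (\<lambda>k i. gU m k i * \<Phi> m k i) (kt T (NT m) t) (ix (N m) x))"
          unfolding fm_def hQ_def q(1) prod.case using gU[OF ktr[OF q(2)]] by simp
      qed
      have s1: "(LINT z|PM T. U.step m z * hP m z) = (\<Sum>k\<in>{1..NT m}. dt T (NT m) * (\<Sum>i\<in>{0..<int (N m)}. dx (N m) * (U m k i * \<Psi> m k i)))"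
        unfolding e1 by (rule PM_step(2)[OF T N NT g1])
      have s2: "(LINT z|PM T. fm m z * hQ m z) = (\<Sum>k\<in>{1..NT m}. dt T (NT m) * (\<Sum>i\<in>{0..<int (N m)}. dx (N m) * (gU m k i * \<Phi> m k i)))"
        unfolding e2 by (rule PM_step(2)[OF T N NT g2])
      have "(LINT z|PM T. U.step m z * hP m z) + (LINT z|PM T. fm m z * hQ m z)
        = (\<Sum>k\<in>{1..NT m}. dt T (NT m) * (\<Sum>i\<in>{0..<int (N m)}. dx (N m) * (U m k i * \<Psi> m k i)))
        + (\<Sum>k\<in>{1..NT m}. dt T (NT m) * (\<Sum>i\<in>{0..<int (N m)}. dx (N m) * (gU m k i * \<Phi> m k i)))"
        unfolding s1 s2 ..
      also have "\<dots> = (\<Sum>k\<in>{1..NT m}. dt T (NT m) * (\<Sum>i\<in>{0..<int (N m)}. dx (N m) * (U m k i * \<Psi> m k i + gU m k i * \<Phi> m k i)))"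
        by (simp only: sum.distrib distrib_left)
      also have "\<dots> = - (\<Sum>i\<in>{0..<int (N m)}. dx (N m) * U m 0 i * p m 0 i)"
        unfolding \<Psi>_def \<Phi>_def by (rule U.discrete_weak_form[where p="p m", OF pg pT])
      finally show ?thesis using T by (simp add: init p_def)
    qed
    have init_lim: "(\<lambda>m. \<Sum>i\<in>{0..<int (N m)}. dx (N m) * cell_avg (N m) u0 i * \<phi> (of_int i * dx (N m)) 0) \<longlonglongrightarrow> (LINT x:{0..<1}|lebesgue. u0 x * \<phi> x 0)"
    proof (rule U.initial_term_limit[OF u0])
      show "torus_fun (\<lambda>x. \<phi> x 0)" using T by (intro per) simp
      have "continuous_on UNIV (\<lambda>x. (\<lambda>(x, t). \<phi> x t) (x, 0))"
        by (rule continuous_on_compose2[OF c0]) (use T in \<open>auto intro!: continuous_intros\<close>)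
      then show "continuous_on UNIV (\<lambda>x. \<phi> x 0)" by simp
      show "\<bar>\<phi> x 0\<bar> \<le> K" for x using T by (intro K(2)) simp
    qed
    have eq: "(LINT z|PM T. ?u z * ?pt z) + (LINT z|PM T. f z * ?px z) = - (LINT x:{0..<1}|lebesgue. u0 x * \<phi> x 0)"
      by (rule LIMSEQ_unique[OF sumlim]) (unfold disc, rule tendsto_minus[OF init_lim])
    have wi: "?wi z = ?u z * ?pt z + f z * ?px z" if qs: "z \<in> space (PM T)" for z
    proof -
      obtain x t where q: "z = (x, t)" "t \<in> {0<..<T}" using qs by (auto simp: space_PM QT_def)
      then have t0: "t \<in> {0..<T}" by auto
      have 1: "deriv (\<lambda>s. \<phi> x s) t = pt x t" by (rule DERIV_imp_deriv[OF dt'[OF q(2)]])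
      have "deriv (\<lambda>y. \<phi> y t) = (\<lambda>y. p1 y t)" using DERIV_imp_deriv[OF d1[OF t0]] by auto
      then have 2: "deriv (deriv (\<lambda>y. \<phi> y t)) x = px x t" using DERIV_imp_deriv[OF d2[OF t0]] by simp
      show ?thesis unfolding q(1) prod.case weak_integrand_def 1 2 f_def by (simp add: algebra_simps)
    qed
    have isum: "integrable (PM T) (\<lambda>z. ?u z * ?pt z + f z * ?px z)"
      by (rule Bochner_Integration.integrable_add[OF LP(1) LQ(1)])
    have iw: "integrable (PM T) ?wi" using isum wi by (subst Bochner_Integration.integrable_cong[OF refl, of _ ?wi "\<lambda>z. ?u z * ?pt z + f z * ?px z"]) auto
    have mw: "?wi \<in> borel_measurable (PM T)" using iw by (rule borel_measurable_integrable)
    have "(LINT z:QT T|lebesgue. ?wi z) = (LINT z|PM T. ?wi z)" by (rule set_integral_QT[OF mw])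
    also have "\<dots> = (LINT z|PM T. ?u z * ?pt z + f z * ?px z)"
      by (rule Bochner_Integration.integral_cong[OF refl wi])
    also have "\<dots> = (LINT z|PM T. ?u z * ?pt z) + (LINT z|PM T. f z * ?px z)"
      by (rule Bochner_Integration.integral_add[OF LP(1) LQ(1)])
    finally have "(LINT z:QT T|lebesgue. ?wi z) = - (LINT x:{0..<1}|lebesgue. u0 x * \<phi> x 0)" unfolding eq .
    moreover have "set_integrable lebesgue (QT T) ?wi" using iw set_integrable_QT[OF mw] by simp
    ultimately show "set_integrable lebesgue (QT T) ?wi \<and> (LINT z:QT T|lebesgue. ?wi z) = - (LINT x:{0..<1}|lebesgue. u0 x * \<phi> x 0)" by blast
  qed
qed

end

section \<open>Uniform bounds for the scheme and conclusion\<close>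

text \<open>
  A bound on the dissipation of the square roots bounds the total variation in \<open>L\<^sup>2\<close> in time, hence in \<open>L\<^sup>1\<close>. As a
  grid function is at most its mean plus its total variation, \<open>v\<^sup>3 \<le> 2 (M\<^sup>2 + TV\<^sup>2) v\<close>, which is summable
  by conservation of mass.
\<close>

lemma species_bounds:
  assumes T: "T > 0" and N: "N \<ge> 1" and NT: "NT \<ge> 1"
    and grid: "\<And>k. k \<in> {1..NT} \<Longrightarrow> grid_fun N (v k)" and pos: "\<And>k i. k \<in> {1..NT} \<Longrightarrow> v k i \<ge> 0"
    and mass: "\<And>k. k \<in> {1..NT} \<Longrightarrow> (\<Sum>i\<in>{0..<int N}. dx N * v k i) = M" and M0: "M \<ge> 0"
    and Q: "(\<Sum>k\<in>{1..NT}. dt T NT * grid_H1_sq N (\<lambda>i. sqrt (v k i))) \<le> Q"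
  shows "(\<Sum>k\<in>{1..NT}. dt T NT * TV N (v k)) \<le> T + 4 * M * Q"
    and "(\<Sum>k\<in>{1..NT}. dt T NT * (\<Sum>i\<in>{0..<int N}. dx N * \<bar>v k i\<bar> ^ 3)) \<le> 2 * M * (M\<^sup>2 * T + 4 * M * Q)"
proof -
  note t = dt_pos[OF T NT] and d = dx_pos[OF N]
  have sT: "(\<Sum>k\<in>{1..NT}. dt T NT) = T" using NT by (simp add: dt_def)
  have TV2: "(\<Sum>k\<in>{1..NT}. dt T NT * (TV N (v k))\<^sup>2) \<le> 4 * M * Q"
  proof -
    have "(\<Sum>k\<in>{1..NT}. dt T NT * (TV N (v k))\<^sup>2) \<le> (\<Sum>k\<in>{1..NT}. 4 * M * (dt T NT * grid_H1_sq N (\<lambda>i. sqrt (v k i))))"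
    proof (rule sum_mono)
      fix k assume k: "k \<in> {1..NT}"
      have "(TV N (v k))\<^sup>2 \<le> 4 * M * grid_H1_sq N (\<lambda>i. sqrt (v k i))"
        by (rule TV_square_le[OF grid[OF k] N mass[OF k] pos[OF k]])
      from mult_left_mono[OF this, of "dt T NT"] t
      show "dt T NT * (TV N (v k))\<^sup>2 \<le> 4 * M * (dt T NT * grid_H1_sq N (\<lambda>i. sqrt (v k i)))" by (simp add: mult_ac)
    qed
    also have "\<dots> = 4 * M * (\<Sum>k\<in>{1..NT}. dt T NT * grid_H1_sq N (\<lambda>i. sqrt (v k i)))" by (simp only: sum_distrib_left)
    also have "\<dots> \<le> 4 * M * Q" using Q M0 by (intro mult_left_mono) auto
    finally show ?thesis .
  qed
  have "(\<Sum>k\<in>{1..NT}. dt T NT * TV N (v k)) \<le> (\<Sum>k\<in>{1..NT}. dt T NT + dt T NT * (TV N (v k))\<^sup>2)"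
  proof (rule sum_mono)
    fix k
    \<comment> \<open>\<open>TV \<le> 1 + TV\<^sup>2\<close> passes from \<open>L\<^sup>2\<close> to \<open>L\<^sup>1\<close> in time.\<close>
    have "0 \<le> (TV N (v k) - 1)\<^sup>2" "0 \<le> TV N (v k)" by (simp_all add: TV_nonneg)
    then have "TV N (v k) \<le> 1 + (TV N (v k))\<^sup>2" by (simp add: power2_diff)
    from mult_left_mono[OF this, of "dt T NT"] t
    show "dt T NT * TV N (v k) \<le> dt T NT + dt T NT * (TV N (v k))\<^sup>2" by (simp add: distrib_left)
  qed
  also have "\<dots> \<le> T + 4 * M * Q" using TV2 by (simp only: sum.distrib sT)
  finally show "(\<Sum>k\<in>{1..NT}. dt T NT * TV N (v k)) \<le> T + 4 * M * Q" .
  have "(\<Sum>k\<in>{1..NT}. dt T NT * (\<Sum>i\<in>{0..<int N}. dx N * \<bar>v k i\<bar> ^ 3)) \<le> (\<Sum>k\<in>{1..NT}. 2 * M * (M\<^sup>2 * dt T NT + dt T NT * (TV N (v k))\<^sup>2))"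
  proof (rule sum_mono)
    fix k assume k: "k \<in> {1..NT}"
    have c: "\<bar>v k i\<bar> ^ 3 \<le> 2 * (M\<^sup>2 + (TV N (v k))\<^sup>2) * v k i" for i
    proof -
      have "v k i \<le> M + TV N (v k)" by (rule le_mean_plus_TV[OF grid[OF k] N mass[OF k]])
      then have "(v k i)\<^sup>2 \<le> (M + TV N (v k))\<^sup>2" using pos[OF k] by (intro power_mono) auto
      also have "\<dots> \<le> 2 * (M\<^sup>2 + (TV N (v k))\<^sup>2)" using sum_squares_bound[of M "TV N (v k)"] by (simp add: power2_sum)
      finally have "(v k i)\<^sup>2 * v k i \<le> 2 * (M\<^sup>2 + (TV N (v k))\<^sup>2) * v k i" using pos[OF k] by (intro mult_right_mono) auto
      then show ?thesis using pos[OF k, of i] by (simp add: power3_eq_cube power2_eq_square)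
    qed
    have "(\<Sum>i\<in>{0..<int N}. dx N * \<bar>v k i\<bar> ^ 3) \<le> (\<Sum>i\<in>{0..<int N}. 2 * (M\<^sup>2 + (TV N (v k))\<^sup>2) * (dx N * v k i))"
    proof (rule sum_mono)
      fix i from mult_left_mono[OF c[of i], of "dx N"] d
      show "dx N * \<bar>v k i\<bar> ^ 3 \<le> 2 * (M\<^sup>2 + (TV N (v k))\<^sup>2) * (dx N * v k i)" by (simp add: mult_ac)
    qed
    also have "\<dots> = 2 * (M\<^sup>2 + (TV N (v k))\<^sup>2) * M" by (subst sum_distrib_left[symmetric]) (simp only: mass[OF k])
    finally have "(\<Sum>i\<in>{0..<int N}. dx N * \<bar>v k i\<bar> ^ 3) \<le> 2 * (M\<^sup>2 + (TV N (v k))\<^sup>2) * M" .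
    from mult_left_mono[OF this, of "dt T NT"] t
    show "dt T NT * (\<Sum>i\<in>{0..<int N}. dx N * \<bar>v k i\<bar> ^ 3) \<le> 2 * M * (M\<^sup>2 * dt T NT + dt T NT * (TV N (v k))\<^sup>2)"
      by (simp add: algebra_simps)
  qed
  also have "\<dots> = 2 * M * (M\<^sup>2 * T + (\<Sum>k\<in>{1..NT}. dt T NT * (TV N (v k))\<^sup>2))"
    by (simp only: sum_distrib_left[symmetric] sum.distrib sT)
  also have "\<dots> \<le> 2 * M * (M\<^sup>2 * T + 4 * M * Q)" using TV2 M0 by (intro mult_left_mono) auto
  finally show "(\<Sum>k\<in>{1..NT}. dt T NT * (\<Sum>i\<in>{0..<int N}. dx N * \<bar>v k i\<bar> ^ 3)) \<le> 2 * M * (M\<^sup>2 * T + 4 * M * Q)" .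
qed

lemma species_discrete_family:
  fixes N NT :: "nat \<Rightarrow> nat" and U W :: "nat \<Rightarrow> nat \<Rightarrow> int \<Rightarrow> real"
  assumes T: "T > 0" and N: "\<And>m. N m \<ge> 1" and NT: "\<And>m. NT m \<ge> 1"
    and dx0: "(\<lambda>m. dx (N m)) \<longlonglongrightarrow> 0" and dt0: "(\<lambda>m. dt T (NT m)) \<longlonglongrightarrow> 0"
    and co: "d > 0" "ds \<ge> 0" "dc > 0"
    and s: "Linf_torus \<sigma>" "AE x in lebesgue. \<sigma> x \<ge> 0" and r: "Linf_torus \<rho>" "AE x in lebesgue. \<rho> x \<ge> 0"
    and sch: "\<And>m. scheme_species T (N m) (NT m) d ds \<sigma> dc \<rho> u0 (U m) (W m)"
    and Upos: "\<And>m k i. k \<le> NT m \<Longrightarrow> U m k i \<ge> 0" and Wpos: "\<And>m k i. k \<le> NT m \<Longrightarrow> W m k i \<ge> 0"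
    and Um: "\<And>m. mass_conserved (N m) (NT m) u0 (U m)" and Wm: "\<And>m. mass_conserved (N m) (NT m) w0 (W m)"
    and Q: "\<And>m. (\<Sum>k\<in>{1..NT m}. dt T (NT m) * grid_H1_sq (N m) (\<lambda>i. sqrt (U m k i))) \<le> Q"
  defines "M \<equiv> LINT x:{0..<1}|lebesgue. u0 x"
  shows "\<exists>E. discrete_family T N NT U (\<lambda>m k i. mu (N m) d ds \<sigma> dc \<rho> (U m k) (W m k) i * U m k i) M (T + 4 * M * Q) E"
    and "\<And>m. (\<Sum>k\<in>{1..NT m}. dt T (NT m) * (\<Sum>i\<in>{0..<int (N m)}. dx (N m) * \<bar>U m k i\<bar> ^ 3)) \<le> 2 * M * (M\<^sup>2 * T + 4 * M * Q)"
proof -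
  define M' where "M' = (LINT x:{0..<1}|lebesgue. w0 x)"
  have grid: "grid_fun (N m) (U m k)" if "k \<le> NT m" for m k using sch that unfolding scheme_species_def by blast
  have mass: "(\<Sum>i\<in>{0..<int (N m)}. dx (N m) * U m k i) = M" if "k \<le> NT m" for m k
    using Um that unfolding mass_conserved_def M_def by blast
  have massW: "(\<Sum>i\<in>{0..<int (N m)}. dx (N m) * W m k i) = M'" if "k \<le> NT m" for m k
    using Wm that unfolding mass_conserved_def M'_def by blast
  have dxp: "dx (N m) > 0" and dtp: "dt T (NT m) > 0" for m using dx_pos[OF N] dt_pos[OF T NT] by blast+
  have M0: "M \<ge> 0" unfolding mass[OF le0, symmetric, of 0] using dxp[of 0] Upos[OF le0, of 0] by (intro sum_nonneg) auto
  have b: "\<And>m. (\<Sum>k\<in>{1..NT m}. dt T (NT m) * TV (N m) (U m k)) \<le> T + 4 * M * Q"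
    "\<And>m. (\<Sum>k\<in>{1..NT m}. dt T (NT m) * (\<Sum>i\<in>{0..<int (N m)}. dx (N m) * \<bar>U m k i\<bar> ^ 3)) \<le> 2 * M * (M\<^sup>2 * T + 4 * M * Q)"
    by (rule species_bounds(1)[OF T N NT _ _ _ M0 Q]; use grid Upos mass in auto)
       (rule species_bounds(2)[OF T N NT _ _ _ M0 Q]; use grid Upos mass in auto)
  show "\<And>m. (\<Sum>k\<in>{1..NT m}. dt T (NT m) * (\<Sum>i\<in>{0..<int (N m)}. dx (N m) * \<bar>U m k i\<bar> ^ 3)) \<le> 2 * M * (M\<^sup>2 * T + 4 * M * Q)" by (rule b(2))
  obtain Cs where Cs: "AE x in lebesgue. \<bar>\<sigma> x\<bar> \<le> Cs" using s by (auto simp: Linf_torus_def)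
  obtain Cr where Cr: "AE x in lebesgue. \<bar>\<rho> x\<bar> \<le> Cr" using r by (auto simp: Linf_torus_def)
  define Cm where "Cm = d + ds * (Cs * M) + dc * (Cr * M')"
  have mu: "0 \<le> mu (N m) d ds \<sigma> dc \<rho> (U m k) (W m k) i" "mu (N m) d ds \<sigma> dc \<rho> (U m k) (W m k) i \<le> Cm" if k: "k \<le> NT m" for m k i
  proof -
    note gs = grid_conv_bounds[OF N cell_avg_bounds[OF N s Cs] Upos[OF k] mass[OF k]]
    note gr = grid_conv_bounds[OF N cell_avg_bounds[OF N r Cr] Wpos[OF k] massW[OF k]]
    show "0 \<le> mu (N m) d ds \<sigma> dc \<rho> (U m k) (W m k) i" unfolding mu_def using co gs(1)[where i=i] gr(1)[where i=i] by simp
    show "mu (N m) d ds \<sigma> dc \<rho> (U m k) (W m k) i \<le> Cm" unfolding mu_def Cm_def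
      using co by (intro add_mono mult_left_mono gs(2) gr(2) order_refl) auto
  qed
  have "discrete_family T N NT U (\<lambda>m k i. mu (N m) d ds \<sigma> dc \<rho> (U m k) (W m k) i * U m k i) M (T + 4 * M * Q) (Cm * M)"
  proof (rule discrete_family.intro[OF T N NT dx0 dt0 grid _ Upos mass b(1)])
    fix m k assume k: "k \<in> {1..NT m}"
    then have k': "k \<le> NT m" by simp
    show "grid_fun (N m) (\<lambda>i. mu (N m) d ds \<sigma> dc \<rho> (U m k) (W m k) i * U m k i)"
    proof
      fix i
      have "torus_fun \<sigma>" "torus_fun \<rho>" using s r by (auto simp: Linf_torus_def)
      note per = grid_conv_grid_fun[OF cell_avg_grid_fun[OF N[of m] this(1)], of "U m k"]
        grid_conv_grid_fun[OF cell_avg_grid_fun[OF N[of m] this(2)], of "W m k"]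
      show "mu (N m) d ds \<sigma> dc \<rho> (U m k) (W m k) (i + int (N m)) * U m k (i + int (N m)) = mu (N m) d ds \<sigma> dc \<rho> (U m k) (W m k) i * U m k i"
        unfolding mu_def by (simp only: grid_fun_plus(1)[OF per(1)] grid_fun_plus(1)[OF per(2)] grid_fun_plus(1)[OF grid[OF k']])
    qed
    show "0 \<le> mu (N m) d ds \<sigma> dc \<rho> (U m k) (W m k) i * U m k i" for i
      using mu(1)[OF k'] Upos[OF k'] by simp
    show "U m k i - U m (k - 1) i = dt T (NT m) / (dx (N m))\<^sup>2 *
        (mu (N m) d ds \<sigma> dc \<rho> (U m k) (W m k) (i + 1) * U m k (i + 1) - 2 * (mu (N m) d ds \<sigma> dc \<rho> (U m k) (W m k) i * U m k i)
         + mu (N m) d ds \<sigma> dc \<rho> (U m k) (W m k) (i - 1) * U m k (i - 1))" for i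
    proof -
      have "(U m k i - U m (k - 1) i) / dt T (NT m) = (mu (N m) d ds \<sigma> dc \<rho> (U m k) (W m k) (i + 1) * U m k (i + 1)
          - 2 * mu (N m) d ds \<sigma> dc \<rho> (U m k) (W m k) i * U m k i
         + mu (N m) d ds \<sigma> dc \<rho> (U m k) (W m k) (i - 1) * U m k (i - 1)) / (dx (N m))\<^sup>2"
        using sch[of m] k unfolding scheme_species_def Let_def by simp
      then have "U m k i - U m (k - 1) i = dt T (NT m) * ((mu (N m) d ds \<sigma> dc \<rho> (U m k) (W m k) (i + 1) * U m k (i + 1)
          - 2 * mu (N m) d ds \<sigma> dc \<rho> (U m k) (W m k) i * U m k i
         + mu (N m) d ds \<sigma> dc \<rho> (U m k) (W m k) (i - 1) * U m k (i - 1)) / (dx (N m))\<^sup>2)"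
        using dtp[of m] by (simp add: nonzero_divide_eq_eq mult.commute)
      then show ?thesis by (simp add: mult.assoc)
    qed
    have "(\<Sum>i\<in>{0..<int (N m)}. dx (N m) * (mu (N m) d ds \<sigma> dc \<rho> (U m k) (W m k) i * U m k i)) \<le> (\<Sum>i\<in>{0..<int (N m)}. Cm * (dx (N m) * U m k i))"
    proof (rule sum_mono)
      fix i
      have "mu (N m) d ds \<sigma> dc \<rho> (U m k) (W m k) i * (dx (N m) * U m k i) \<le> Cm * (dx (N m) * U m k i)"
        using mu(2)[OF k'] Upos[OF k'] dxp[of m] by (intro mult_right_mono) auto
      then show "dx (N m) * (mu (N m) d ds \<sigma> dc \<rho> (U m k) (W m k) i * U m k i) \<le> Cm * (dx (N m) * U m k i)" by (simp only: mult_ac)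
    qed
    also have "\<dots> = Cm * M" by (subst sum_distrib_left[symmetric]) (simp only: mass[OF k'])
    finally show "(\<Sum>i\<in>{0..<int (N m)}. dx (N m) * (mu (N m) d ds \<sigma> dc \<rho> (U m k) (W m k) i * U m k i)) \<le> Cm * M" .
  qed
  then show "\<exists>E. discrete_family T N NT U (\<lambda>m k i. mu (N m) d ds \<sigma> dc \<rho> (U m k) (W m k) i * U m k i) M (T + 4 * M * Q) E" by blast
qed

lemma dissipation_bounds:
  assumes N: "N \<ge> 1" and co: "d11 \<ge> 0" "d22 \<ge> 0" "d1 > 0" "d2 > 0" "d12 > 0" "d21 > 0"
    and k: "Linf_torus \<rho>" "Linf_torus \<sigma>1" "Linf_torus \<sigma>2"
    and pos: "AE x in lebesgue. \<rho> x \<ge> 0" "AE x in lebesgue. \<sigma>1 x \<ge> 0" "AE x in lebesgue. \<sigma>2 x \<ge> 0"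
  shows "4 * (d1 / d12) * grid_H1_sq N (\<lambda>i. sqrt (v i)) \<le> dissipation N d1 d2 d11 d12 d21 d22 \<rho> \<sigma>1 \<sigma>2 v w"
    and "4 * (d2 / d21) * grid_H1_sq N (\<lambda>i. sqrt (w i)) \<le> dissipation N d1 d2 d11 d12 d21 d22 \<rho> \<sigma>1 \<sigma>2 v w"
proof -
  have "0 \<le> 2 * (d11 / d12) * nonlocal_dissip N \<sigma>1 v v" "0 \<le> 2 * (d22 / d21) * nonlocal_dissip N \<sigma>2 w w" "0 \<le> 4 * nonlocal_dissip N \<rho> v w"
    "0 \<le> 4 * (d1 / d12) * grid_H1_sq N (\<lambda>i. sqrt (v i))" "0 \<le> 4 * (d2 / d21) * grid_H1_sq N (\<lambda>i. sqrt (w i))"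
    using co nonlocal_dissip_nonneg[OF N k(1) pos(1)] nonlocal_dissip_nonneg[OF N k(2) pos(2)] nonlocal_dissip_nonneg[OF N k(3) pos(3)]
      grid_H1_sq_nonneg[OF N] by simp_all
  then show "4 * (d1 / d12) * grid_H1_sq N (\<lambda>i. sqrt (v i)) \<le> dissipation N d1 d2 d11 d12 d21 d22 \<rho> \<sigma>1 \<sigma>2 v w"
    "4 * (d2 / d21) * grid_H1_sq N (\<lambda>i. sqrt (w i)) \<le> dissipation N d1 d2 d11 d12 d21 d22 \<rho> \<sigma>1 \<sigma>2 v w"
    unfolding dissipation_def by linarith+
qed

lemma state_fun_limit:
  assumes "\<forall>t\<in>{0<..<T}. torus_fun (\<lambda>x. u x t)" "(\<lambda>(x, t). u x t) \<in> borel_measurable borel" "\<forall>x t. u x t \<ge> 0"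
    and i: "integrable (PM T) (\<lambda>(x, t). u x t)"
  shows "state_fun T u"
proof -
  interpret pair_sigma_finite XM "YM T" by (rule pair_XY)
  have "AE t in YM T. integrable XM (\<lambda>x. u x t)" using AE_integrable_snd[of u] i unfolding PM_def by simp
  then have "AE t in lborel. t \<in> {0<..<T} \<longrightarrow> integrable XM (\<lambda>x. u x t)"
    unfolding YM_def by (subst (asm) AE_restrict_space_iff) auto
  then have "AE t in lebesgue. t \<in> {0<..<T} \<longrightarrow> integrable XM (\<lambda>x. u x t)" by (rule AE_completion)
  then have "AE t in lebesgue. t \<in> {0<..<T} \<longrightarrow> set_integrable lebesgue {0..<1} (\<lambda>x. u x t)"
    by eventually_elim (metis set_integrable_XM borel_measurable_integrable)
  then show ?thesis unfolding state_fun_def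
    using assms set_borel_measurable_QT[OF borel_measurable_PM] by blast
qed

theorem theorem3:
  fixes d1 d2 d11 d12 d21 d22 T :: real
    and \<rho>1 \<rho>2 \<sigma>1 \<sigma>2 u10 u20 :: "real \<Rightarrow> real"
    and N NT :: "nat \<Rightarrow> nat"
    and U1 U2 :: "nat \<Rightarrow> nat \<Rightarrow> int \<Rightarrow> real"
  assumes "d11 \<ge> 0" "d22 \<ge> 0" "d1 > 0" "d2 > 0" "d12 > 0" "d21 > 0"
    and "Linf_torus \<rho>1" "Linf_torus \<rho>2" "Linf_torus \<sigma>1" "Linf_torus \<sigma>2"
    and "AE x in lebesgue. \<rho>1 x \<ge> 0" "AE x in lebesgue. \<rho>2 x \<ge> 0"
    and "AE x in lebesgue. \<sigma>1 x \<ge> 0" "AE x in lebesgue. \<sigma>2 x \<ge> 0"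
    and "AE x in lebesgue. \<rho>1 x = \<rho>2 (- x)"
    and "AE x in lebesgue. \<sigma>1 x = \<sigma>1 (- x)" "AE x in lebesgue. \<sigma>2 x = \<sigma>2 (- x)"
    and "L1_torus u10" "L1_torus u20"
    and "AE x in lebesgue. u10 x \<ge> 0" "AE x in lebesgue. u20 x \<ge> 0"
    and "L1_torus (\<lambda>x. h d12 (u10 x))" "L1_torus (\<lambda>x. h d21 (u20 x))"
    and "T > 0"
    and "\<And>m. N m \<ge> 1" "\<And>m. NT m \<ge> 1"
    and "(\<lambda>m. max (dx (N m)) (dt T (NT m))) \<longlonglongrightarrow> 0"
    and "\<And>m. scheme_solution T (N m) (NT m) d1 d2 d11 d12 d21 d22 \<rho>1 \<rho>2 \<sigma>1 \<sigma>2 u10 u20 (U1 m) (U2 m)"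
    and "\<And>m k i. k \<le> NT m \<Longrightarrow> U1 m k i \<ge> 0" "\<And>m k i. k \<le> NT m \<Longrightarrow> U2 m k i \<ge> 0"
    and "\<And>m. mass_conserved (N m) (NT m) u10 (U1 m)" "\<And>m. mass_conserved (N m) (NT m) u20 (U2 m)"
    and "\<And>m. entropy_inequality T (N m) (NT m) d1 d2 d11 d12 d21 d22 \<rho>1 \<sigma>1 \<sigma>2 (U1 m) (U2 m)"
  shows "\<exists>u1 u2 (r :: nat \<Rightarrow> nat).
     strict_mono r \<and>
     distributional_solution T d1 d2 d11 d12 d21 d22 \<rho>1 \<rho>2 \<sigma>1 \<sigma>2 u10 u20 u1 u2 \<and>
     (\<forall>p. 1 \<le> p \<and> p < 3 \<longrightarrow>
        in_Lp p (QT T) (\<lambda>(x, t). u1 x t) \<and> in_Lp p (QT T) (\<lambda>(x, t). u2 x t) \<and>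
        Lp_converges p (QT T)
          (\<lambda>m (x, t). reconstruction T (N (r m)) (NT (r m)) (U1 (r m)) x t) (\<lambda>(x, t). u1 x t) \<and>
        Lp_converges p (QT T)
          (\<lambda>m (x, t). reconstruction T (N (r m)) (NT (r m)) (U2 (r m)) x t) (\<lambda>(x, t). u2 x t))"
proof -
  note co = assms(1-6) and ker = assms(7-10) and kpos = assms(11-14) and data = assms(18,19) and dpos = assms(20,21) and hdata = assms(22,23)
  note T = assms(24) and N = assms(25) and NT = assms(26) and mesh = assms(27) and sol = assms(28)
    and pos1 = assms(29) and pos2 = assms(30) and mass1 = assms(31) and mass2 = assms(32) and ent = assms(33)
  have dtp: "dt T (NT m) > 0" and dxp: "dx (N m) > 0" for m using dt_pos[OF T NT] dx_pos[OF N] by blast+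
  have dx0: "(\<lambda>m. dx (N m)) \<longlonglongrightarrow> 0" 
    by (rule Lim_null_comparison[OF always_eventually mesh]) (use dxp in \<open>auto simp: less_imp_le\<close>)
  have dt0: "(\<lambda>m. dt T (NT m)) \<longlonglongrightarrow> 0" 
    by (rule Lim_null_comparison[OF always_eventually mesh]) (use dtp in \<open>auto simp: less_imp_le\<close>)
  have sch1: "scheme_species T (N m) (NT m) d1 d11 \<sigma>1 d12 \<rho>1 u10 (U1 m) (U2 m)" 
    and sch2: "scheme_species T (N m) (NT m) d2 d22 \<sigma>2 d21 \<rho>2 u20 (U2 m) (U1 m)" for m
    using sol[of m] by (simp_all add: scheme_solution_def)
  have init1: "U1 m 0 i = cell_avg (N m) u10 i" and init2: "U2 m 0 i = cell_avg (N m) u20 i" for m i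
    using sch1[of m] sch2[of m] by (simp_all add: scheme_species_def)
  define C0 where "C0 = ((LINT x:{0..<1}|lebesgue. h d12 (u10 x)) + 1 / d12) + ((LINT x:{0..<1}|lebesgue. h d21 (u20 x)) + 1 / d21)"
  define Dm where "Dm m k = dissipation (N m) d1 d2 d11 d12 d21 d22 \<rho>1 \<sigma>1 \<sigma>2 (U1 m k) (U2 m k)" for m k
  have diss: "(\<Sum>k\<in>{1..NT m}. dt T (NT m) * Dm m k) \<le> C0" for m
  proof -
    have e0: "entropy (N m) d12 d21 (U1 m 0) (U2 m 0) \<le> C0"
    proof -
      have a: "0 \<le> cell_avg (N m) u10 i" "0 \<le> cell_avg (N m) u20 i" for i
        using pos1[OF le0, of m i] pos2[OF le0, of m i] by (simp_all add: init1 init2)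
      show ?thesis unfolding entropy_def C0_def init1 init2
        by (intro add_mono initial_entropy_bound[OF co(5) N data(1) dpos(1) hdata(1) a(1)] initial_entropy_bound[OF co(6) N data(2) dpos(2) hdata(2) a(2)])
    qed
    have "0 \<le> entropy (N m) d12 d21 (U1 m (NT m)) (U2 m (NT m))"
      unfolding entropy_def using dxp[of m] h_nonneg[OF co(5)] h_nonneg[OF co(6)] pos1[of "NT m" m] pos2[of "NT m" m]
      by (intro add_nonneg_nonneg sum_nonneg mult_nonneg_nonneg) (auto simp: less_imp_le)
    then show ?thesis using sum_dissipation[OF ent order_refl, of m] e0 unfolding Dm_def by linarith
  qed
  define Q1 where "Q1 = C0 / (4 * (d1 / d12))"
  define Q2 where "Q2 = C0 / (4 * (d2 / d21))"
  note db = dissipation_bounds[OF N co ker(1) ker(3) ker(4) kpos(1) kpos(3) kpos(4)]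
  have gen: "(\<Sum>k\<in>{1..NT m}. dt T (NT m) * G k) \<le> C0 / c" if c: "c > 0" and G: "\<And>k. c * G k \<le> Dm m k" for m c and G :: "nat \<Rightarrow> real"
  proof -
    have "c * (\<Sum>k\<in>{1..NT m}. dt T (NT m) * G k) = (\<Sum>k\<in>{1..NT m}. dt T (NT m) * (c * G k))"
      by (simp add: sum_distrib_left mult_ac)
    also have "\<dots> \<le> (\<Sum>k\<in>{1..NT m}. dt T (NT m) * Dm m k)"
      using G dtp[of m] by (intro sum_mono mult_left_mono) auto
    also have "\<dots> \<le> C0" by (rule diss)
    finally show ?thesis using c by (simp add: field_simps)
  qed
  have Q1: "(\<Sum>k\<in>{1..NT m}. dt T (NT m) * grid_H1_sq (N m) (\<lambda>i. sqrt (U1 m k i))) \<le> Q1" for m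
    unfolding Q1_def by (rule gen) (use co db(1) in \<open>auto simp: Dm_def\<close>)
  have Q2: "(\<Sum>k\<in>{1..NT m}. dt T (NT m) * grid_H1_sq (N m) (\<lambda>i. sqrt (U2 m k i))) \<le> Q2" for m
    unfolding Q2_def by (rule gen) (use co db(2) in \<open>auto simp: Dm_def\<close>)
  note fam1 = species_discrete_family[OF T N NT dx0 dt0 co(3) co(1) co(5) ker(3) kpos(3) ker(1) kpos(1) sch1 pos1 pos2 mass1 mass2 Q1]
  note fam2 = species_discrete_family[OF T N NT dx0 dt0 co(4) co(2) co(6) ker(4) kpos(4) ker(2) kpos(2) sch2 pos2 pos1 mass2 mass1 Q2]
  define g1 where "g1 m k i = mu (N m) d1 d11 \<sigma>1 d12 \<rho>1 (U1 m k) (U2 m k) i * U1 m k i" for m k i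
  define g2 where "g2 m k i = mu (N m) d2 d22 \<sigma>2 d21 \<rho>2 (U2 m k) (U1 m k) i * U2 m k i" for m k i
  obtain M1 B1 E1 where F1: "discrete_family T N NT U1 g1 M1 B1 E1" using fam1(1) unfolding g1_def[abs_def] by blast
  obtain M2 B2 E2 where F2: "discrete_family T N NT U2 g2 M2 B2 E2" using fam2(1) unfolding g2_def[abs_def] by blast
  interpret F1: discrete_family T N NT U1 g1 M1 B1 E1 by (rule F1)
  interpret F2: discrete_family T N NT U2 g2 M2 B2 E2 by (rule F2)
  obtain C1 where C1: "\<And>m. (LINT z|PM T. \<bar>F1.step m z\<bar> ^ 3) \<le> C1" using fam1(2) unfolding F1.step_cube(2) by blast
  obtain C2 where C2: "\<And>m. (LINT z|PM T. \<bar>F2.step m z\<bar> ^ 3) \<le> C2" using fam2(2) unfolding F2.step_cube(2) by blast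
  obtain r1 u1 where r1: "strict_mono (r1::nat\<Rightarrow>nat)" and u1: "(\<lambda>(x, t). u1 x t) \<in> borel_measurable borel"
    "\<forall>t\<in>{0<..<T}. torus_fun (\<lambda>x. u1 x t)" "\<forall>x t. u1 x t \<ge> (0::real)" "integrable (PM T) (\<lambda>(x, t). u1 x t)"
    "integrable (PM T) (\<lambda>z. \<bar>(\<lambda>(x, t). u1 x t) z\<bar> ^ 3)"
    and l1: "(\<lambda>m. LINT z|PM T. \<bar>F1.step (r1 m) z - (\<lambda>(x, t). u1 x t) z\<bar>) \<longlonglongrightarrow> 0"
    using F1.limit_exists[OF C1] by blast
  interpret S2: discrete_family T "\<lambda>m. N (r1 m)" "\<lambda>m. NT (r1 m)" "\<lambda>m. U2 (r1 m)" "\<lambda>m. g2 (r1 m)" M2 B2 E2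
    by (rule F2.discrete_family_subseq[OF r1])
  obtain r2 u2 where r2: "strict_mono (r2::nat\<Rightarrow>nat)" and u2: "(\<lambda>(x, t). u2 x t) \<in> borel_measurable borel"
    "\<forall>t\<in>{0<..<T}. torus_fun (\<lambda>x. u2 x t)" "\<forall>x t. u2 x t \<ge> (0::real)" "integrable (PM T) (\<lambda>(x, t). u2 x t)"
    "integrable (PM T) (\<lambda>z. \<bar>(\<lambda>(x, t). u2 x t) z\<bar> ^ 3)"
    and l2: "(\<lambda>m. LINT z|PM T. \<bar>S2.step (r2 m) z - (\<lambda>(x, t). u2 x t) z\<bar>) \<longlonglongrightarrow> 0"
    using S2.limit_exists[OF C2] by blast
  define r where "r m = r1 (r2 m)" for m
  have r: "strict_mono r" using r1 r2 by (auto simp: r_def strict_mono_def)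
  have l1': "(\<lambda>m. LINT z|PM T. \<bar>F1.step (r m) z - (\<lambda>(x, t). u1 x t) z\<bar>) \<longlonglongrightarrow> 0"
    using LIMSEQ_subseq_LIMSEQ[OF l1 r2] unfolding r_def o_def .
  have l2': "(\<lambda>m. LINT z|PM T. \<bar>F2.step (r m) z - (\<lambda>(x, t). u2 x t) z\<bar>) \<longlonglongrightarrow> 0"
    using l2 unfolding r_def .
  note R1 = F1.discrete_family_subseq[OF r] and R2 = F2.discrete_family_subseq[OF r]
  \<comment> \<open>The two weak equations follow by exchanging the roles of the species.\<close>
  interpret P12: convergent_pair T "\<lambda>m. N (r m)" "\<lambda>m. NT (r m)" "\<lambda>m. U1 (r m)" "\<lambda>m. g1 (r m)" M1 B1 E1 "\<lambda>m. U2 (r m)" "\<lambda>m. g2 (r m)" M2 B2 E2 u1 u2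
    by (intro convergent_pair.intro convergent_pair_axioms.intro R1 R2) (use u1 u2 l1' l2' in auto)
  interpret P21: convergent_pair T "\<lambda>m. N (r m)" "\<lambda>m. NT (r m)" "\<lambda>m. U2 (r m)" "\<lambda>m. g2 (r m)" M2 B2 E2 "\<lambda>m. U1 (r m)" "\<lambda>m. g1 (r m)" M1 B1 E1 u2 u1
    by (intro convergent_pair.intro convergent_pair_axioms.intro R1 R2) (use u1 u2 l1' l2' in auto)
  have w1: "weak_equation T d1 d11 \<sigma>1 d12 \<rho>1 u10 u1 u2"
    by (rule P12.weak_equation_limit[OF ker(3) ker(1) data(1)]) (simp_all add: g1_def init1)
  have w2: "weak_equation T d2 d22 \<sigma>2 d21 \<rho>2 u20 u2 u1"
    by (rule P21.weak_equation_limit[OF ker(4) ker(2) data(2)]) (simp_all add: g2_def init2)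
  have sol: "distributional_solution T d1 d2 d11 d12 d21 d22 \<rho>1 \<rho>2 \<sigma>1 \<sigma>2 u10 u20 u1 u2"
    unfolding distributional_solution_def using state_fun_limit[OF u1(2,1,3,4)] state_fun_limit[OF u2(2,1,3,4)] w1 w2 by blast
  have rec: "(\<lambda>(x, t). reconstruction T (N m) (NT m) V x t) = (\<lambda>(x, t). V (kt T (NT m) t) (ix (N m) x))" for m V
    by (simp add: reconstruction_def kt_def ix_def)
  have "in_Lp p (QT T) (\<lambda>(x, t). u1 x t) \<and> in_Lp p (QT T) (\<lambda>(x, t). u2 x t) \<and>
        Lp_converges p (QT T) (\<lambda>m (x, t). reconstruction T (N (r m)) (NT (r m)) (U1 (r m)) x t) (\<lambda>(x, t). u1 x t) \<and>
        Lp_converges p (QT T) (\<lambda>m (x, t). reconstruction T (N (r m)) (NT (r m)) (U2 (r m)) x t) (\<lambda>(x, t). u2 x t)"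
    if p: "1 \<le> p" "p < 3" for p
    unfolding rec
    by (intro conjI in_Lp_QT(1)[OF borel_measurable_PM[OF u1(1)] u1(4,5) p] in_Lp_QT(1)[OF borel_measurable_PM[OF u2(1)] u2(4,5) p]
        Lp_converges_QT[OF F1.step_integrable u1(4) F1.step_cube(1) u1(5) C1 l1' p]
        Lp_converges_QT[OF F2.step_integrable u2(4) F2.step_cube(1) u2(5) C2 l2' p])
  then show ?thesis using r sol by blast
qed

end
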